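(* Let $G$ be a $3$-regular graph on $n$ vertices. If $H$ is any graph whose $(n-2)$-deck equals the $(n-2)$-deck of $G$, then $H$ is isomorphic to $G$. That is, every $3$-regular graph is $2$-reconstructible.
   Context: All graphs are finite and simple. For a graph $G$ on $n$ vertices and $k\le n$, the $k$-deck of $G$ is the multiset (of isomorphism classes) of the $\binom{n}{k}$ induced subgraphs of $G$ on $k$ vertices; its elements are called cards. A graph is $\ell$-reconstructible if it is determined up to isomorphism by its $(n-\ell)$-deck, i.e. by the multiset of induced subgraphs obtained by deleting $\ell$ vertices. *)

theory Defs
  imports "Graph_Theory.Digraph_Isomorphism" "HOL-Library.Multiset"
begin

text \<open>
  A finite simple graph is an element of the library locale \<open>graph\<close>: a finite loop-free digraph
  without parallel arcs whose arc relation is symmetric, each edge \<open>{u, v}\<close> being the pair of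
  opposite arcs \<open>(u, v)\<close> and \<open>(v, u)\<close>. Hence the degree of a vertex is its \<open>out_degree\<close>.
\<close>

definition regular_graph :: "nat \<Rightarrow> ('a, 'b) pre_digraph \<Rightarrow> bool" where
  "regular_graph d G \<longleftrightarrow> graph G \<and> (\<forall>v\<in>verts G. out_degree G v = d)"

text \<open>
  Isomorphism classes are taken inside the type of graphs with natural numbers as vertices and
  arcs, so that graphs over different vertex types can be compared. The lemmas below show that this
  loses nothing: equality of classes is isomorphism.
\<close>

definition iso_class :: "('a, 'b) pre_digraph \<Rightarrow> (nat, nat) pre_digraph set" where
  "iso_class G = {K. graph K \<and> digraph_iso G K}"

lemma iso_class_nonempty:
  assumes "graph G"
  shows "iso_class G \<noteq> {}"
proof -
  interpret graph G by fact
  obtain f :: "'a \<Rightarrow> nat" where f: "inj_on f (verts G)"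
    using finite_imp_inj_to_nat_seg[OF finite_verts] by blast
  obtain g :: "'b \<Rightarrow> nat" where g: "inj_on g (arcs G)"
    using finite_imp_inj_to_nat_seg[OF finite_arcs] by blast
  define h where "h = \<lparr>iso_verts = f, iso_arcs = g,
    iso_head = (\<lambda>e. f (head G (the_inv_into (arcs G) g e))),
    iso_tail = (\<lambda>e. f (tail G (the_inv_into (arcs G) g e)))\<rparr>"
  have h: "digraph_isomorphism h"
    using f g wf_digraph by (simp add: digraph_isomorphism_def h_def the_inv_into_f_f)
  have fin: "fin_digraph (app_iso h G)" using h ..
  interpret K: fin_digraph "app_iso h G" by (rule fin)
  have ends: "tail (app_iso h G) (g e) = f (tail G e)" "head (app_iso h G) (g e) = f (head G e)"
    if "e \<in> arcs G" for e
    using that g by (simp_all add: h_def the_inv_into_f_f)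
  have arcs: "arcs (app_iso h G) = g ` arcs G" by (simp add: h_def)
  have f_eq: "f u = f v \<longleftrightarrow> u = v" if "u \<in> verts G" "v \<in> verts G" for u v
    by (rule inj_on_eq_iff[OF f that])
  have "graph (app_iso h G)"
  proof unfold_locales
    fix e assume "e \<in> arcs (app_iso h G)"
    then obtain a where a: "a \<in> arcs G" "e = g a" unfolding arcs by blast
    then show "tail (app_iso h G) e \<noteq> head (app_iso h G) e"
      by (simp only: ends f_eq tail_in_verts head_in_verts no_loops) simp
  next
    fix e1 e2 assume "e1 \<in> arcs (app_iso h G)" "e2 \<in> arcs (app_iso h G)"
      and eq: "arc_to_ends (app_iso h G) e1 = arc_to_ends (app_iso h G) e2"
    then obtain a b where ab: "a \<in> arcs G" "e1 = g a" "b \<in> arcs G" "e2 = g b"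
      unfolding arcs by blast
    from eq have "arc_to_ends G a = arc_to_ends G b"
      using ab(1,3) unfolding ab(2,4) arc_to_ends_def prod.inject
      by (simp only: ends f_eq tail_in_verts head_in_verts)
    then have "a = b" by (rule no_multi_arcs[OF ab(1,3)])
    then show "e1 = e2" using ab by simp
  next
    show "symmetric (app_iso h G)"
      unfolding symmetric_def
    proof (rule symI)
      fix x y assume "(x, y) \<in> arcs_ends (app_iso h G)"
      then obtain a where a: "a \<in> arcs G" "x = f (tail G a)" "y = f (head G a)"
        unfolding arcs_ends_def arcs arc_to_ends_def by (auto simp only: ends prod.inject image_iff)
      then have "(head G a, tail G a) \<in> arcs_ends G"
        using sym_arcs by (auto simp: symmetric_def arcs_ends_def arc_to_ends_def dest: symD)
      then obtain b where b: "b \<in> arcs G" "tail G b = head G a" "head G b = tail G a"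
        unfolding arcs_ends_def arc_to_ends_def by (elim imageE) (simp only: prod.inject)
      have "arc_to_ends (app_iso h G) (g b) = (y, x)"
        unfolding arc_to_ends_def by (simp only: ends[OF b(1)] a(2,3) b(2,3))
      moreover have "g b \<in> arcs (app_iso h G)" unfolding arcs using b(1) by (rule imageI)
      ultimately show "(y, x) \<in> arcs_ends (app_iso h G)"
        unfolding arcs_ends_def by (rule image_eqI[OF sym])
    qed
  qed
  then have "app_iso h G \<in> iso_class G"
    using h unfolding iso_class_def digraph_iso_def by blast
  then show ?thesis by blast
qed

lemma iso_class_eq_iff:
  assumes "graph G" "graph H"
  shows "iso_class G = iso_class H \<longleftrightarrow> digraph_iso G H"
proof -
  have wf: "wf_digraph G" "wf_digraph H"
    using assms by (simp_all add: graph_def digraph_def fin_digraph_def)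
  show ?thesis
  proof
    assume eq: "iso_class G = iso_class H"
    obtain K where K: "K \<in> iso_class G" using iso_class_nonempty[OF assms(1)] by blast
    have GK: "digraph_iso G K" using K by (simp add: iso_class_def)
    have HK: "digraph_iso H K" using K[unfolded eq] by (simp add: iso_class_def)
    show "digraph_iso G H" by (rule digraph_iso_trans[OF GK digraph_iso_swap[OF wf(2) HK]])
  next
    assume GH: "digraph_iso G H"
    have "digraph_iso G K \<longleftrightarrow> digraph_iso H K" for K :: "(nat, nat) pre_digraph"
      using digraph_iso_trans[OF GH] digraph_iso_trans[OF digraph_iso_swap[OF wf(1) GH]] by (rule iffI[rotated])
    then show "iso_class G = iso_class H" by (simp add: iso_class_def)
  qed
qed

definition deck :: "nat \<Rightarrow> ('a, 'b) pre_digraph \<Rightarrow> (nat, nat) pre_digraph set multiset" where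
  "deck k G = image_mset (\<lambda>S. iso_class (G \<restriction> S)) (mset_set {S. S \<subseteq> verts G \<and> card S = k})"

end

theory Submission
  imports Defs "HOL-Combinatorics.Permutations"
begin

text \<open>
  Let \<open>G\<close> be cubic and let \<open>H\<close> have the same \<open>(n - 2)\<close>-deck. Counting edges and cherries shows that
  \<open>H\<close> is cubic. Suppose that the graphs are not isomorphic, and delete from one of them two vertices
  \<open>u\<close> and \<open>v\<close> that are adjacent or have one common neighbour. The card determines the graph up to the
  distribution of the four remaining edge ends among \<open>u\<close> and \<open>v\<close>, so exchanging one end of \<open>u\<close>
  with a suitable end of \<open>v\<close> turns \<open>G\<close> into \<open>H\<close> and vice versa.

  For consecutive vertices of a shortest cycle, one of the two possible exchanges creates a shorter
  cycle, so the exchange of their neighbours outside the cycle always switches between \<open>G\<close> and \<open>H\<close>.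
  Hence the outside neighbours can be permuted arbitrarily, and only the sign of the permutation
  matters. If the girth \<open>g\<close> is even, then rotating the cycle is an odd permutation that yields an
  isomorphic graph, a contradiction.

  If \<open>g\<close> is odd, consider an ear of a shortest cycle with as few inner vertices as possible. Permuting
  the outside neighbours, we may assume that it joins adjacent vertices of the cycle, so it has at
  least \<open>g - 2\<close> inner vertices. An exchange along an edge that leaves a shortest cycle destroys this
  cycle, and the new shortest cycle that must replace it provides an ear with at most \<open>g - 1\<close> inner
  vertices. The cycle and the ear form a theta graph, the outside neighbours of which can again be
  permuted arbitrarily. In both cases this theta graph has a reflection that acts as an odd permutation
  on its vertices of degree two.
\<close>

section \<open>Cycles in lists\<close>

text \<open>\<open>toggle\<close> by itself only offers two exchanges, one of which reaches the
  other class, and does not say which. It becomes usable where one of the two contradicts an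
  extremal choice; for this reason \<open>girth\<close> and \<open>ear_length\<close> are minima
  over both isomorphism classes at once, so that a shortcut is forbidden whichever class it appears
  in. Then the class depends only on the sign of the arrangement of outside neighbours, and any
  symmetry of the inner graph that acts oddly on the attachment vertices puts one graph into both
  classes.

  A single cycle of odd length \<open>2 * k + 1\<close> may lack such a symmetry: its rotations are
  even, and a reflection consists of \<open>k\<close> transpositions. The theta graph repairs this.
  There \<open>R\<close> has \<open>2 * k - 1\<close> vertices and the ear has
  \<open>2 * k - 1\<close> or \<open>2 * k\<close>. Exchanging the two equal paths takes
  \<open>2 * k - 1\<close> transpositions, and reversing both unequal ones takes
  \<open>(k - 1) + k\<close>, which is odd for every \<open>k\<close>.\<close>

definition cyc :: "('a \<times> 'a) set \<Rightarrow> 'a list \<Rightarrow> bool" where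
  "cyc E zs \<longleftrightarrow> distinct zs \<and> 3 \<le> length zs \<and> successively (\<lambda>x y. (x, y) \<in> E) zs
    \<and> (last zs, hd zs) \<in> E"

text \<open>Rotations bring every consecutive pair to the front, the closing one included, so no
  indices are needed. The notion speaks of the list alone and therefore commutes with
  \<open>map\<close>; this is how a vertex map is shown to preserve the edges of a cycle.\<close>

definition cadj :: "'a list \<Rightarrow> 'a \<Rightarrow> 'a \<Rightarrow> bool" where
  "cadj zs x y \<longleftrightarrow> (\<exists>n T. rotate n zs = x # y # T \<or> rotate n zs = y # x # T)"

lemma cyc_rotate1: "cyc E (rotate1 zs) \<longleftrightarrow> cyc E zs"
  by (cases zs rule: list.exhaust; cases "tl zs" rule: list.exhaust)
    (auto simp: cyc_def successively_append_iff successively_Cons)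

lemma cyc_rotate: "cyc E (rotate n zs) \<longleftrightarrow> cyc E zs"
  by (induction n) (simp_all add: cyc_rotate1)

lemma cyc_append_swap: "cyc E (xs @ ys) \<longleftrightarrow> cyc E (ys @ xs)"
  by (metis cyc_rotate rotate_append)

lemma cyc_Cons_snoc: "cyc E (x # xs) \<longleftrightarrow> cyc E (xs @ [x])"
  using cyc_append_swap[of E "[x]" xs] by simp

lemma cyc_rev:
  assumes "sym E"
  shows "cyc E (rev zs) \<longleftrightarrow> cyc E zs"
proof -
  have *: "(x, y) \<in> E \<longleftrightarrow> (y, x) \<in> E" for x y
    using assms by (auto dest: symD)
  show ?thesis
    by (cases "zs = []") (auto simp: cyc_def hd_rev last_rev * cong: conj_cong)
qed

lemma cyc_map:
  assumes "inj_on f (set zs)" "\<And>x y. x \<in> set zs \<Longrightarrow> y \<in> set zs \<Longrightarrow> (x, y) \<in> E \<Longrightarrow> (f x, f y) \<in> F"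
    and "cyc E zs"
  shows "cyc F (map f zs)"
proof -
  have "zs \<noteq> []" using assms(3) by (auto simp: cyc_def)
  moreover have "successively (\<lambda>x y. (f x, f y) \<in> F) zs"
    by (rule successively_mono[where P = "\<lambda>x y. (x, y) \<in> E"])
      (use assms in \<open>auto simp: cyc_def\<close>)
  ultimately show ?thesis
    using assms by (auto simp: cyc_def successively_map distinct_map hd_map last_map)
qed

lemma cyc_mono:
  assumes "cyc K zs" "\<And>x y. x \<in> set zs \<Longrightarrow> y \<in> set zs \<Longrightarrow> (x, y) \<in> K \<Longrightarrow> (x, y) \<in> L"
  shows "cyc L zs"
  using cyc_map[of id zs K L] assms by simp

lemma rotate_to_hd:
  assumes "x \<in> set zs"
  obtains n T where "rotate n zs = x # T" "length zs = Suc (length T)" "set zs = insert x (set T)"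
proof -
  obtain A C where zs: "zs = A @ x # C" using assms by (meson split_list)
  have "rotate (length A) zs = x # (C @ A)" unfolding zs by (simp add: rotate_append)
  then show ?thesis using that[of "length A" "C @ A"] zs by auto
qed

lemma cadj_sym: "cadj zs x y \<Longrightarrow> cadj zs y x"
  unfolding cadj_def by blast

lemma cadj_rotate: "cadj (rotate n zs) x y \<longleftrightarrow> cadj zs x y"
proof
  show "cadj zs x y" if "cadj (rotate n zs) x y"
    using that unfolding cadj_def rotate_rotate by blast
  have *: "\<exists>k. rotate k (rotate n zs) = zs"
  proof (cases "zs = []")
    case False
    then have "n \<le> n * length zs" by (cases zs) auto
    \<comment> \<open>This makes \<open>n\<close> full turns in total; the subtraction is truncated,
      hence the bound on \<open>n\<close>.\<close>
    then show ?thesis by (intro exI[of _ "n * length zs - n"]) (simp add: rotate_rotate)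
  qed simp
  then obtain k where k: "rotate k (rotate n zs) = zs" ..
  show "cadj (rotate n zs) x y" if "cadj zs x y"
    using that unfolding cadj_def by (metis k rotate_rotate)
qed

lemma cadj_map: "cadj zs x y \<Longrightarrow> cadj (map f zs) (f x) (f y)"
  unfolding cadj_def rotate_map by (metis list.simps(9))

lemma cyc_cadj:
  assumes "cyc E zs" "sym E" "cadj zs x y"
  shows "(x, y) \<in> E"
proof -
  obtain n T where "rotate n zs = x # y # T \<or> rotate n zs = y # x # T"
    using assms(3) unfolding cadj_def by blast
  moreover have "cyc E (rotate n zs)" using assms(1) by (simp add: cyc_rotate)
  ultimately show ?thesis using assms(2) by (auto simp: cyc_def dest: symD)
qed

lemma cadj_hd_next: "cadj (x # y # T) x y"
  unfolding cadj_def by (intro exI[of _ 0] exI[of _ T]) simp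

lemma cadj_hd_last: "cadj (x # T @ [y]) x y"
proof -
  have "rotate (length (x # T)) ((x # T) @ [y]) = [y] @ x # T" by (rule rotate_append)
  then show ?thesis unfolding cadj_def
    by (intro exI[of _ "length (x # T)"] exI[of _ T]) simp
qed

lemma cadj_middle: "cadj (A @ x # y # C) x y"
proof -
  have "cadj (rotate (length A) (A @ x # y # C)) x y"
    unfolding rotate_append by (simp add: cadj_hd_next)
  then show ?thesis by (simp add: cadj_rotate)
qed

lemma cyc_two_neighbours:
  assumes "cyc E zs" "x \<in> set zs"
  obtains y z where "y \<noteq> z" "y \<noteq> x" "z \<noteq> x" "y \<in> set zs" "z \<in> set zs" "cadj zs x y" "cadj zs x z"
proof -
  obtain n T where n: "rotate n zs = x # T" "set zs = insert x (set T)"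
    using assms(2) by (metis rotate_to_hd)
  have "cyc E (x # T)" using assms(1) n(1) cyc_rotate by metis
  then obtain y T' where T: "T = y # T'" "T' \<noteq> []" "distinct (x # T)"
    unfolding cyc_def by (cases T; cases "tl T") auto
  then obtain T'' z where T': "T' = T'' @ [z]" by (metis rev_exhaust)
  show ?thesis
  proof (rule that[of y z])
    have "cadj (x # y # T') x y" by (rule cadj_hd_next)
    then show "cadj zs x y" using n(1) T cadj_rotate by metis
    have "cadj (x # (y # T'') @ [z]) x z" by (rule cadj_hd_last)
    then show "cadj zs x z" using n(1) T T' cadj_rotate by (metis append_Cons)
  qed (use T T' n in auto)
qed

text \<open>\<open>last (a # A)\<close> and \<open>hd (C @ [a])\<close> also cover the cases in
  which the neighbour is \<open>a\<close> itself. They could only coincide if both were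
  \<open>a\<close>, and then the cycle would have just two vertices.\<close>

lemma cyc_split_neighbours:
  assumes "cyc K (a # A @ x # C)" "sym K"
  shows "cadj (a # A @ x # C) x (last (a # A))" "cadj (a # A @ x # C) x (hd (C @ [a]))"
    "last (a # A) \<noteq> hd (C @ [a])" "(x, last (a # A)) \<in> K" "(x, hd (C @ [a])) \<in> K"
proof -
  show 1: "cadj (a # A @ x # C) x (last (a # A))"
  proof -
    have "butlast (a # A) @ last (a # A) # x # C = (butlast (a # A) @ [last (a # A)]) @ x # C"
      by (simp only: append_assoc append_Cons append_Nil)
    also have "\<dots> = a # A @ x # C"
      by (subst append_butlast_last_id) simp_all
    finally show ?thesis
      using cadj_sym[OF cadj_middle[of "butlast (a # A)" "last (a # A)" x C]] by (simp only:)
  qed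
  show 2: "cadj (a # A @ x # C) x (hd (C @ [a]))"
  proof (cases C)
    case Nil
    then show ?thesis using cadj_sym[OF cadj_hd_last[of a A x]] by simp
  next
    case (Cons c C')
    then show ?thesis using cadj_middle[of "a # A" x c C'] by simp
  qed
  show "last (a # A) \<noteq> hd (C @ [a])"
  proof (cases C)
    case Nil
    then have "A \<noteq> []" using assms(1) by (auto simp: cyc_def)
    then have "last A \<in> set A" by simp
    then show ?thesis using assms(1) Nil by (auto simp: cyc_def)
  next
    case (Cons c C')
    moreover have "last (a # A) \<in> set (a # A)" by (rule last_in_set) simp
    ultimately show ?thesis using assms(1) by (auto simp: cyc_def)
  qed
  show "(x, last (a # A)) \<in> K" "(x, hd (C @ [a])) \<in> K"
    using cyc_cadj[OF assms] 1 2 by blast+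
qed

text \<open>As \<open>r\<close> is off the cycle, both other edges at \<open>x\<close> belong to it;
  reversing the cycle if necessary decides which of \<open>p\<close> and \<open>q\<close> comes
  first.\<close>

lemma cyc_between_neighbours:
  assumes "cyc L cs" "x \<in> set cs" "sym L" "L `` {x} = {p, q, r}" "r \<notin> set cs"
  obtains T where "cyc L (x # p # T @ [q])" "set (x # p # T @ [q]) = set cs"
proof -
  obtain n T where n: "rotate n cs = x # T" "length cs = Suc (length T)" "set cs = insert x (set T)"
    using rotate_to_hd[OF assms(2)] .
  have c: "cyc L (x # T)" using assms(1) n(1) cyc_rotate by metis
  then have "2 \<le> length T" by (simp add: cyc_def)
  then obtain y T1 where T1: "T = y # T1" "T1 \<noteq> []" by (cases T; cases "tl T") auto
  then obtain T2 z where "T1 = T2 @ [z]" by (metis rev_exhaust)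
  with T1 have T: "T = y # T2 @ [z]" by simp
  have "(x, y) \<in> L" "(x, z) \<in> L" "y \<noteq> z"
    using c assms(3) unfolding T by (auto simp: cyc_def dest: symD)
  moreover have "y \<noteq> r" "z \<noteq> r" using assms(5) n(3) unfolding T by auto
  moreover have "u = p \<or> u = q \<or> u = r" if "(x, u) \<in> L" for u using that assms(4) by blast
  ultimately consider "y = p" "z = q" | "y = q" "z = p" by metis
  then show ?thesis
  proof cases
    case 1
    then show ?thesis using that[of T2] c n(3) unfolding T by simp
  next
    case 2
    have "cyc L (rev (x # T))" using c cyc_rev[OF assms(3)] by blast
    then have "cyc L (x # p # rev T2 @ [q])" using 2 cyc_Cons_snoc[of L x] unfolding T by simp
    then show ?thesis using that[of "rev T2"] n(3) 2 unfolding T by auto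
  qed
qed

lemma ex_permutes_map:
  assumes "distinct xs" "distinct ys" "set xs = set ys"
  obtains f where "f permutes set xs" "map f xs = ys"
proof -
  have len: "length xs = length ys" using assms by (metis distinct_card)
  define f where "f = (\<lambda>x. if x \<in> set xs then the (map_of (zip xs ys) x) else x)"
  have "map f xs = ys"
    by (rule nth_equalityI) (auto simp: f_def len map_of_zip_nth[OF len assms(1)])
  moreover have "f permutes set xs"
  proof (rule bij_imp_permutes)
    have "f ` set xs = set xs" using \<open>map f xs = ys\<close> assms(3) by (metis set_map)
    then show "bij_betw f (set xs) (set xs)"
      by (simp add: bij_betw_def finite_surj_inj)
  qed (simp add: f_def)
  ultimately show ?thesis using that by blast
qed

text \<open>A vertex of degree at most one can be deleted; without such vertices, all continuations of a
  longest path stay on it and close a cycle.\<close>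
lemma dense_contains_cycle:
  assumes "finite S" "S \<noteq> {}" "sym E" "irrefl E" "2 * card S \<le> card (E \<inter> S \<times> S)"
  shows "\<exists>zs. cyc E zs \<and> set zs \<subseteq> S"
  using assms(1,2,5)
proof (induction "card S" arbitrary: S rule: less_induct)
  case less
  have irr: "(x, x) \<notin> E" for x using assms(4) by (simp add: irrefl_def)
  have sm: "(x, y) \<in> E \<Longrightarrow> (y, x) \<in> E" for x y using assms(3) by (auto dest: symD)
  show ?case
  proof (cases "\<exists>x\<in>S. card (E `` {x} \<inter> S) \<le> 1")
    case True
    then obtain x where x: "x \<in> S" "card (E `` {x} \<inter> S) \<le> 1" by blast
    let ?N = "E `` {x} \<inter> S"
    \<comment> \<open>The loss of at most one edge costs two ordered pairs, and
      \<open>2 * card S\<close> drops by two as well.\<close>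
    have "E \<inter> S \<times> S \<subseteq> (E \<inter> (S - {x}) \<times> (S - {x})) \<union> (Pair x ` ?N \<union> (\<lambda>y. (y, x)) ` ?N)"
      using sm by auto
    then have "card (E \<inter> S \<times> S) \<le> card ((E \<inter> (S - {x}) \<times> (S - {x})) \<union> (Pair x ` ?N \<union> (\<lambda>y. (y, x)) ` ?N))"
      using less.prems(1) by (intro card_mono) auto
    also have "\<dots> \<le> card (E \<inter> (S - {x}) \<times> (S - {x})) + (card (Pair x ` ?N) + card ((\<lambda>y. (y, x)) ` ?N))"
      by (meson add_mono card_Un_le le_refl le_trans)
    also have "\<dots> \<le> card (E \<inter> (S - {x}) \<times> (S - {x})) + (1 + 1)"
      using x(2) less.prems(1) by (intro add_mono le_refl) (meson card_image_le finite_Int le_trans)+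
    finally have le: "card (E \<inter> S \<times> S) \<le> card (E \<inter> (S - {x}) \<times> (S - {x})) + 2" by simp
    have c: "card S = Suc (card (S - {x}))" using less.prems(1) x(1) by (metis card.remove)
    have "S - {x} \<noteq> {}"
    proof
      assume "S - {x} = {}"
      then have "S = {x}" using x(1) by blast
      then have "E \<inter> S \<times> S = {}" using irr by auto
      then show False using less.prems(3) c by simp
    qed
    moreover have "2 * card (S - {x}) \<le> card (E \<inter> (S - {x}) \<times> (S - {x}))"
      using le c less.prems(3) by simp
    ultimately have "\<exists>zs. cyc E zs \<and> set zs \<subseteq> S - {x}"
      using less.hyps[of "S - {x}"] less.prems(1) c by simp
    then show ?thesis by blast
  next
    case False
    define paths where "paths = {zs. distinct zs \<and> set zs \<subseteq> S \<and> zs \<noteq> [] \<and> successively (\<lambda>x y. (x, y) \<in> E) zs}"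
    obtain s where s: "s \<in> S" using less.prems(2) by blast
    have ne: "paths \<noteq> {}" using s by (auto simp: paths_def intro!: exI[of _ "[s]"])
    have bound: "\<forall>zs. zs \<in> paths \<longrightarrow> length zs < Suc (card S)"
      by (auto simp: paths_def less_Suc_eq_le) (metis card_mono distinct_card less.prems(1))
    obtain zs where zs: "zs \<in> paths" "\<And>ys. ys \<in> paths \<Longrightarrow> length ys \<le> length zs"
      using ex_has_greatest_nat[of "\<lambda>zs. zs \<in> paths" _ length, OF _ bound] ne
      by (metis equals0I)
    then obtain x T where T: "zs = x # T" by (cases zs) (auto simp: paths_def)
    have xS: "x \<in> S" using zs(1) T by (auto simp: paths_def)
    have nbT: "y \<in> set T" if "y \<in> E `` {x} \<inter> S" for y
    proof (rule ccontr)
      assume "y \<notin> set T"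
      then have "y # zs \<in> paths" using that zs(1) T irr sm by (auto simp: paths_def)
      then show False using zs(2)[of "y # zs"] by simp
    qed
    have "\<exists>y \<in> E `` {x} \<inter> S. y \<noteq> hd T"
    proof (rule ccontr)
      assume "\<not> ?thesis"
      then have "E `` {x} \<inter> S \<subseteq> {hd T}" by blast
      then have "card (E `` {x} \<inter> S) \<le> 1" using card_mono[of "{hd T}"] by fastforce
      then show False using False xS by blast
    qed
    then obtain y where y: "(x, y) \<in> E" "y \<in> set T" "y \<noteq> hd T" using nbT by blast
    obtain A C where A: "T = A @ y # C" using y(2) by (meson split_list)
    have "A \<noteq> []" using A y(3) by auto
    then have "cyc E (x # A @ [y])"
      using zs(1) T A sm[OF y(1)]
      by (cases A) (auto simp: paths_def cyc_def successively_append_iff successively_Cons hd_append)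
    moreover have "set (x # A @ [y]) \<subseteq> S" using zs(1) T A by (auto simp: paths_def)
    ultimately show ?thesis by blast
  qed
qed

text \<open>A boolean stands for the sign: \<open>\<beta> = even m\<close> is \<open>\<beta>\<close>
  negated \<open>m\<close> times. Moving \<open>a\<close> to the front of \<open>xs\<close> takes
  \<open>length xs\<close> adjacent flips.\<close>

lemma flips_move:
  assumes flip: "\<And>\<beta> A a b C. Q \<beta> (A @ a # b # C) \<Longrightarrow> Q (\<not> \<beta>) (A @ b # a # C)"
    and "Q \<beta> (A @ xs @ a # C)"
  shows "Q (\<beta> = even (length xs)) (A @ a # xs @ C)"
  using assms(2)
proof (induction xs arbitrary: \<beta> A)
  case (Cons x xs)
  have "Q (\<beta> = even (length xs)) ((A @ [x]) @ a # xs @ C)"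
    using Cons.IH[of \<beta> "A @ [x]"] Cons.prems by simp
  then have "Q (\<not> (\<beta> = even (length xs))) (A @ a # x # (xs @ C))"
    by (intro flip) simp
  moreover have "(\<not> (\<beta> = even (length xs))) = (\<beta> = even (length (x # xs)))" by auto
  ultimately show ?case by (simp only: append_Cons)
qed simp

text \<open>Moving the last entry to the front and reversing the other \<open>m\<close> entries
  takes \<open>m + m * (m - 1) div 2\<close> flips, the triangular number for length
  \<open>m + 1\<close>.\<close>

lemma flips_rev:
  assumes flip: "\<And>\<beta> A a b C. Q \<beta> (A @ a # b # C) \<Longrightarrow> Q (\<not> \<beta>) (A @ b # a # C)"
    and "Q \<beta> (A @ xs @ C)"
  shows "Q (\<beta> = even (length xs * (length xs - 1) div 2)) (A @ rev xs @ C)"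
  using assms(2)
proof (induction xs arbitrary: \<beta> A rule: rev_induct)
  case (snoc x xs)
  let ?k = "length xs"
  have "Q (\<beta> = even ?k) ((A @ [x]) @ xs @ C)"
    using flips_move[of Q \<beta> A xs x C, OF flip] snoc.prems by simp
  then have "Q ((\<beta> = even ?k) = even (?k * (?k - 1) div 2)) ((A @ [x]) @ rev xs @ C)"
    by (rule snoc.IH)
  moreover have "(?k + 1) * ?k div 2 = ?k + ?k * (?k - 1) div 2"
    by (cases ?k) (auto simp: algebra_simps)
  then have "((\<beta> = even ?k) = even (?k * (?k - 1) div 2)) =
      (\<beta> = even (length (xs @ [x]) * (length (xs @ [x]) - 1) div 2))" by auto
  ultimately show ?case by simp
qed simp

text \<open>Consecutive vertices of \<open>R @ ps\<close> in a theta graph lie both on the cycle,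
  both on the ear, or on either side of the seam; \<open>theta_flip\<close> needs a separate
  argument for each.\<close>

lemma append_eq_two_Cons_cases:
  assumes "R @ ps = A @ u # v # C"
  obtains (left) C' where "R = A @ u # v # C'"
  | (between) "R = A @ [u]" "ps = v # C"
  | (right) A' where "ps = A' @ u # v # C"
  using assms by (auto simp: append_eq_append_conv2 append_eq_Cons_conv)

section \<open>Exchanging edge ends\<close>

text \<open>The equivalence is demanded for all elements of the type, not just those of
  \<open>V\<close>, so it also transports the inclusion in \<open>V \<times> V\<close>
  (\<open>cls_sub\<close>).\<close>

definition isomorphic_on :: "'a set \<Rightarrow> ('a \<times> 'a) set \<Rightarrow> ('a \<times> 'a) set \<Rightarrow> bool" where
  "isomorphic_on V K E \<longleftrightarrow> (\<exists>f. f permutes V \<and> (\<forall>x y. (x, y) \<in> K \<longleftrightarrow> (f x, f y) \<in> E))"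

text \<open>The 2-switch of graph theory: on four distinct vertices it keeps all degrees if
  \<open>ub\<close> and \<open>vd\<close> are edges and \<open>ud\<close> and \<open>vb\<close> are
  not.\<close>

definition swap_ends :: "('a \<times> 'a) set \<Rightarrow> 'a \<Rightarrow> 'a \<Rightarrow> 'a \<Rightarrow> 'a \<Rightarrow> ('a \<times> 'a) set" where
  "swap_ends K u b v d =
    (K - {(u, b), (b, u), (v, d), (d, v)}) \<union> {(u, d), (d, u), (v, b), (b, v)}"

lemma isomorphic_on_trans:
  assumes "isomorphic_on V K L" "isomorphic_on V L M"
  shows "isomorphic_on V K M"
proof -
  obtain f g where "f permutes V" "\<forall>x y. (x, y) \<in> K \<longleftrightarrow> (f x, f y) \<in> L"
    "g permutes V" "\<forall>x y. (x, y) \<in> L \<longleftrightarrow> (g x, g y) \<in> M"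
    using assms unfolding isomorphic_on_def by blast
  then show ?thesis unfolding isomorphic_on_def
    by (intro exI[of _ "g \<circ> f"]) (simp add: permutes_compose)
qed

lemma isomorphic_on_sym:
  assumes "isomorphic_on V K L"
  shows "isomorphic_on V L K"
proof -
  obtain f where "f permutes V" "\<forall>x y. (x, y) \<in> K \<longleftrightarrow> (f x, f y) \<in> L"
    using assms unfolding isomorphic_on_def by blast
  then show ?thesis unfolding isomorphic_on_def
    by (intro exI[of _ "inv f"]) (simp add: permutes_inv permutes_inverses)
qed

text \<open>Two non-isomorphic cubic graphs with the same cards, indexed by \<open>bool\<close> so that every lemma
  holds with their roles exchanged. The locale turns out to be inconsistent. A set \<open>S\<close> with \<open>card S\<close>
  equal to the girth spans a cycle iff it carries at least \<open>2 * card S\<close> ordered edges, which is why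
  such sets are counted in \<open>F_dense\<close>.\<close>
locale deck_pair =
  fixes V :: "'a set" and F :: "bool \<Rightarrow> ('a \<times> 'a) set"
  assumes finite_V: "finite V"
    and F_sub: "F \<beta> \<subseteq> V \<times> V"
    and F_sym: "sym (F \<beta>)"
    and F_irrefl: "irrefl (F \<beta>)"
    and F_cubic: "x \<in> V \<Longrightarrow> card (F \<beta> `` {x}) = 3"
    and F_card: "u \<in> V \<Longrightarrow> v \<in> V \<Longrightarrow> u \<noteq> v \<Longrightarrow>
      \<exists>f. f permutes V \<and> (\<forall>x y. x \<notin> {u, v} \<longrightarrow> y \<notin> {u, v} \<longrightarrow>
        ((x, y) \<in> F \<beta> \<longleftrightarrow> (f x, f y) \<in> F (\<not> \<beta>)))"
    and F_dense: "k \<le> card V - 2 \<Longrightarrow>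
      card {S. S \<subseteq> V \<and> card S = k \<and> 2 * k \<le> card (F \<beta> \<inter> S \<times> S)} =
      card {S. S \<subseteq> V \<and> card S = k \<and> 2 * k \<le> card (F (\<not> \<beta>) \<inter> S \<times> S)}"
    and not_iso: "\<not> isomorphic_on V (F \<beta>) (F (\<not> \<beta>))"
    and V_ne: "V \<noteq> {}"
begin

text \<open>Graphs are modified as labelled relations on the fixed set \<open>V\<close>, while only
  their isomorphism type matters; \<open>\<beta>\<close> records which of the two it is.\<close>

definition cls :: "bool \<Rightarrow> ('a \<times> 'a) set \<Rightarrow> bool" where
  "cls \<beta> K \<longleftrightarrow> isomorphic_on V K (F \<beta>)"

lemma cls_F: "cls \<beta> (F \<beta>)"
  unfolding cls_def isomorphic_on_def by (intro exI[of _ id]) (simp add: permutes_id)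

lemma cls_iso: "cls \<beta> K \<Longrightarrow> isomorphic_on V L K \<Longrightarrow> cls \<beta> L"
  unfolding cls_def by (rule isomorphic_on_trans)

lemma cls_disjoint: "cls \<beta> K \<Longrightarrow> cls (\<not> \<beta>) K \<Longrightarrow> False"
  using not_iso[of \<beta>] unfolding cls_def by (meson isomorphic_on_sym isomorphic_on_trans)

lemma cls_sub: assumes "cls \<beta> K" shows "K \<subseteq> V \<times> V"
proof -
  obtain f where f: "f permutes V" "\<forall>x y. (x, y) \<in> K \<longleftrightarrow> (f x, f y) \<in> F \<beta>"
    using assms unfolding cls_def isomorphic_on_def by blast
  show ?thesis
  proof clarify
    fix x y assume "(x, y) \<in> K"
    then have "(f x, f y) \<in> V \<times> V" using f(2) F_sub by blast
    then show "x \<in> V \<and> y \<in> V" using permutes_in_image[OF f(1)] by auto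
  qed
qed

lemma cls_sym: "cls \<beta> K \<Longrightarrow> sym K"
  using F_sym[of \<beta>] unfolding cls_def isomorphic_on_def sym_def by metis

lemma cls_irrefl: "cls \<beta> K \<Longrightarrow> (x, x) \<notin> K"
  using F_irrefl[of \<beta>] unfolding cls_def isomorphic_on_def irrefl_def by metis

lemma cls_symD: "cls \<beta> K \<Longrightarrow> (x, y) \<in> K \<Longrightarrow> (y, x) \<in> K"
  using cls_sym[of \<beta> K] by (auto dest: symD)

lemma cls_cubic:
  assumes "cls \<beta> K" "x \<in> V" shows "card (K `` {x}) = 3"
proof -
  obtain f where f: "f permutes V" "\<forall>x y. (x, y) \<in> K \<longleftrightarrow> (f x, f y) \<in> F \<beta>"
    using assms unfolding cls_def isomorphic_on_def by blast
  have "F \<beta> `` {f x} = f ` (K `` {x})"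
  proof (intro equalityI subsetI)
    fix y assume "y \<in> F \<beta> `` {f x}"
    then have "(x, inv f y) \<in> K" using f by (simp add: permutes_inverses)
    then show "y \<in> f ` (K `` {x})" using permutes_inverses(1)[OF f(1), of y] by force
  qed (use f in auto)
  moreover have "f x \<in> V" using f(1) assms(2) by (simp add: permutes_in_image)
  ultimately show ?thesis
    using F_cubic[of "f x" \<beta>] card_image[of f "K `` {x}"] permutes_inj_on[OF f(1)] by metis
qed

lemma cls_finite: "cls \<beta> K \<Longrightarrow> finite K"
  using cls_sub finite_V by (meson finite_SigmaI finite_subset)

lemma cls_finite_nbs: "cls \<beta> K \<Longrightarrow> finite (K `` A)"
  by (meson cls_sub finite_V finite_Image cls_finite)

text \<open>Relabelling the other graph along the isomorphism of cards makes it agree with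
  \<open>K\<close> literally outside \<open>u\<close> and \<open>v\<close>, so that the two
  relations can be compared vertex by vertex.\<close>

lemma other_cls:
  assumes "cls \<beta> K" "u \<in> V" "v \<in> V" "u \<noteq> v"
  obtains L where "cls (\<not> \<beta>) L"
    "\<forall>x y. x \<notin> {u, v} \<longrightarrow> y \<notin> {u, v} \<longrightarrow> ((x, y) \<in> L \<longleftrightarrow> (x, y) \<in> K)"
proof -
  obtain f where f: "f permutes V" "\<forall>x y. (x, y) \<in> K \<longleftrightarrow> (f x, f y) \<in> F \<beta>"
    using assms unfolding cls_def isomorphic_on_def by blast
  have "f u \<in> V" "f v \<in> V" "f u \<noteq> f v"
    using f(1) assms by (auto simp: permutes_in_image dest: permutes_inj injD)
  from F_card[OF this, of \<beta>] obtain h where h: "h permutes V"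
    "\<forall>x y. x \<notin> {f u, f v} \<longrightarrow> y \<notin> {f u, f v} \<longrightarrow>
        ((x, y) \<in> F \<beta> \<longleftrightarrow> (h x, h y) \<in> F (\<not> \<beta>))" by blast
  show ?thesis
  proof (rule that)
    show "cls (\<not> \<beta>) {(x, y). (h (f x), h (f y)) \<in> F (\<not> \<beta>)}"
      unfolding cls_def isomorphic_on_def
      by (intro exI[of _ "h \<circ> f"]) (simp add: permutes_compose f h)
    show "\<forall>x y. x \<notin> {u, v} \<longrightarrow> y \<notin> {u, v} \<longrightarrow>
        ((x, y) \<in> {(x, y). (h (f x), h (f y)) \<in> F (\<not> \<beta>)} \<longleftrightarrow> (x, y) \<in> K)"
      using h(2) f(2) inj_eq[OF permutes_inj[OF f(1)]] by simp
  qed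
qed

text \<open>A vertex outside \<open>{u, v}\<close> has degree three in both graphs and the same
  neighbours outside \<open>{u, v}\<close>, hence equally many neighbours in \<open>{u, v}\<close>.
  Adjacency of \<open>u\<close> and \<open>v\<close> then follows by counting the edges at
  them.\<close>

lemma other_cls_neighbours:
  assumes K: "cls \<beta> K" and L: "cls \<gamma> L" and uv: "u \<in> V" "v \<in> V" "u \<noteq> v"
    and agree: "\<forall>x y. x \<notin> {u, v} \<longrightarrow> y \<notin> {u, v} \<longrightarrow> ((x, y) \<in> L \<longleftrightarrow> (x, y) \<in> K)"
  shows "x \<notin> {u, v} \<Longrightarrow> (u, x) \<in> L \<and> (v, x) \<in> L \<longleftrightarrow> (u, x) \<in> K \<and> (v, x) \<in> K"
    and "x \<notin> {u, v} \<Longrightarrow> (u, x) \<in> L \<or> (v, x) \<in> L \<longleftrightarrow> (u, x) \<in> K \<or> (v, x) \<in> K"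
    and "(u, v) \<in> L \<longleftrightarrow> (u, v) \<in> K"
proof -
  have main: "((u, x) \<in> L \<and> (v, x) \<in> L \<longleftrightarrow> (u, x) \<in> K \<and> (v, x) \<in> K) \<and>
     ((u, x) \<in> L \<or> (v, x) \<in> L \<longleftrightarrow> (u, x) \<in> K \<or> (v, x) \<in> K)" if x: "x \<notin> {u, v}" for x
  proof (cases "x \<in> V")
    case False
    then show ?thesis using cls_sub[OF K] cls_sub[OF L] by blast
  next
    case True
    have split: "card (M `` {x}) = card (M `` {x} - {u, v}) + card (M `` {x} \<inter> {u, v})"
      if "cls b M" for b M
      using card_Int_Diff[OF cls_finite_nbs[OF that], of "{x}" "{u, v}"] by simp
    have "K `` {x} - {u, v} = L `` {x} - {u, v}" using agree x by auto
    then have c: "card (K `` {x} \<inter> {u, v}) = card (L `` {x} \<inter> {u, v})"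
      using split[OF K] split[OF L] cls_cubic[OF K True] cls_cubic[OF L True] by simp
    have int: "M `` {x} \<inter> {u, v} =
        (if (u, x) \<in> M then {u} else {}) \<union> (if (v, x) \<in> M then {v} else {})" if "sym M" for M
      using that by (auto dest: symD)
    show ?thesis
      using c uv(3) unfolding int[OF cls_sym[OF K]] int[OF cls_sym[OF L]] by (auto split: if_splits)
  qed
  then show "x \<notin> {u, v} \<Longrightarrow> (u, x) \<in> L \<and> (v, x) \<in> L \<longleftrightarrow> (u, x) \<in> K \<and> (v, x) \<in> K"
    and "x \<notin> {u, v} \<Longrightarrow> (u, x) \<in> L \<or> (v, x) \<in> L \<longleftrightarrow> (u, x) \<in> K \<or> (v, x) \<in> K"
    by blast+
  have "x \<in> L `` {u} - {v} \<union> (L `` {v} - {u}) \<longleftrightarrow> x \<in> K `` {u} - {v} \<union> (K `` {v} - {u})"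
    "x \<in> (L `` {u} - {v}) \<inter> (L `` {v} - {u}) \<longleftrightarrow> x \<in> (K `` {u} - {v}) \<inter> (K `` {v} - {u})" for x
    using main[of x] cls_irrefl[OF K, of x] cls_irrefl[OF L, of x] by auto
  then have eqs: "L `` {u} - {v} \<union> (L `` {v} - {u}) = K `` {u} - {v} \<union> (K `` {v} - {u})"
    "(L `` {u} - {v}) \<inter> (L `` {v} - {u}) = (K `` {u} - {v}) \<inter> (K `` {v} - {u})"
    by blast+
  \<comment> \<open>Six edge ends at \<open>u\<close> and \<open>v\<close> together, minus the two
    on the edge \<open>uv\<close>; a common neighbour counts twice.\<close>
  have tot: "card (M `` {u} - {v} \<union> (M `` {v} - {u})) + card ((M `` {u} - {v}) \<inter> (M `` {v} - {u}))
      = (if (u, v) \<in> M then 4 else 6)" if M: "cls b M" for b M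
  proof -
    have fin: "finite (M `` A)" for A using cls_finite_nbs[OF M] .
    have "(u, v) \<in> M \<longleftrightarrow> (v, u) \<in> M" using cls_symD[OF M] by blast
    then have c: "card (M `` {u} - {v}) = (if (u, v) \<in> M then 2 else 3)"
      "card (M `` {v} - {u}) = (if (u, v) \<in> M then 2 else 3)"
      using fin cls_cubic[OF M uv(1)] cls_cubic[OF M uv(2)] by (simp_all add: card_Diff_singleton_if)
    have "card (M `` {u} - {v} \<union> (M `` {v} - {u})) + card ((M `` {u} - {v}) \<inter> (M `` {v} - {u}))
      = card (M `` {u} - {v}) + card (M `` {v} - {u})"
      by (rule card_Un_Int[symmetric]) (simp_all only: finite_Diff fin)
    then show ?thesis unfolding c by simp
  qed
  show "(u, v) \<in> L \<longleftrightarrow> (u, v) \<in> K"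
    using tot[OF K] tot[OF L] unfolding eqs by (auto split: if_splits)
qed

lemma other_cls_differs:
  assumes K: "cls \<beta> K" and L: "cls (\<not> \<beta>) L"
    and agree: "\<forall>x y. x \<notin> {u, v} \<longrightarrow> y \<notin> {u, v} \<longrightarrow> ((x, y) \<in> L \<longleftrightarrow> (x, y) \<in> K)"
    and u: "\<And>x. (u, x) \<in> L \<longleftrightarrow> (u, x) \<in> K" and v: "\<And>x. (v, x) \<in> L \<longleftrightarrow> (v, x) \<in> K"
  shows False
proof -
  have s: "(x, y) \<in> L \<longleftrightarrow> (y, x) \<in> L" "(x, y) \<in> K \<longleftrightarrow> (y, x) \<in> K" for x y
    using cls_symD[OF K] cls_symD[OF L] by blast+
  have "(x, y) \<in> L \<longleftrightarrow> (x, y) \<in> K" for x y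
  proof (cases "x \<in> {u, v}")
    case True
    then show ?thesis using u[of y] v[of y] by blast
  next
    case False
    then show ?thesis using agree s[of x y] u[of x] v[of x] by (cases "y \<in> {u, v}") auto
  qed
  then have "L = K" by auto
  then show False using L cls_disjoint[OF K] by blast
qed

text \<open>The card does not tell \<open>u\<close> from \<open>v\<close>. If \<open>L\<close> has
  attached \<open>a\<close> to \<open>v\<close>, the transposition of \<open>u\<close> and
  \<open>v\<close> repairs this without leaving the class.\<close>

lemma other_cls_anchored:
  assumes K: "cls \<beta> K" and uv: "u \<in> V" "v \<in> V" "u \<noteq> v"
    and a: "a \<notin> {u, v}" "(u, a) \<in> K" "(v, a) \<notin> K"
  obtains L where "cls (\<not> \<beta>) L"
    "\<forall>x y. x \<notin> {u, v} \<longrightarrow> y \<notin> {u, v} \<longrightarrow> ((x, y) \<in> L \<longleftrightarrow> (x, y) \<in> K)"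
    "(u, a) \<in> L" "(v, a) \<notin> L"
proof -
  obtain L where L: "cls (\<not> \<beta>) L"
    "\<forall>x y. x \<notin> {u, v} \<longrightarrow> y \<notin> {u, v} \<longrightarrow> ((x, y) \<in> L \<longleftrightarrow> (x, y) \<in> K)"
    using other_cls[OF K uv] by blast
  note nb = other_cls_neighbours[OF K L(1) uv L(2)]
  show ?thesis
  proof (cases "(u, a) \<in> L")
    case True
    then show ?thesis using that[OF L] nb(1)[of a] a by blast
  next
    case False
    then have va: "(v, a) \<in> L" using nb(2)[of a] a by blast
    let ?t = "transpose u v"
    define M where "M = {(x, y). (?t x, ?t y) \<in> L}"
    show ?thesis
    proof (rule that[of M])
      have "isomorphic_on V M L"
        unfolding isomorphic_on_def M_def
        by (intro exI[of _ ?t]) (simp add: permutes_swap_id uv)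
      then show "cls (\<not> \<beta>) M" using L(1) cls_iso by blast
      show "\<forall>x y. x \<notin> {u, v} \<longrightarrow> y \<notin> {u, v} \<longrightarrow> ((x, y) \<in> M \<longleftrightarrow> (x, y) \<in> K)"
        using L(2) by (simp add: M_def transpose_apply_other)
      show "(u, a) \<in> M" "(v, a) \<notin> M"
        using a va False by (simp_all add: M_def transpose_apply_other)
    qed
  qed
qed

text \<open>The card without \<open>u\<close> and \<open>v\<close> determines the graph up to the partition of \<open>a, b, c, d\<close>
  into two pairs; the partition \<open>ab|cd\<close> gives back \<open>K\<close>.\<close>
lemma toggle:
  assumes K: "cls \<beta> K" and uv: "u \<noteq> v"
    and Nu: "K `` {u} = {l, a, b}" and Nv: "K `` {v} = {l', c, d}"
    and dist: "distinct [a, b, c, d]" "{a, b, c, d} \<inter> {u, v} = {}"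
    and l: "l = v \<and> l' = u \<or> l = l' \<and> l \<notin> {u, v}"
  shows "cls (\<not> \<beta>) (swap_ends K u b v d) \<or> cls (\<not> \<beta>) (swap_ends K u b v c)"
proof -
  have V: "u \<in> V" "v \<in> V" using cls_sub[OF K] Nu Nv by blast+
  have la: "l \<noteq> a" "l \<noteq> b" "l' \<noteq> c" "l' \<noteq> d"
    using cls_cubic[OF K V(1)] cls_cubic[OF K V(2)] unfolding Nu Nv
    by (auto simp: card_insert_if split: if_splits)
  have Ku: "(u, x) \<in> K \<longleftrightarrow> x \<in> {l, a, b}" and Kv: "(v, x) \<in> K \<longleftrightarrow> x \<in> {l', c, d}" for x
    using Nu Nv by blast+
  have a: "a \<notin> {u, v}" "(u, a) \<in> K" "(v, a) \<notin> K"
    using dist la l by (auto simp: Ku Kv)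
  obtain L where L: "cls (\<not> \<beta>) L"
    "\<forall>x y. x \<notin> {u, v} \<longrightarrow> y \<notin> {u, v} \<longrightarrow> ((x, y) \<in> L \<longleftrightarrow> (x, y) \<in> K)"
    "(u, a) \<in> L" "(v, a) \<notin> L"
    using other_cls_anchored[OF K V uv a] by blast
  note nb = other_cls_neighbours[OF K L(1) V uv L(2)]
  note irr = cls_irrefl[OF L(1)] and sL = cls_symD[OF L(1)] and sK = cls_symD[OF K]
  have ul: "(u, l) \<in> L" "(v, l') \<in> L"
    using l nb(1)[of l] nb(3) sL by (auto simp: Ku Kv)
  have "card (L `` {u} - {l, a}) = 1"
    using cls_cubic[OF L(1) V(1)] ul(1) L(3) la
    by (subst card_Diff_subset) (auto simp: cls_finite_nbs[OF L(1)])
  then obtain e where e: "L `` {u} - {l, a} = {e}" by (meson card_1_singletonE)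
  have Lu: "(u, x) \<in> L \<longleftrightarrow> x \<in> {l, a, e}" for x using e ul L(3) by blast
  \<comment> \<open>\<open>L\<close> is now determined by the third neighbour \<open>e\<close> of
    \<open>u\<close>: \<open>b\<close> would give back \<open>K\<close>, while \<open>c\<close> and
    \<open>d\<close> give the two exchanges.\<close>
  have "e \<in> {b, c, d}"
  proof -
    have "e \<noteq> u" using Lu[of e] irr by blast
    moreover have "e \<noteq> v" using e Lu[of v] nb(3) l Ku[of v] dist by auto
    ultimately show ?thesis using nb(2)[of e] Lu[of e] e l by (auto simp: Ku Kv)
  qed
  moreover have "e \<noteq> b"
  proof
    assume e: "e = b"
    have Lv: "(v, x) \<in> L \<longleftrightarrow> (v, x) \<in> K" for x
      using nb(1)[of x] nb(2)[of x] nb(3) Lu[of x] Ku[of x] e sL[of u v] sL[of v u] sK[of u v] sK[of v u] irr[of v]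
        cls_irrefl[OF K, of v] by blast
    then show False using other_cls_differs[OF K L(1,2)] by (simp add: Lu Ku e)
  qed
  moreover have "L = swap_ends K u b v e'" if ee: "e = e'" "e' \<in> {c, d}" for e'
  proof -
    have ne: "b \<noteq> u" "b \<noteq> v" "e' \<noteq> u" "e' \<noteq> v" "b \<noteq> e'" using dist ee(2) by auto
    have sL': "(x, y) \<in> L \<longleftrightarrow> (y, x) \<in> L" and sK': "(x, y) \<in> K \<longleftrightarrow> (y, x) \<in> K" for x y
      using sL sK by blast+
    have vu: "(v, u) \<in> L \<longleftrightarrow> (v, u) \<in> K"
      using nb(3) sL'[of u v] sK'[of u v] by blast
    have Lv: "(v, x) \<in> L \<longleftrightarrow> x = b \<or> (v, x) \<in> K \<and> x \<noteq> e'" for x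
    proof (cases "x \<in> {u, v}")
      case True
      then show ?thesis
        using vu irr[of v] cls_irrefl[OF K, of v] ne by blast
    next
      case False
      have "(v, x) \<in> L \<longleftrightarrow> ((u, x) \<in> K \<or> (v, x) \<in> K) \<and> ((u, x) \<in> L \<longrightarrow> (u, x) \<in> K \<and> (v, x) \<in> K)"
        using nb(1,2)[OF False] by blast
      moreover have "x = l \<longleftrightarrow> x = l'" using l False by blast
      moreover have "a \<notin> {b, c, d}" "b \<notin> {c, d}" "c \<noteq> d" using dist by auto
      moreover have "l' \<noteq> e'" "b \<noteq> e'" "a \<noteq> e'" using la ee(2) dist by auto
      ultimately show ?thesis
        using ee(2) la unfolding Lu Ku Kv ee(1)
        by (smt (verit) empty_iff insert_iff)
    qed
    have Lu': "(u, x) \<in> L \<longleftrightarrow> x = e' \<or> (u, x) \<in> K \<and> x \<noteq> b" for x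
      using Lu[of x] Ku[of x] ee dist la by auto
    have "(x, y) \<in> L \<longleftrightarrow> (x, y) \<in> swap_ends K u b v e'" for x y
    proof -
      consider "x = u" | "x = v" | "y = u" "x \<notin> {u, v}" | "y = v" "x \<notin> {u, v}" | "x \<notin> {u, v}" "y \<notin> {u, v}"
        by blast
      then show ?thesis
      proof cases
        case 3
        then show ?thesis using Lu'[of x] sL'[of x u] sK'[of x u] ne uv unfolding swap_ends_def by auto
      next
        case 4
        then show ?thesis using Lv[of x] sL'[of x v] sK'[of x v] ne uv unfolding swap_ends_def by auto
      next
        case 5
        then have "(x, y) \<in> L \<longleftrightarrow> (x, y) \<in> K" using L(2) by blast
        then show ?thesis using 5 ne unfolding swap_ends_def by auto
      next
        case 1
        then show ?thesis using Lu'[of y] ne uv vu sL'[of u v] sK'[of u v] unfolding swap_ends_def by auto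
      next
        case 2
        then show ?thesis using Lv[of y] ne uv vu unfolding swap_ends_def by auto
      qed
    qed
    then show ?thesis by auto
  qed
  ultimately show ?thesis using L(1) by blast
qed

text \<open>The common neighbour \<open>x\<close> leaves \<open>u\<close> and \<open>v\<close> one
  free end each. Up to exchanging \<open>u\<close> and \<open>v\<close> there is only one way to
  distribute these two ends, so the card forces \<open>L = K\<close>.\<close>

lemma triangle_free:
  assumes K: "cls \<beta> K" "(u, v) \<in> K" "(u, x) \<in> K" "(v, x) \<in> K"
  shows False
proof -
  note irr = cls_irrefl[OF K(1)] and sK = cls_symD[OF K(1)]
  have uv: "u \<in> V" "v \<in> V" "u \<noteq> v" "x \<noteq> u" "x \<noteq> v"
    using K cls_sub[OF K(1)] irr by blast+
  have "card (K `` {u} - {v, x}) = 1"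
    using cls_cubic[OF K(1) uv(1)] K uv
    by (subst card_Diff_subset) (auto simp: cls_finite_nbs[OF K(1)])
  then obtain a where a: "K `` {u} - {v, x} = {a}" by (meson card_1_singletonE)
  have "card (K `` {v} - {u, x}) = 1"
    using cls_cubic[OF K(1) uv(2)] K uv sK
    by (subst card_Diff_subset) (auto simp: cls_finite_nbs[OF K(1)])
  then obtain d where d: "K `` {v} - {u, x} = {d}" by (meson card_1_singletonE)
  have Ku: "(u, y) \<in> K \<longleftrightarrow> y \<in> {v, x, a}" for y using a K(2,3) by blast
  have Kv: "(v, y) \<in> K \<longleftrightarrow> y \<in> {u, x, d}" for y using d K(2,4) sK by blast
  have "a \<notin> {u, v}" using a irr[of u] by blast
  obtain L where L: "cls (\<not> \<beta>) L"
    "\<forall>x y. x \<notin> {u, v} \<longrightarrow> y \<notin> {u, v} \<longrightarrow> ((x, y) \<in> L \<longleftrightarrow> (x, y) \<in> K)"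
    "(u, a) \<in> L"
  proof (cases "a = d")
    case True
    obtain L where L: "cls (\<not> \<beta>) L"
      "\<forall>x y. x \<notin> {u, v} \<longrightarrow> y \<notin> {u, v} \<longrightarrow> ((x, y) \<in> L \<longleftrightarrow> (x, y) \<in> K)"
      using other_cls[OF K(1) uv(1-3)] by blast
    then show ?thesis
      using that[OF L] other_cls_neighbours(1)[OF K(1) L(1) uv(1-3) L(2) \<open>a \<notin> {u, v}\<close>] True Ku[of a] Kv[of a]
      by blast
  next
    case False
    then have "(v, a) \<notin> K" using a \<open>a \<notin> {u, v}\<close> by (auto simp: Kv)
    then show ?thesis
      using other_cls_anchored[OF K(1) uv(1-3) \<open>a \<notin> {u, v}\<close>, of thesis] that Ku[of a] by blast
  qed
  note nb = other_cls_neighbours[OF K(1) L(1) uv(1-3) L(2)]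
  note sL = cls_symD[OF L(1)] and irL = cls_irrefl[OF L(1)]
  have "{v, x, a} \<subseteq> L `` {u}"
    using nb(1)[of x] nb(3) L(3) K(2-4) uv(4,5) by blast
  moreover have "a \<noteq> v" "a \<noteq> x" using a by blast+
  then have "card {v, x, a} = 3" using uv by auto
  ultimately have "L `` {u} = {v, x, a}"
    using cls_cubic[OF L(1) uv(1)] cls_finite_nbs[OF L(1)] by (metis card_subset_eq)
  then have Lu: "(u, y) \<in> L \<longleftrightarrow> (u, y) \<in> K" for y using Ku by blast
  have Lv: "(v, y) \<in> L \<longleftrightarrow> (v, y) \<in> K" for y
  proof (cases "(u, y) \<in> K")
    case True
    then show ?thesis
      using nb(1)[of y] Lu[of y] irr[of u] irr[of v] irL[of v] by blast
  next
    case False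
    then show ?thesis
      using nb(2)[of y] nb(3) Lu[of y] sL[of u v] sK[of u v] K(2) by blast
  qed
  then show False using other_cls_differs[OF K(1) L(1,2)] Lu by simp
qed

end

section \<open>Shortest cycles\<close>

text \<open>\<open>xs\<close> lists the vertices of a set from which an edge leaves it,
  \<open>ys\<close> the outer ends of these edges in the same order, and \<open>B\<close> holds the
  edges that do not cross the boundary. Only \<open>ys\<close> varies later; its entries may
  repeat.\<close>

definition arrange :: "('a \<times> 'a) set \<Rightarrow> 'a list \<Rightarrow> 'a list \<Rightarrow> ('a \<times> 'a) set" where
  "arrange B xs ys = B \<union> set (zip xs ys) \<union> (set (zip xs ys))\<inverse>"

definition uncut :: "'a set \<Rightarrow> ('a \<times> 'a) set" where
  "uncut S = S \<times> S \<union> (- S) \<times> (- S)"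

lemma set_zip_rev: "length xs = length ys \<Longrightarrow> set (zip (rev xs) ys) = set (zip xs (rev ys))"
  by (metis length_rev rev_rev_ident set_rev zip_rev)

lemma zip_unique:
  assumes "distinct xs" "(x, a) \<in> set (zip xs ys)" "(x, b) \<in> set (zip xs ys)"
  shows "a = b"
  using assms by (auto simp: set_zip nth_eq_iff_index_eq)

lemma arrange_rev: "length xs = length ys \<Longrightarrow> arrange B (rev xs) ys = arrange B xs (rev ys)"
  unfolding arrange_def by (simp only: set_zip_rev)

lemma arrange_rotate1:
  "length xs = length ys \<Longrightarrow> arrange B (rotate1 xs) (rotate1 ys) = arrange B xs ys"
  unfolding arrange_def by (cases xs; cases ys) auto

lemma arrange_cut:
  assumes "sym K" "set xs \<subseteq> S" "set ys \<inter> S = {}"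
    and "\<And>x y. x \<in> S \<Longrightarrow> y \<notin> S \<Longrightarrow> (x, y) \<in> K \<longleftrightarrow> (x, y) \<in> set (zip xs ys)"
  shows "K = arrange (K \<inter> uncut S) xs ys"
proof -
  have s: "(x, y) \<in> K \<longleftrightarrow> (y, x) \<in> K" for x y using assms(1) by (auto dest: symD)
  have z: "x \<in> S \<and> y \<notin> S" if "(x, y) \<in> set (zip xs ys)" for x y
    using that assms(2,3) by (meson disjoint_iff set_zip_leftD set_zip_rightD subsetD)
  have "(x, y) \<in> K \<longleftrightarrow> (x, y) \<in> arrange (K \<inter> uncut S) xs ys" for x y
    using assms(4)[of x y] assms(4)[of y x] z[of x y] z[of y x] s[of x y]
    unfolding arrange_def uncut_def by auto
  then show ?thesis by auto
qed

lemma arrange_edge: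
  assumes "B \<subseteq> uncut S" "set xs \<subseteq> S" "set ys \<inter> S = {}"
  shows "x \<in> S \<Longrightarrow> y \<in> S \<Longrightarrow> (x, y) \<in> arrange B xs ys \<longleftrightarrow> (x, y) \<in> B"
    and "x \<notin> S \<Longrightarrow> y \<notin> S \<Longrightarrow> (x, y) \<in> arrange B xs ys \<longleftrightarrow> (x, y) \<in> B"
    and "x \<in> S \<Longrightarrow> y \<notin> S \<Longrightarrow> (x, y) \<in> arrange B xs ys \<longleftrightarrow> (x, y) \<in> set (zip xs ys)"
    and "x \<notin> S \<Longrightarrow> y \<in> S \<Longrightarrow> (x, y) \<in> arrange B xs ys \<longleftrightarrow> (y, x) \<in> set (zip xs ys)"
proof -
  have z: "x \<in> S \<and> y \<notin> S" if "(x, y) \<in> set (zip xs ys)" for x y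
    using that assms(2,3) by (meson disjoint_iff set_zip_leftD set_zip_rightD subsetD)
  show "x \<in> S \<Longrightarrow> y \<in> S \<Longrightarrow> (x, y) \<in> arrange B xs ys \<longleftrightarrow> (x, y) \<in> B"
    and "x \<notin> S \<Longrightarrow> y \<notin> S \<Longrightarrow> (x, y) \<in> arrange B xs ys \<longleftrightarrow> (x, y) \<in> B"
    and "x \<in> S \<Longrightarrow> y \<notin> S \<Longrightarrow> (x, y) \<in> arrange B xs ys \<longleftrightarrow> (x, y) \<in> set (zip xs ys)"
    and "x \<notin> S \<Longrightarrow> y \<in> S \<Longrightarrow> (x, y) \<in> arrange B xs ys \<longleftrightarrow> (y, x) \<in> set (zip xs ys)"
    using z[of x y] z[of y x] assms(1) unfolding arrange_def uncut_def by auto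
qed

text \<open>An exchange at consecutive entries of \<open>xs\<close> is an adjacent transposition in
  \<open>ys\<close>. Since \<open>B\<close> never crosses the boundary of \<open>S\<close>, the
  exchange removes only the edges \<open>ub\<close> and \<open>vd\<close> of the cut.\<close>

lemma swap_ends_arrange:
  assumes "B \<subseteq> uncut S" "set (A @ u # v # C) \<subseteq> S" "set (A' @ b # d # C') \<inter> S = {}"
    and "distinct (A @ u # v # C)" "length A = length A'" "b \<noteq> d"
  shows "swap_ends (arrange B (A @ u # v # C) (A' @ b # d # C')) u b v d =
    arrange B (A @ u # v # C) (A' @ d # b # C')"
proof -
  have zz: "x \<in> set A \<union> set C \<and> x \<in> S \<and> y \<notin> S" if "(x, y) \<in> set (zip A A') \<union> set (zip C C')" for x y
  proof -
    have "x \<in> set A \<union> set C" "y \<in> set A' \<union> set C'"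
      using that by (auto dest: set_zip_leftD set_zip_rightD)
    then show ?thesis using assms(2,3) by auto
  qed
  have ends: "u \<in> S" "v \<in> S" "b \<notin> S" "d \<notin> S" "u \<noteq> v" using assms by auto
  have uv: "u \<notin> set A \<union> set C" "v \<notin> set A \<union> set C" using assms(4) by auto
  have B: "(x, y) \<in> B \<Longrightarrow> x \<in> S \<longleftrightarrow> y \<in> S" for x y using assms(1) by (auto simp: uncut_def)
  let ?Z = "set (zip A A') \<union> set (zip C C')"
  have e: "arrange B (A @ u # v # C) (A' @ p # q # C') =
      B \<union> ?Z \<union> ?Z\<inverse> \<union> {(u, p), (p, u), (v, q), (q, v)}" for p q
    using assms(5) unfolding arrange_def by auto
  have "(u, b) \<notin> B \<union> ?Z \<union> ?Z\<inverse>" "(b, u) \<notin> B \<union> ?Z \<union> ?Z\<inverse>"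
    "(v, d) \<notin> B \<union> ?Z \<union> ?Z\<inverse>" "(d, v) \<notin> B \<union> ?Z \<union> ?Z\<inverse>"
    using B zz ends uv by blast+
  then have dis: "(B \<union> ?Z \<union> ?Z\<inverse>) \<inter> {(u, b), (b, u), (v, d), (d, v)} = {}" by blast
  have "B \<union> ?Z \<union> ?Z\<inverse> \<union> {(u, b), (b, u), (v, d), (d, v)} - {(u, b), (b, u), (v, d), (d, v)}
      = B \<union> ?Z \<union> ?Z\<inverse>"
    using Diff_triv[OF dis] Un_Diff[of "B \<union> ?Z \<union> ?Z\<inverse>"] by (metis Diff_cancel Un_empty_right)
  then show ?thesis unfolding e swap_ends_def by simp
qed

text \<open>\<open>f\<close> fixes everything outside \<open>S\<close>, so it carries the edge from
  \<open>x\<close> to its outer end to one from \<open>f x\<close> to the same end. Edge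
  preservation in one direction gives the converse: an injective map of the finite set of edges
  inside \<open>S\<close> into itself is onto.\<close>

lemma arrange_map_isomorphic:
  assumes "B \<subseteq> uncut S" "set xs \<subseteq> S" "set ys \<inter> S = {}" "S \<subseteq> V" "finite S"
    and f: "f permutes S" "\<And>x y. x \<in> S \<Longrightarrow> y \<in> S \<Longrightarrow> (x, y) \<in> B \<Longrightarrow> (f x, f y) \<in> B"
  shows "isomorphic_on V (arrange B xs ys) (arrange B (map f xs) ys)"
  unfolding isomorphic_on_def
proof (intro exI[of _ f] conjI allI)
  show "f permutes V" using f(1) assms(4) by (rule permutes_subset)
  have inj: "f x = f y \<longleftrightarrow> x = y" for x y using permutes_inj[OF f(1)] by (simp add: inj_eq)
  have fS: "f x \<in> S \<longleftrightarrow> x \<in> S" for x using permutes_in_image[OF f(1)] .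
  have out: "f x = x" if "x \<notin> S" for x using f(1) that by (simp add: permutes_not_in)
  have map: "set (map f xs) \<subseteq> S" using assms(2) fS by auto
  let ?P = "B \<inter> S \<times> S" and ?f = "\<lambda>(x, y). (f x, f y)"
  have img: "?f ` ?P = ?P"
  proof (rule card_subset_eq)
    show "?f ` ?P \<subseteq> ?P" using f(2) fS by auto
    show "card (?f ` ?P) = card ?P" by (rule card_image) (auto simp: inj_on_def inj)
  qed (use assms(5) in auto)
  have in_in: "(f x, f y) \<in> B \<longleftrightarrow> (x, y) \<in> B" if "x \<in> S" "y \<in> S" for x y
  proof
    assume "(f x, f y) \<in> B"
    then have "(f x, f y) \<in> ?f ` ?P" using that fS img by blast
    then show "(x, y) \<in> B" using inj by force
  qed (rule f(2)[OF that])
  have zip: "(f x, y) \<in> set (zip (map f xs) ys) \<longleftrightarrow> (x, y) \<in> set (zip xs ys)" for x y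
  proof -
    have "set (zip (map f xs) ys) = (\<lambda>(x, y). (f x, y)) ` set (zip xs ys)" by (simp add: zip_map1)
    then show ?thesis using inj by force
  qed
  note e = arrange_edge[OF assms(1-3)] and e' = arrange_edge[OF assms(1) map assms(3)]
  show "(x, y) \<in> arrange B xs ys \<longleftrightarrow> (f x, f y) \<in> arrange B (map f xs) ys" for x y
    by (cases "x \<in> S"; cases "y \<in> S") (simp_all add: e e' fS in_in out zip del: set_zip)
qed

section \<open>The girth of the pair and exchanges along a shortest cycle\<close>

context deck_pair
begin

definition girth :: nat where
  "girth = (LEAST l. \<exists>\<beta> K zs. cls \<beta> K \<and> cyc K zs \<and> length zs = l)"

lemma girth_le: "cls \<beta> K \<Longrightarrow> cyc K zs \<Longrightarrow> girth \<le> length zs"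
  unfolding girth_def by (rule Least_le) blast

lemma ex_girth_cycle: "\<exists>\<beta> K zs. cls \<beta> K \<and> cyc K zs \<and> length zs = girth"
  unfolding girth_def
proof (rule LeastI_ex)
  have "card (F True) = (\<Sum>x\<in>V. card (F True `` {x}))"
  proof -
    have "F True = (SIGMA x:V. F True `` {x})" using F_sub[of True] by auto
    then show ?thesis
      using card_SigmaI[OF finite_V, of "\<lambda>x. F True `` {x}"] cls_finite_nbs[OF cls_F] by simp
  qed
  also have "\<dots> = 3 * card V" using F_cubic by simp
  finally have "2 * card V \<le> card (F True \<inter> V \<times> V)"
    using F_sub[of True] by (simp add: inf_absorb1)
  then show "\<exists>l \<beta> K zs. cls \<beta> K \<and> cyc K zs \<and> length zs = l"
    using dense_contains_cycle[OF finite_V V_ne F_sym F_irrefl] cls_F by blast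
qed

lemma girth_ge_4: "4 \<le> girth"
proof (rule ccontr)
  assume "\<not> ?thesis"
  then obtain \<beta> K zs where K: "cls \<beta> K" "cyc K zs" "length zs < 4"
    using ex_girth_cycle by (metis not_le)
  then have "length zs = Suc (Suc (Suc 0))" by (simp add: cyc_def)
  then obtain x y z where "zs = [x, y, z]" by (auto simp: length_Suc_conv)
  then show False using K triangle_free[OF K(1), of x y z] cls_symD[OF K(1)] by (auto simp: cyc_def)
qed

lemma cyc_subset_V: "cls \<beta> K \<Longrightarrow> cyc K zs \<Longrightarrow> set zs \<subseteq> V"
proof
  fix x assume K: "cls \<beta> K" "cyc K zs" and "x \<in> set zs"
  then obtain y where "cadj zs x y" using cyc_two_neighbours by metis
  then show "x \<in> V" using cyc_cadj[OF K(2) cls_sym[OF K(1)]] cls_sub[OF K(1)] by blast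
qed

lemma neighbours_eq:
  assumes "cls \<beta> K" "(x, p) \<in> K" "(x, q) \<in> K" "(x, r) \<in> K" "distinct [p, q, r]"
  shows "K `` {x} = {p, q, r}"
proof -
  have "card {p, q, r} = card (K `` {x})"
    using assms cls_cubic[OF assms(1)] cls_sub[OF assms(1)] by auto
  then show ?thesis
    using card_subset_eq[OF cls_finite_nbs[OF assms(1)], of "{p, q, r}"] assms(2-4) by auto
qed

lemma third_neighbour:
  assumes "cls \<beta> K" "(x, p) \<in> K" "(x, q) \<in> K" "p \<noteq> q"
  obtains r where "K `` {x} = {p, q, r}" "distinct [p, q, r]"
proof -
  have "card (K `` {x} - {p, q}) = 1"
    using assms cls_cubic[OF assms(1)] cls_sub[OF assms(1)]
    by (subst card_Diff_subset) auto
  then obtain r where "K `` {x} - {p, q} = {r}" by (meson card_1_singletonE)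
  then show ?thesis using that[of r] assms by auto
qed

text \<open>A chord would close a shorter cycle, so the third edge at each vertex leaves the
  cycle.\<close>

lemma short_cycle_neighbours:
  assumes K: "cls \<beta> K" "cyc K zs" "length zs = girth" "x \<in> set zs"
  obtains y z w where "K `` {x} = {y, z, w}" "distinct [y, z, w]" "cadj zs x y" "cadj zs x z"
    "y \<in> set zs" "z \<in> set zs" "w \<notin> set zs"
proof -
  obtain n T where n: "rotate n zs = x # T" "length zs = Suc (length T)" "set zs = insert x (set T)"
    using rotate_to_hd[OF K(4)] .
  have cT: "cyc K (x # T)" using K(2) n(1) cyc_rotate by metis
  have "3 \<le> length T" using n(2) K(3) girth_ge_4 by simp
  then obtain y T1 where T1: "T = y # T1" "T1 \<noteq> []" by (cases T; cases "tl T") auto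
  then obtain T2 z where "T1 = T2 @ [z]" by (metis rev_exhaust)
  with T1 have T: "T = y # T2 @ [z]" by simp
  have yz: "(x, y) \<in> K" "(x, z) \<in> K" "y \<noteq> z"
    using cT cls_symD[OF K(1)] unfolding T by (auto simp: cyc_def)
  obtain w where w: "K `` {x} = {y, z, w}" "distinct [y, z, w]"
    using third_neighbour[OF K(1) yz] .
  have wK: "(x, w) \<in> K" using w by blast
  have "w \<noteq> x" using cls_irrefl[OF K(1)] wK by blast
  have "w \<notin> set zs"
  proof
    assume "w \<in> set zs"
    then have "w \<in> set T2" using n(3) T w(2) \<open>w \<noteq> x\<close> by auto
    then obtain P R where P: "T2 = P @ w # R" by (meson split_list)
    have "cyc K (x # y # P @ [w])"
      using cT cls_symD[OF K(1) wK] unfolding T P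
      by (auto simp: cyc_def successively_append_iff successively_Cons hd_append split: if_splits)
    then show False using girth_le[OF K(1)] K(3) n(2) unfolding T P by fastforce
  qed
  moreover have "cadj zs x y" "cadj zs x z"
    using n(1) cadj_rotate[of n zs x y] cadj_rotate[of n zs x z]
      cadj_hd_next[of x y "T2 @ [z]"] cadj_hd_last[of x "y # T2" z] by (simp_all add: T)
  ultimately show ?thesis using that[of y z w] w n(3) T by auto
qed

text \<open>The other exchange allowed by \<open>toggle\<close> would shortcut the cycle.\<close>
lemma short_cycle_flip:
  assumes K: "cls \<beta> K" "cyc K zs" "length zs = girth" "zs = A @ u # v # C"
    and b: "(u, b) \<in> K" "b \<notin> set zs" and d: "(v, d) \<in> K" "d \<notin> set zs"
  shows "cls (\<not> \<beta>) (swap_ends K u b v d)"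
proof -
  have cyc: "cyc K ((u # v # C) @ A)" using K(2,4) cyc_append_swap by blast
  have len: "2 \<le> length (C @ A)" using K(3,4) girth_ge_4 by simp
  then obtain c T where cT: "C @ A = c # T" "T \<noteq> []" by (cases "C @ A"; cases "tl (C @ A)") auto
  then obtain R a where T: "T = R @ [a]" by (metis rev_exhaust)
  have cyc': "cyc K (u # v # c # R @ [a])" using cyc cT T by simp
  have set: "set zs = set (u # v # c # R @ [a])"
    using K(4) cT T by (metis Un_commute append_Cons set_append)
  have bd: "b \<notin> set (u # v # c # R @ [a])" "d \<notin> set (u # v # c # R @ [a])"
    using b d set by blast+
  note sK = cls_symD[OF K(1)]
  have edges: "(u, v) \<in> K" "(v, c) \<in> K" "(a, u) \<in> K" "(u, a) \<in> K" "(v, u) \<in> K"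
    using cyc' sK by (auto simp: cyc_def)
  have "b \<noteq> d" using triangle_free[OF K(1) edges(1) b(1)] d(1) by blast
  have "a \<noteq> c" using cyc' by (auto simp: cyc_def)
  have "K `` {u} = {v, a, b}" "K `` {v} = {u, c, d}"
    using neighbours_eq[OF K(1) edges(1,4) b(1)] neighbours_eq[OF K(1) edges(5,2) d(1)] bd cyc'
    by (auto simp: cyc_def)
  then have "cls (\<not> \<beta>) (swap_ends K u b v d) \<or> cls (\<not> \<beta>) (swap_ends K u b v c)"
    by (intro toggle[OF K(1), where l = v and l' = u and a = a])
      (use cyc' bd \<open>b \<noteq> d\<close> \<open>a \<noteq> c\<close> in \<open>auto simp: cyc_def\<close>)
  moreover have False if L: "cls (\<not> \<beta>) (swap_ends K u b v c)"
  proof -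
    let ?L = "swap_ends K u b v c"
    have "successively (\<lambda>x y. (x, y) \<in> K) (c # R @ [a])" using cyc' by (simp add: cyc_def)
    then have "successively (\<lambda>x y. (x, y) \<in> ?L) (c # R @ [a])"
      by (rule successively_mono) (use cyc' in \<open>auto simp: swap_ends_def cyc_def\<close>)
    moreover have "(u, c) \<in> ?L" "(a, u) \<in> ?L"
      using edges cyc' bd by (auto simp: swap_ends_def cyc_def)
    ultimately have "cyc ?L (u # c # R @ [a])" using cyc' by (auto simp: cyc_def)
    moreover have "length (u # c # R @ [a]) < girth"
      using K(3,4) arg_cong[OF cT(1), of length] T by simp
    ultimately show False using girth_le[OF L] by (metis not_le)
  qed
  ultimately show ?thesis by blast
qed

text \<open>Class and list \<open>ys\<close> come last, so that fixing the other arguments yields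
  the predicate \<open>Q\<close> of \<open>flips_move\<close> and \<open>flips_rev\<close>.\<close>

definition arranged :: "('a \<times> 'a) set \<Rightarrow> 'a set \<Rightarrow> 'a list \<Rightarrow> bool \<Rightarrow> 'a list \<Rightarrow> bool" where
  "arranged B S xs \<beta> ys \<longleftrightarrow>
    cls \<beta> (arrange B xs ys) \<and> length ys = length xs \<and> set ys \<inter> S = {}"

lemma short_cycle_arranged:
  assumes K: "cls \<beta> K" "cyc K zs" "length zs = girth"
  obtains B ys where "K = arrange B zs ys" "B = K \<inter> uncut (set zs)" "cyc B zs"
    "arranged B (set zs) zs \<beta> ys"
proof -
  have "\<exists>w. w \<notin> set zs \<and> (\<forall>v. v \<notin> set zs \<longrightarrow> ((x, v) \<in> K \<longleftrightarrow> v = w))" if "x \<in> set zs" for x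
    using short_cycle_neighbours[OF K that] by (smt (verit, ccfv_threshold) Image_singleton_iff insert_iff singletonD)
  then obtain w where w: "\<And>x. x \<in> set zs \<Longrightarrow> w x \<notin> set zs"
    "\<And>x v. x \<in> set zs \<Longrightarrow> v \<notin> set zs \<Longrightarrow> (x, v) \<in> K \<longleftrightarrow> v = w x" by metis
  let ?B = "K \<inter> uncut (set zs)" and ?ys = "map w zs"
  have eq: "K = arrange ?B zs ?ys"
  proof (rule arrange_cut[OF cls_sym[OF K(1)] subset_refl])
    show "set ?ys \<inter> set zs = {}" using w(1) by auto
    show "(x, y) \<in> K \<longleftrightarrow> (x, y) \<in> set (zip zs ?ys)" if "x \<in> set zs" "y \<notin> set zs" for x y
      using w(2)[OF that] that(1) by (auto simp: zip_map2 zip_same_conv_map)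
  qed
  have "cyc ?B zs" using K(2) by (rule cyc_mono) (auto simp: uncut_def)
  then show ?thesis
    using that[OF eq refl] w(1) K(1) eq unfolding arranged_def by auto
qed

text \<open>The edges of the cycle lie in \<open>B\<close>, so it persists in every arrangement and
  remains shortest; \<open>short_cycle_flip\<close> therefore applies again after each flip, at
  every position. Equal outer ends would close a triangle.\<close>

lemma short_cycle_arranged_flip:
  assumes B: "cyc B zs" "B \<subseteq> uncut (set zs)" "length zs = girth"
    and ys: "arranged B (set zs) zs \<beta> (A @ b # d # C)"
  shows "arranged B (set zs) zs (\<not> \<beta>) (A @ d # b # C)"
proof -
  let ?K = "arrange B zs (A @ b # d # C)"
  have K: "cls \<beta> ?K" and len: "length (A @ b # d # C) = length zs"
    and dis: "set (A @ b # d # C) \<inter> set zs = {}" using ys by (auto simp: arranged_def)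
  define A' where "A' = take (length A) zs"
  have lA: "length A' = length A" using len by (simp add: A'_def)
  have "2 \<le> length (drop (length A) zs)" using len by simp
  then obtain u v C' where "drop (length A) zs = u # v # C'"
    by (metis One_nat_def Suc_1 Suc_le_length_iff)
  then have zs: "zs = A' @ u # v # C'" by (metis A'_def append_take_drop_id)
  have cyc: "cyc ?K zs" using B(1) by (rule cyc_mono) (auto simp: arrange_def)
  have e: "(u, b) \<in> ?K" "(v, d) \<in> ?K"
    using lA unfolding zs arrange_def by auto
  have bd: "b \<notin> set zs" "d \<notin> set zs" using dis by auto
  have "b \<noteq> d"
    using triangle_free[OF K, of u v b] e cyc unfolding zs
    by (auto simp: cyc_def successively_append_iff)
  then have "swap_ends ?K u b v d = arrange B zs (A @ d # b # C)"
    using swap_ends_arrange[of B "set zs" A' u v C' A b d C] B dis lA zs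
    by (auto simp: cyc_def)
  then have "cls (\<not> \<beta>) (arrange B zs (A @ d # b # C))"
    using short_cycle_flip[OF K cyc B(3) zs e(1) bd(1) e(2) bd(2)] by simp
  then show ?thesis using len dis by (auto simp: arranged_def)
qed

text \<open>A rotation of the cycle amounts to \<open>girth - 1\<close> flips.\<close>
lemma girth_odd: "odd girth"
proof
  assume even: "even girth"
  obtain \<beta> K zs where K: "cls \<beta> K" "cyc K zs" "length zs = girth" using ex_girth_cycle by blast
  obtain B ys where B: "K = arrange B zs ys" "B = K \<inter> uncut (set zs)" "cyc B zs"
    "arranged B (set zs) zs \<beta> ys"
    using short_cycle_arranged[OF K] .
  have Bs: "B \<subseteq> uncut (set zs)" using B(2) by blast
  have ys: "length ys = length zs" "set ys \<inter> set zs = {}" using B(4) by (auto simp: arranged_def)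
  have zsV: "set zs \<subseteq> V" by (rule cyc_subset_V[OF K(1,2)])
  obtain f where f: "f permutes set zs" "map f zs = rotate1 zs"
    using ex_permutes_map[of zs "rotate1 zs"] K(2) by (auto simp: cyc_def)
  \<comment> \<open>With \<open>map f zs = rotate1 zs\<close> the right-hand graph is
    \<open>K\<close> again, both lists being rotated. Hence rotating \<open>ys\<close> alone stays
    in the class of \<open>K\<close>.\<close>
  have "isomorphic_on V (arrange B zs (rotate1 ys)) (arrange B (map f zs) (rotate1 ys))"
  proof (rule arrange_map_isomorphic[OF Bs subset_refl _ zsV _ f(1)])
    show "(f x, f y) \<in> B" if "x \<in> set zs" "y \<in> set zs" "(x, y) \<in> B" for x y
    proof -
      have "(x, y) \<in> K" using that(3) B(2) by blast
      obtain p q w where pq: "K `` {x} = {p, q, w}" "cadj zs x p" "cadj zs x q" "w \<notin> set zs"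
        using short_cycle_neighbours[OF K \<open>x \<in> set zs\<close>] by metis
      have "y \<in> {p, q, w}" using \<open>(x, y) \<in> K\<close> pq(1) by blast
      then have "cadj zs x y" using pq \<open>y \<in> set zs\<close> by blast
      then have "cadj (rotate1 zs) (f x) (f y)" using cadj_map[of zs x y f] f(2) by simp
      moreover have "sym B" using B(2) cls_sym[OF K(1)] by (auto simp: uncut_def sym_def)
      moreover have "cyc B (rotate1 zs)" using B(3) cyc_rotate1 by blast
      ultimately show ?thesis using cyc_cadj by metis
    qed
  qed (use ys in auto)
  then have "cls \<beta> (arrange B zs (rotate1 ys))"
    using cls_iso K(1) B(1) arrange_rotate1[OF ys(1)[symmetric]] f(2) by simp
  then have "arranged B (set zs) zs \<beta> (rotate1 ys)"
    using ys by (simp add: arranged_def)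
  moreover have "ys \<noteq> []" using ys K(2) by (auto simp: cyc_def)
  then have "rotate1 ys = [] @ tl ys @ hd ys # []" "ys = [] @ hd ys # tl ys @ []"
    by (simp_all add: rotate1_hd_tl)
  ultimately have "arranged B (set zs) zs (\<beta> = even (length (tl ys))) ys"
    using flips_move[of "arranged B (set zs) zs" \<beta> "[]" "tl ys" "hd ys" "[]"]
      short_cycle_arranged_flip[OF B(3) Bs K(3)] by metis
  moreover have "odd (length (tl ys))"
    using even ys(1) K(3) girth_ge_4 by simp
  then have "(\<beta> = even (length (tl ys))) = (\<not> \<beta>)" by blast
  ultimately have "arranged B (set zs) zs (\<not> \<beta>) ys" by (simp only:)
  then have "cls (\<not> \<beta>) (arrange B zs ys)" unfolding arranged_def by blast
  then show False using cls_disjoint K(1) B(1) by blast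
qed

section \<open>Shortest ears\<close>

text \<open>The end vertices \<open>x\<close> and \<open>y\<close> of an ear are not counted in \<open>ps\<close>.\<close>
definition ear :: "('a \<times> 'a) set \<Rightarrow> 'a list \<Rightarrow> 'a \<Rightarrow> 'a list \<Rightarrow> 'a \<Rightarrow> bool" where
  "ear K zs x ps y \<longleftrightarrow> cyc K zs \<and> length zs = girth \<and> x \<in> set zs \<and> y \<in> set zs \<and> x \<noteq> y \<and>
    ps \<noteq> [] \<and> distinct ps \<and> set ps \<inter> set zs = {} \<and> successively (\<lambda>x y. (x, y) \<in> K) ps \<and>
    (x, hd ps) \<in> K \<and> (last ps, y) \<in> K"

definition ear_length :: nat where
  "ear_length = (LEAST l. \<exists>\<beta> K zs x ps y. cls \<beta> K \<and> ear K zs x ps y \<and> length ps = l)"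

lemma ear_length_le: "cls \<beta> K \<Longrightarrow> ear K zs x ps y \<Longrightarrow> ear_length \<le> length ps"
  unfolding ear_length_def by (rule Least_le) blast

lemma ear_rotate: "ear K (rotate n zs) x ps y \<longleftrightarrow> ear K zs x ps y"
  by (simp add: ear_def cyc_rotate)

text \<open>The inner vertices of an ear avoid the cycle, so rearranging the outer ends does not
  touch the inner path. The outer end at \<open>y\<close> is moved to the position next to
  \<open>x\<close>; the parity of this move decides \<open>\<gamma>\<close>, which is left
  open.\<close>

lemma ear_adjacent:
  assumes K: "cls \<beta> K" and ear: "ear K zs x ps y"
  obtains \<gamma> L z R where "cls \<gamma> L" "ear L (x # z # R) x ps z"
proof -
  obtain n T where n: "rotate n zs = x # T" "length zs = Suc (length T)" "set zs = insert x (set T)"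
    using rotate_to_hd[of x zs] ear by (metis ear_def)
  let ?zs = "x # T"
  have ear': "ear K ?zs x ps y" using ear n(1) ear_rotate by metis
  then have cyc: "cyc K ?zs" "length ?zs = girth" and ends: "y \<in> set T" "x \<noteq> y"
    "(x, hd ps) \<in> K" "(last ps, y) \<in> K" and ps: "ps \<noteq> []" "distinct ps" "set ps \<inter> set ?zs = {}"
    "successively (\<lambda>x y. (x, y) \<in> K) ps"
    by (auto simp: ear_def)
  obtain B ys where B: "K = arrange B ?zs ys" "B = K \<inter> uncut (set ?zs)" "cyc B ?zs"
    "arranged B (set ?zs) ?zs \<beta> ys"
    using short_cycle_arranged[OF K cyc] .
  have Bs: "B \<subseteq> uncut (set ?zs)" using B(2) by blast
  have ys: "length ys = length ?zs" "set ys \<inter> set ?zs = {}" using B(4) by (auto simp: arranged_def)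
  obtain T1 T2 where T: "T = T1 @ y # T2" using ends(1) by (meson split_list)
  obtain w W where W: "ys = w # W" "length W = length T" using ys(1) by (cases ys) auto
  define W1 where "W1 = take (length T1) W"
  define W2 where "W2 = drop (Suc (length T1)) W"
  define w' where "w' = W ! length T1"
  have W': "W = W1 @ w' # W2" "length W1 = length T1"
    using W(2) T by (simp_all add: W1_def W2_def w'_def id_take_nth_drop)
  have edges: "(p, q) \<in> K \<longleftrightarrow> (p, q) \<in> set (zip ?zs ys)" if "p \<in> set ?zs" "q \<notin> set ?zs" for p q
    using arrange_edge(3)[OF Bs subset_refl ys(2) that] B(1) by metis
  have out: "hd ps \<notin> set ?zs" "last ps \<notin> set ?zs"
    using ps(3) hd_in_set[OF ps(1)] last_in_set[OF ps(1)] by blast+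
  have dz: "distinct ?zs" using cyc by (simp add: cyc_def)
  have "(x, hd ps) \<in> set (zip ?zs ys)" using edges[OF _ out(1)] ends by simp
  moreover have "(x, w) \<in> set (zip ?zs ys)" using W by simp
  ultimately have w: "hd ps = w" by (rule zip_unique[OF dz])
  have "(y, last ps) \<in> set (zip ?zs ys)"
    using edges[OF _ out(2), of y] ends cls_symD[OF K] by auto
  moreover have "(y, w') \<in> set (zip ?zs ys)" using W W' T by simp
  ultimately have w': "last ps = w'" by (rule zip_unique[OF dz])
  have "arranged B (set ?zs) ?zs \<beta> ([w] @ W1 @ w' # W2)" using B(4) W(1) W'(1) by simp
  then obtain \<gamma> where \<gamma>: "arranged B (set ?zs) ?zs \<gamma> ([w] @ w' # W1 @ W2)"
    using flips_move[of "arranged B (set ?zs) ?zs" \<beta> "[w]" W1 w' W2]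
      short_cycle_arranged_flip[OF B(3) Bs cyc(2)] by metis
  obtain z R where T': "T = z # R" using ends(1) by (cases T) auto
  let ?L = "arrange B ?zs ([w] @ w' # W1 @ W2)"
  have L: "cls \<gamma> ?L" and dis: "set ([w] @ w' # W1 @ W2) \<inter> set ?zs = {}"
    using \<gamma> by (auto simp: arranged_def)
  have "cyc ?L ?zs" using B(3) by (rule cyc_mono) (auto simp: arrange_def)
  moreover have "(x, hd ps) \<in> ?L" "(z, last ps) \<in> ?L"
    using w w' T' unfolding arrange_def by simp_all
  moreover have "successively (\<lambda>x y. (x, y) \<in> ?L) ps"
  proof (rule successively_mono[OF ps(4)])
    fix p q assume "p \<in> set ps" "q \<in> set ps" "(p, q) \<in> K"
    then have "p \<notin> set ?zs" "q \<notin> set ?zs" using ps(3) by auto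
    then show "(p, q) \<in> ?L"
      using \<open>(p, q) \<in> K\<close> arrange_edge(2)[OF Bs subset_refl dis] B(2) by (auto simp: uncut_def)
  qed
  ultimately have "ear ?L ?zs x ps z"
    using cyc(2) ps dz T' cls_symD[OF L] unfolding ear_def by auto
  then show ?thesis using that[OF L] T' by simp
qed

text \<open>By permuting the outside neighbours of the cycle one may assume that the ear joins adjacent
  vertices, so that it closes a cycle.\<close>
lemma girth_le_ear:
  assumes K: "cls \<beta> K" "ear K zs x ps y"
  shows "girth \<le> length ps + 2"
proof -
  obtain \<gamma> L z R where L: "cls \<gamma> L" "ear L (x # z # R) x ps z" using ear_adjacent[OF K] .
  have "(z, x) \<in> L" "x \<noteq> z" "ps \<noteq> []" "distinct ps" "x \<notin> set ps" "z \<notin> set ps"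
    "successively (\<lambda>x y. (x, y) \<in> L) ps" "(x, hd ps) \<in> L" "(last ps, z) \<in> L"
    using L(2) cls_symD[OF L(1), of x z] by (simp_all add: ear_def cyc_def)
  moreover from \<open>ps \<noteq> []\<close> have "1 \<le> length ps" by (cases ps) simp_all
  ultimately have "cyc L (x # ps @ [z])"
    by (simp add: cyc_def successively_append_iff successively_Cons)
  then show ?thesis using girth_le[OF L(1)] by fastforce
qed

text \<open>If at most one vertex were off a shortest cycle, all third edges would end there, and it
  would have degree at least four. The bound makes \<open>F_dense\<close> applicable to the vertex
  sets of shortest cycles.\<close>

lemma girth_le_card: "girth \<le> card V - 2"
proof (rule ccontr)
  assume g: "\<not> ?thesis"
  obtain \<beta> K zs where K: "cls \<beta> K" "cyc K zs" "length zs = girth" using ex_girth_cycle by blast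
  have zV: "set zs \<subseteq> V" using cyc_subset_V[OF K(1,2)] .
  have card_zs: "card (set zs) = girth" using K by (metis cyc_def distinct_card)
  have "card (V - set zs) \<le> 1"
    using g card_zs card_Diff_subset[OF _ zV] by simp
  then have one: "p = q" if "p \<in> V - set zs" "q \<in> V - set zs" for p q
    using that finite_V by (metis card_le_Suc0_iff_eq finite_Diff One_nat_def)
  have out: "\<exists>w. (x, w) \<in> K \<and> w \<in> V - set zs" if "x \<in> set zs" for x
    using short_cycle_neighbours[OF K that] cls_sub[OF K(1)] by blast
  have "zs \<noteq> []" using K by (auto simp: cyc_def)
  then obtain w where w: "w \<in> V - set zs" using out[of "hd zs"] by auto
  have "set zs \<subseteq> K `` {w}"
    using out one[OF w] cls_symD[OF K(1)] by blast
  then have "girth \<le> 3"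
    using card_mono[OF cls_finite_nbs[OF K(1)], of "set zs" "{w}"] cls_cubic[OF K(1), of w] w card_zs
    by simp
  then show False using girth_ge_4 by simp
qed

section \<open>Counting shortest cycles to obtain a short ear\<close>

definition dense :: "('a \<times> 'a) set \<Rightarrow> 'a set set" where
  "dense K = {S. S \<subseteq> V \<and> card S = girth \<and> 2 * girth \<le> card (K \<inter> S \<times> S)}"

lemma finite_dense: "finite (dense K)"
  unfolding dense_def by (rule finite_subset[of _ "Pow V"]) (auto simp: finite_V)

lemma card_dense_F:
  assumes "cls \<beta> K"
  shows "card (dense K) = card (dense (F \<beta>))"
proof -
  obtain f where f: "f permutes V" "\<forall>x y. (x, y) \<in> K \<longleftrightarrow> (f x, f y) \<in> F \<beta>"
    using assms unfolding cls_def isomorphic_on_def by blast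
  have inj: "inj_on f S" for S using permutes_inj_on[OF f(1)] .
  have c: "card (K \<inter> S \<times> S) = card (F \<beta> \<inter> (f ` S) \<times> (f ` S))" for S
  proof -
    have "F \<beta> \<inter> (f ` S) \<times> (f ` S) = map_prod f f ` (K \<inter> S \<times> S)" using f(2) by fastforce
    moreover have "inj (map_prod f f)" using permutes_inj[OF f(1)] by (simp add: prod.inj_map)
    ultimately show ?thesis by (simp add: card_image inj_on_subset[OF _ subset_UNIV])
  qed
  have "dense (F \<beta>) = (`) f ` dense K"
  proof (intro equalityI subsetI)
    fix S assume S: "S \<in> dense (F \<beta>)"
    have "f ` inv f ` S = S" using permutes_inverses(1)[OF f(1)] by (simp add: image_image)
    moreover have "inv f ` S \<subseteq> V"
      using S permutes_image[OF permutes_inv[OF f(1)]] by (auto simp: dense_def)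
    ultimately have "inv f ` S \<in> dense K"
      using S c[of "inv f ` S"] card_image[OF inj, of "inv f ` S"] by (simp add: dense_def)
    then show "S \<in> (`) f ` dense K" using \<open>f ` inv f ` S = S\<close> by (metis imageI)
  next
    fix S assume "S \<in> (`) f ` dense K"
    then obtain T where T: "S = f ` T" "T \<in> dense K" by blast
    moreover have "f ` T \<subseteq> V" using T(2) permutes_image[OF f(1)] by (auto simp: dense_def)
    ultimately show "S \<in> dense (F \<beta>)" using c[of T] card_image[OF inj, of T] by (simp add: dense_def)
  qed
  moreover have "inj_on ((`) f) (dense K)"
    using permutes_inj[OF f(1)] by (simp add: inj_on_def inj_image_eq_iff)
  ultimately show ?thesis by (simp add: card_image)
qed

lemma card_dense: "cls \<beta> K \<Longrightarrow> cls (\<not> \<beta>) L \<Longrightarrow> card (dense K) = card (dense L)"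
  using card_dense_F[of \<beta> K] card_dense_F[of "\<not> \<beta>" L] F_dense[OF girth_le_card, of \<beta>]
  by (simp add: dense_def)

text \<open>The path is cut at its first return \<open>y\<close> to the cycle. Prefixing
  \<open>v\<close> adds one inner vertex, but \<open>y\<close> is not an inner vertex; hence the
  bound \<open>length Q\<close>.\<close>

lemma ear_from_walk:
  assumes K: "cls \<beta> K" "cyc K zs" "length zs = girth"
    and u: "u \<in> set zs" "(u, v) \<in> K" "v \<notin> set zs" "(v, hd Q) \<in> K"
    and Q: "distinct Q" "successively (\<lambda>x y. (x, y) \<in> K) Q" "Q \<noteq> []" "last Q \<in> set zs"
      "u \<notin> set Q" "v \<notin> set Q"
  shows "\<exists>ps y. ear K zs u ps y \<and> length ps \<le> length Q"
proof -
  let ?P = "takeWhile (\<lambda>x. x \<notin> set zs) Q"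
  have "dropWhile (\<lambda>x. x \<notin> set zs) Q \<noteq> []"
    using Q(3,4) by (metis dropWhile_eq_Nil_conv last_in_set)
  then obtain y R where y: "dropWhile (\<lambda>x. x \<notin> set zs) Q = y # R" by (meson neq_Nil_conv)
  then have eq: "Q = ?P @ y # R" by (metis takeWhile_dropWhile_id)
  have yz: "y \<in> set zs" using hd_dropWhile[of "\<lambda>x. x \<notin> set zs" Q] y by simp
  have yu: "y \<noteq> u" using eq Q(5) by (metis in_set_conv_decomp)
  have out: "\<forall>x\<in>set ?P. x \<notin> set zs" by (auto dest: set_takeWhileD)
  have "v \<notin> set ?P" using Q(6) by (meson set_takeWhileD)
  moreover have "distinct ?P" using Q(1) by (rule distinct_takeWhile)
  moreover have "successively (\<lambda>x y. (x, y) \<in> K) (v # Q)" using Q(2,3) u(4) by (simp add: successively_Cons)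
  then have "successively (\<lambda>x y. (x, y) \<in> K) ((v # ?P) @ y # R)" using eq by simp
  then have "successively (\<lambda>x y. (x, y) \<in> K) (v # ?P)" "(last (v # ?P), y) \<in> K"
    unfolding successively_append_iff by simp_all
  ultimately have "ear K zs u (v # ?P) y"
    unfolding ear_def using K u yz yu out by auto
  moreover have "length (v # ?P) \<le> length Q" using arg_cong[OF eq, of length] by simp
  ultimately show ?thesis by blast
qed

text \<open>Swapping the edge \<open>ub\<close> of a shortest cycle for \<open>uc\<close> destroys that cycle. Since both graphs
  have equally many shortest cycles, a new one appears, and it contains exactly one of \<open>u\<close>
  and \<open>v\<close>; together with the edge \<open>uv\<close> it yields the ear.\<close>
lemma short_ear_if_swap:
  assumes K: "cls \<beta> K" "cyc K zs" "length zs = girth" and L: "cls (\<not> \<beta>) (swap_ends K u b v c)"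
    and u: "K `` {u} = {v, a, b}" "u \<in> set zs" "a \<in> set zs" "b \<in> set zs"
    and v: "K `` {v} = {u, c, d}" "v \<notin> set zs" and dist: "distinct [u, v, a, b, c, d]"
  shows "\<exists>ps y. ear K zs u ps y \<and> length ps \<le> girth - 1"
proof (cases "c \<in> set zs")
  case True
  have "ear K zs u [v] c"
    using True K u v dist unfolding ear_def by auto
  then show ?thesis using girth_ge_4 by fastforce
next
  case False
  let ?L = "swap_ends K u b v c"
  have e: "(x, y) \<in> ?L \<longleftrightarrow> (x, y) \<in> K \<and> (x, y) \<notin> {(u, b), (b, u), (v, c), (c, v)} \<or>
      (x, y) \<in> {(u, c), (c, u), (v, b), (b, v)}" for x y
    by (auto simp: swap_ends_def)
  have Ku: "(u, x) \<in> K \<longleftrightarrow> x \<in> {v, a, b}" and Kv: "(v, x) \<in> K \<longleftrightarrow> x \<in> {u, c, d}" for x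
    using u(1) v(1) by blast+
  have Lu: "?L `` {u} = {c, a, v}" and Lv: "?L `` {v} = {d, b, u}"
    using dist unfolding set_eq_iff Image_singleton_iff e Ku Kv by auto
  let ?Z = "set zs"
  have card_Z: "card ?Z = girth" using K by (metis cyc_def distinct_card)
  have ZV: "?Z \<subseteq> V" using cyc_subset_V[OF K(1,2)] .
  have "card (K \<inter> ?Z \<times> ?Z) = (\<Sum>x\<in>?Z. card (K `` {x} \<inter> ?Z))"
  proof -
    have "K \<inter> ?Z \<times> ?Z = (SIGMA x:?Z. K `` {x} \<inter> ?Z)" by auto
    then show ?thesis by (simp add: card_SigmaI)
  qed
  also have "\<dots> = (\<Sum>x\<in>?Z. 2)"
  proof (rule sum.cong[OF refl])
    fix x assume "x \<in> ?Z"
    then obtain p q w where *: "K `` {x} = {p, q, w}" "distinct [p, q, w]" "p \<in> ?Z" "q \<in> ?Z" "w \<notin> ?Z"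
      using short_cycle_neighbours[OF K] by metis
    then have "K `` {x} \<inter> ?Z = {p, q}" by auto
    then show "card (K `` {x} \<inter> ?Z) = 2" using * by simp
  qed
  finally have cK: "card (K \<inter> ?Z \<times> ?Z) = 2 * girth" using card_Z by simp
  then have ZK: "?Z \<in> dense K" using ZV card_Z by (simp add: dense_def)
  have "?L \<inter> ?Z \<times> ?Z \<subset> K \<inter> ?Z \<times> ?Z"
  proof
    show "?L \<inter> ?Z \<times> ?Z \<subseteq> K \<inter> ?Z \<times> ?Z" using e False v(2) by auto
    have "(u, b) \<in> K \<inter> ?Z \<times> ?Z" using u by auto
    moreover have "(u, b) \<notin> ?L" unfolding e using dist by auto
    ultimately show "?L \<inter> ?Z \<times> ?Z \<noteq> K \<inter> ?Z \<times> ?Z" by blast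
  qed
  then have "card (?L \<inter> ?Z \<times> ?Z) < 2 * girth"
    using psubset_card_mono[of "K \<inter> ?Z \<times> ?Z"] cK by simp
  then have "?Z \<notin> dense ?L" by (simp add: dense_def)
  then have "\<not> dense ?L \<subseteq> dense K"
    using ZK card_subset_eq[OF finite_dense] card_dense[OF K(1) L] by metis
  then obtain Y where Y: "Y \<in> dense ?L" "Y \<notin> dense K" by blast
  then have YV: "Y \<subseteq> V" "card Y = girth" and YL: "2 * card Y \<le> card (?L \<inter> Y \<times> Y)"
    and YK: "card (K \<inter> Y \<times> Y) < card (?L \<inter> Y \<times> Y)"
    by (auto simp: dense_def)
  have finY: "finite Y" using YV(1) finite_V by (rule finite_subset)
  \<comment> \<open>If \<open>Y\<close> contained both or neither of them, then \<open>vb\<close>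
    would be new inside \<open>Y\<close> only where \<open>ub\<close> was lost, and
    \<open>uc\<close> only where \<open>vc\<close> was lost, so that \<open>Y\<close> would have at
    least as many edges in \<open>K\<close>.\<close>
  have one: "\<not> (u \<in> Y \<longleftrightarrow> v \<in> Y)"
  proof
    assume uv: "u \<in> Y \<longleftrightarrow> v \<in> Y"
    define del where "del = (if b \<in> Y \<and> u \<in> Y then {(u, b), (b, u)} else {}) \<union>
      (if c \<in> Y \<and> u \<in> Y then {(v, c), (c, v)} else {})"
    define new where "new = (if c \<in> Y \<and> u \<in> Y then {(u, c), (c, u)} else {}) \<union>
      (if b \<in> Y \<and> u \<in> Y then {(v, b), (b, v)} else {})"
    have "card new = card del" using dist by (auto simp: new_def del_def card_insert_if)
    have "(c, v) \<in> K" "(b, u) \<in> K" "(v, c) \<in> K" "(u, b) \<in> K"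
      using cls_symD[OF K(1)] Ku Kv by blast+
    then have del: "del \<subseteq> K \<inter> Y \<times> Y" using uv by (simp add: del_def)
    have "?L \<inter> Y \<times> Y \<subseteq> (K \<inter> Y \<times> Y - del) \<union> new"
    proof
      fix p assume "p \<in> ?L \<inter> Y \<times> Y"
      then obtain x y where p: "p = (x, y)" "(x, y) \<in> ?L" "x \<in> Y" "y \<in> Y" by auto
      have "(x, y) \<in> new" if "(x, y) \<in> {(u, c), (c, u), (v, b), (b, v)}"
        using that p(3,4) uv by (elim insertE) (simp_all add: new_def)
      moreover have "(x, y) \<notin> del" if "(x, y) \<notin> {(u, b), (b, u), (v, c), (c, v)}"
        using that by (simp add: del_def)
      ultimately show "p \<in> (K \<inter> Y \<times> Y - del) \<union> new" using p e[of x y] by blast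
    qed
    then have "card (?L \<inter> Y \<times> Y) \<le> card ((K \<inter> Y \<times> Y - del) \<union> new)"
      using finY by (intro card_mono) (simp_all add: new_def)
    also have "\<dots> \<le> card (K \<inter> Y \<times> Y - del) + card new" by (rule card_Un_le)
    also have "\<dots> = card (K \<inter> Y \<times> Y)"
      using del finY card_mono[OF _ del] \<open>card new = card del\<close>
      by (simp add: card_Diff_subset del_def)
    finally have "card (?L \<inter> Y \<times> Y) \<le> card (K \<inter> Y \<times> Y)" .
    then show False using YK by simp
  qed
  have "Y \<noteq> {}" using YV(2) girth_ge_4 by auto
  then obtain cs where cs: "cyc ?L cs" "set cs \<subseteq> Y"
    using dense_contains_cycle[OF finY _ cls_sym[OF L] _ YL] cls_irrefl[OF L]
    by (auto simp: irrefl_def)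
  have "card (set cs) = length cs" using cs(1) by (simp add: cyc_def distinct_card)
  \<comment> \<open>A cycle inside \<open>Y\<close> has at least \<open>girth = card Y\<close>
    vertices, so it runs through all of \<open>Y\<close>.\<close>
  then have "card Y \<le> card (set cs)" using girth_le[OF L cs(1)] YV(2) by simp
  then have setcs: "set cs = Y" using cs(2) finY by (simp add: card_seteq)
  have toK: "successively (\<lambda>x y. (x, y) \<in> K) Q"
    if "successively (\<lambda>x y. (x, y) \<in> ?L) Q" "u \<notin> set Q" "v \<notin> set Q" for Q
    by (rule successively_mono[OF that(1)]) (use that e in auto)
  \<comment> \<open>All edges in which \<open>K\<close> and \<open>?L\<close> differ meet
    \<open>u\<close> or \<open>v\<close>. In both uses \<open>s\<close> is the one of these two that
    lies on the new cycle; dropping it leaves a path of \<open>K\<close> with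
    \<open>girth - 1\<close> vertices that is entered from \<open>v\<close> and ends on the old
    cycle.\<close>
  have ear: ?thesis if Q: "cyc ?L (s # p # T @ [q])" "set (s # p # T @ [q]) = Y"
    "(v, p) \<in> K" "q \<in> ?Z" "u \<notin> set (p # T @ [q])" "v \<notin> set (p # T @ [q])" for s p T q
  proof -
    let ?Q = "p # T @ [q]"
    have "successively (\<lambda>x y. (x, y) \<in> ?L) ?Q" using Q(1) by (simp add: cyc_def)
    then have "successively (\<lambda>x y. (x, y) \<in> K) ?Q" using toK Q by blast
    moreover have "length ?Q = girth - 1"
      using Q(1,2) YV(2) distinct_card[of "s # ?Q"] by (auto simp: cyc_def)
    ultimately show ?thesis
      using ear_from_walk[OF K u(2) _ v(2), of ?Q] Q Ku[of v] by (auto simp: cyc_def)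
  qed
  show ?thesis
  proof (cases "u \<in> Y")
    case True
    then have "v \<notin> set cs" using one setcs by blast
    then obtain T where T: "cyc ?L (u # c # T @ [a])" "set (u # c # T @ [a]) = set cs"
      using cyc_between_neighbours[OF cs(1) _ cls_sym[OF L] Lu] True setcs by metis
    show ?thesis
      by (rule ear[OF T(1)]) (use T setcs u Kv True one in \<open>auto simp: cyc_def\<close>)
  next
    case False
    then have "v \<in> set cs" "u \<notin> set cs" using one setcs by blast+
    then obtain T where T: "cyc ?L (v # d # T @ [b])" "set (v # d # T @ [b]) = set cs"
      using cyc_between_neighbours[OF cs(1) _ cls_sym[OF L] Lv] by metis
    show ?thesis
      by (rule ear[OF T(1)]) (use T setcs u Kv False in \<open>auto simp: cyc_def\<close>)
  qed
qed

text \<open>The edge \<open>uv\<close> leaves a shortest cycle, and either exchange offered by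
  \<open>toggle\<close> removes the cycle edge \<open>ub\<close>; so both alternatives fit
  \<open>short_ear_if_swap\<close>, with \<open>c\<close> and \<open>d\<close> interchanged.\<close>

lemma ex_short_ear: "\<exists>\<beta> K zs x ps y. cls \<beta> K \<and> ear K zs x ps y \<and> length ps \<le> girth - 1"
proof -
  obtain \<beta> K zs where K: "cls \<beta> K" "cyc K zs" "length zs = girth" using ex_girth_cycle by blast
  then obtain u where u: "u \<in> set zs" by (cases zs) (auto simp: cyc_def)
  obtain a b v where nu: "K `` {u} = {a, b, v}" "distinct [a, b, v]" "a \<in> set zs" "b \<in> set zs" "v \<notin> set zs"
    using short_cycle_neighbours[OF K u] by metis
  have uv: "(u, v) \<in> K" "(u, a) \<in> K" "(u, b) \<in> K" using nu(1) by blast+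
  have vV: "v \<in> V" using uv cls_sub[OF K(1)] by blast
  have "card (K `` {v} - {u}) = 2"
    using cls_cubic[OF K(1) vV] cls_symD[OF K(1) uv(1)] cls_finite_nbs[OF K(1)]
    by (simp add: card_Diff_singleton_if)
  then obtain c d where "K `` {v} - {u} = {c, d}" "c \<noteq> d" by (meson card_2_iff)
  then have nv: "K `` {v} = {u, c, d}" "c \<noteq> d" "c \<noteq> u" "d \<noteq> u" using cls_symD[OF K(1) uv(1)] by blast+
  have vcd: "(v, c) \<in> K" "(v, d) \<in> K" using nv(1) by blast+
  have "u \<noteq> v" "u \<noteq> a" "u \<noteq> b" "v \<noteq> c" "v \<noteq> d"
    using cls_irrefl[OF K(1)] uv vcd by blast+
  moreover have "a \<noteq> c" "a \<noteq> d" "b \<noteq> c" "b \<noteq> d"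
    using triangle_free[OF K(1) uv(1)] uv(2,3) vcd by blast+
  ultimately have dist: "distinct [u, v, a, b, c, d]" using nu nv by auto
  have nu': "K `` {u} = {v, a, b}" and nv': "K `` {v} = {u, d, c}" using nu(1) nv(1) by auto
  have "cls (\<not> \<beta>) (swap_ends K u b v d) \<or> cls (\<not> \<beta>) (swap_ends K u b v c)"
    by (rule toggle[OF K(1) _ nu' nv(1)]) (use dist in auto)
  then have "\<exists>ps y. ear K zs u ps y \<and> length ps \<le> girth - 1"
  proof
    assume L: "cls (\<not> \<beta>) (swap_ends K u b v d)"
    show ?thesis
      by (rule short_ear_if_swap[OF K L nu' u nu(3,4) nv' nu(5)]) (use dist in auto)
  next
    assume L: "cls (\<not> \<beta>) (swap_ends K u b v c)"
    show ?thesis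
      by (rule short_ear_if_swap[OF K L nu' u nu(3,4) nv(1) nu(5) dist])
  qed
  then show ?thesis using K(1) by blast
qed

lemma ear_length_bounds: "girth \<le> ear_length + 2" "ear_length \<le> girth - 1"
  and ex_shortest_ear: "\<exists>\<beta> K zs x ps y. cls \<beta> K \<and> ear K zs x ps y \<and> length ps = ear_length"
proof -
  show ex: "\<exists>\<beta> K zs x ps y. cls \<beta> K \<and> ear K zs x ps y \<and> length ps = ear_length"
    unfolding ear_length_def by (rule LeastI_ex) (use ex_short_ear in blast)
  show "girth \<le> ear_length + 2" using ex girth_le_ear by metis
  show "ear_length \<le> girth - 1" using ex_short_ear ear_length_le by (meson le_trans)
qed

section \<open>Theta graphs\<close>

text \<open>A cycle \<open>s # t # R\<close> of minimal length with an ear \<open>ps\<close> of minimal length that joins the adjacent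
  vertices \<open>s\<close> and \<open>t\<close>; equivalently, the cycle \<open>t # R @ s # ps\<close> with the chord \<open>st\<close>.\<close>
definition theta :: "bool \<Rightarrow> ('a \<times> 'a) set \<Rightarrow> 'a \<Rightarrow> 'a \<Rightarrow> 'a list \<Rightarrow> 'a list \<Rightarrow> bool" where
  "theta \<beta> K s t R ps \<longleftrightarrow> cls \<beta> K \<and> ear K (s # t # R) s ps t \<and> length ps = ear_length"

lemma ear_iff_path:
  "ear K zs x ps y \<longleftrightarrow> cyc K zs \<and> length zs = girth \<and> x \<in> set zs \<and> y \<in> set zs \<and> x \<noteq> y \<and>
    ps \<noteq> [] \<and> distinct ps \<and> set ps \<inter> set zs = {} \<and> successively (\<lambda>x y. (x, y) \<in> K) (x # ps @ [y])"
  by (cases "ps = []") (auto simp: ear_def successively_Cons successively_append_iff)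

lemma girth_ge_5: "5 \<le> girth"
  using girth_ge_4 girth_odd by (cases "girth = 4") auto

lemma thetaD:
  assumes "theta \<beta> K s t R ps"
  shows "cls \<beta> K" "cyc K (s # t # R)" "length (s # t # R) = girth" "length ps = ear_length"
    "distinct (s # t # R @ ps)" "successively (\<lambda>x y. (x, y) \<in> K) ps"
    "(s, hd ps) \<in> K" "(last ps, t) \<in> K" "3 \<le> length R" "3 \<le> length ps"
  using assms girth_ge_5 ear_length_bounds(1)
  by (auto simp: theta_def ear_def cyc_def)

lemma theta_path:
  assumes "theta \<beta> K s t R ps"
  shows "successively (\<lambda>x y. (x, y) \<in> K) (s # ps @ [t])"
  using assms unfolding theta_def ear_iff_path by blast

lemma theta_cyc:
  assumes "theta \<beta> K s t R ps"
  shows "cyc K (t # R @ s # ps)"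
proof -
  note T = thetaD[OF assms]
  have "R \<noteq> []" "ps \<noteq> []" using T(9,10) by auto
  then show ?thesis
    using T by (auto simp: cyc_def successively_append_iff successively_Cons)
qed

text \<open>The chord would replace the nonempty stretch \<open>Q\<close> and give a shorter
  ear.\<close>

lemma theta_no_chord:
  assumes T: "theta \<beta> K s t R ps" and ps: "ps = P @ x # Q @ y # P'" "Q \<noteq> []"
  shows "(x, y) \<notin> K"
proof
  assume xy: "(x, y) \<in> K"
  note D = thetaD[OF T]
  have "successively (\<lambda>x y. (x, y) \<in> K) ((P @ [x]) @ Q @ y # P')" using D(6) ps by simp
  then have "successively (\<lambda>x y. (x, y) \<in> K) (P @ [x])" "successively (\<lambda>x y. (x, y) \<in> K) (y # P')"
    unfolding successively_append_iff by blast+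
  then have "successively (\<lambda>x y. (x, y) \<in> K) ((P @ [x]) @ y # P')"
    using xy unfolding successively_append_iff[of _ "P @ [x]"] by simp
  moreover have "hd (P @ x # y # P') = hd ps" "last (P @ x # y # P') = last ps"
    unfolding ps by (simp_all add: hd_append)
  moreover have "distinct (s # t # R @ P @ x # y # P')" using D(5) unfolding ps by auto
  ultimately have "ear K (s # t # R) s (P @ x # y # P') t"
    using D(2,3,7,8) unfolding ear_def by auto
  then show False
    using ear_length_le[OF D(1), of "s # t # R" s "P @ x # y # P'" t] D(4) ps(2) unfolding ps(1)
    by (cases Q) simp_all
qed

text \<open>Such an edge splits \<open>ps\<close> at \<open>p\<close> into two ears. Their lengths
  add up to \<open>length ps + 1\<close>, as \<open>p\<close> counts twice, but each is at least
  \<open>length ps\<close>, which exceeds one.\<close>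

lemma theta_no_cross:
  assumes T: "theta \<beta> K s t R ps" and "r \<in> set R" "p \<in> set ps"
  shows "(r, p) \<notin> K"
proof
  assume rp: "(r, p) \<in> K"
  note D = thetaD[OF T]
  obtain P Q where ps: "ps = P @ p # Q" using assms(3) by (meson split_list)
  have pr: "(p, r) \<in> K" using cls_symD[OF D(1) rp] .
  have "ear K (s # t # R) s (P @ [p]) r" "ear K (s # t # R) r (p # Q) t"
  proof -
    have "successively (\<lambda>x y. (x, y) \<in> K) ((P @ [p]) @ Q)" "successively (\<lambda>x y. (x, y) \<in> K) (P @ p # Q)"
      using D(6) ps by simp_all
    then have "successively (\<lambda>x y. (x, y) \<in> K) (P @ [p])" "successively (\<lambda>x y. (x, y) \<in> K) (p # Q)"
      unfolding successively_append_iff by blast+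
    moreover have "hd (P @ [p]) = hd ps" "last (p # Q) = last ps"
      unfolding ps by (simp_all add: hd_append)
    ultimately show "ear K (s # t # R) s (P @ [p]) r" "ear K (s # t # R) r (p # Q) t"
      using D(2,3,5,7,8) rp pr assms(2) unfolding ear_def ps by auto
  qed
  then have "ear_length \<le> length (P @ [p])" "ear_length \<le> length (p # Q)"
    using ear_length_le[OF D(1)] by blast+
  then show False using D(4,10) ps by simp
qed

lemma theta_branch:
  assumes "theta \<beta> K s t R ps"
  shows "K `` {s} = {t, last R, hd ps}" "K `` {t} = {s, hd R, last ps}"
proof -
  note T = thetaD[OF assms]
  have ne: "R \<noteq> []" "ps \<noteq> []" using T(9,10) by auto
  have e: "(s, t) \<in> K" "(t, hd R) \<in> K" "(last R, s) \<in> K"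
    using T(2) ne by (auto simp: cyc_def successively_Cons)
  note sym = cls_symD[OF T(1)]
  have mem: "hd R \<in> set R" "last R \<in> set R" "hd ps \<in> set ps" "last ps \<in> set ps" using ne by simp_all
  show "K `` {s} = {t, last R, hd ps}"
    by (rule neighbours_eq[OF T(1) e(1) sym[OF e(3)] T(7)]) (use mem T(5) in auto)
  show "K `` {t} = {s, hd R, last ps}"
    by (rule neighbours_eq[OF T(1) sym[OF e(1)] e(2) sym[OF T(8)]]) (use mem T(5) in auto)
qed

text \<open>No third edge of a vertex of \<open>R\<close> or \<open>ps\<close> stays in the theta
  graph: it would be a chord of the shortest cycle, a chord of the ear, an edge between
  \<open>R\<close> and \<open>ps\<close>, or a fourth edge at \<open>s\<close> or
  \<open>t\<close>.\<close>

lemma theta_pendant: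
  assumes T: "theta \<beta> K s t R ps" and x: "x \<in> set (R @ ps)"
  obtains y z w where "K `` {x} = {y, z, w}" "cadj (t # R @ s # ps) x y"
    "cadj (t # R @ s # ps) x z" "w \<notin> set (t # R @ s # ps)" "y \<in> set (t # R @ s # ps)" "z \<in> set (t # R @ s # ps)"
proof -
  note D = thetaD[OF T]
  note symK = cls_sym[OF D(1)] and sm = cls_symD[OF D(1)]
  show ?thesis
  proof (cases "x \<in> set R")
    case True
    then obtain P Q where R: "R = P @ x # Q" by (meson split_list)
    have "cyc K (t # P @ x # (Q @ s # ps))" using theta_cyc[OF T] R by simp
    define y where "y = last (t # P)"
    define z where "z = hd ((Q @ s # ps) @ [t])"
    have "t # P @ x # Q @ s # ps = t # R @ s # ps" using R by simp
    with cyc_split_neighbours[OF \<open>cyc K (t # P @ x # (Q @ s # ps))\<close> symK]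
    have N: "cadj (t # R @ s # ps) x y" "cadj (t # R @ s # ps) x z" "y \<noteq> z" "(x, y) \<in> K" "(x, z) \<in> K"
      unfolding y_def z_def by (simp_all only: not_False_eq_True)
    obtain w where w: "K `` {x} = {y, z, w}" "distinct [y, z, w]"
      using third_neighbour[OF D(1) N(4,5,3)] .
    have yz: "y \<in> set (s # t # R)" "z \<in> set (s # t # R)"
      unfolding y_def z_def using R by (cases Q; auto)+
    have "x \<in> set (s # t # R)" using True by simp
    then obtain y' z' w' where w': "K `` {x} = {y', z', w'}" "w' \<notin> set (s # t # R)"
      using short_cycle_neighbours[OF D(1-3)] by metis
    \<comment> \<open>The neighbours \<open>y\<close> and \<open>z\<close> lie on the shortest
      cycle, so the neighbour off it can only be \<open>w\<close>.\<close>
    have "w' \<in> {y, z, w}" using w(1) w'(1) by blast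
    then have "w = w'" using yz w'(2) by blast
    then have "w \<notin> set (s # t # R)" using w' by blast
    moreover have "w \<notin> set ps" using theta_no_cross[OF T True] w(1) by blast
    ultimately show ?thesis by (intro that[OF w(1)] N(1,2)) (use yz in auto)
  next
    case False
    then have "x \<in> set ps" using x by simp
    then obtain P Q where ps: "ps = P @ x # Q" by (meson split_list)
    have "cyc K (t # (R @ s # P) @ x # Q)" using theta_cyc[OF T] ps by simp
    define y where "y = last (t # R @ s # P)"
    define z where "z = hd (Q @ [t])"
    have "t # (R @ s # P) @ x # Q = t # R @ s # ps" using ps by simp
    with cyc_split_neighbours[OF \<open>cyc K (t # (R @ s # P) @ x # Q)\<close> symK]
    have N: "cadj (t # R @ s # ps) x y" "cadj (t # R @ s # ps) x z" "y \<noteq> z" "(x, y) \<in> K" "(x, z) \<in> K"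
      unfolding y_def z_def by (simp_all only: not_False_eq_True)
    obtain w where w: "K `` {x} = {y, z, w}" "distinct [y, z, w]"
      using third_neighbour[OF D(1) N(4,5,3)] .
    have xw: "(x, w) \<in> K" "(w, x) \<in> K" using w(1) sm by blast+
    have "w \<noteq> s"
    proof
      assume "w = s"
      then have "x \<in> {t, last R, hd ps}" using xw(2) theta_branch(1)[OF T] by blast
      moreover have "last R \<in> set R" using D(9) by (cases R rule: rev_cases) auto
      ultimately have "x = hd ps" using \<open>x \<in> set ps\<close> D(5) by auto
      then have "P = []" using ps D(5) by (cases P) auto
      then show False using w(2) \<open>w = s\<close> by (simp add: y_def)
    qed
    moreover have "w \<noteq> t"
    proof
      assume "w = t"
      then have "x \<in> {s, hd R, last ps}" using xw(2) theta_branch(2)[OF T] by blast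
      moreover have "hd R \<in> set R" using D(9) by (cases R) auto
      ultimately have "x = last ps" using \<open>x \<in> set ps\<close> D(5) by auto
      then have "Q = []" using ps D(5) by (cases Q rule: rev_cases) auto
      then show False using w(2) \<open>w = t\<close> by (simp add: z_def)
    qed
    moreover have "w \<notin> set R" using theta_no_cross[OF T _ \<open>x \<in> set ps\<close>] xw(2) by blast
    moreover have "w \<notin> set P"
    proof
      assume "w \<in> set P"
      then obtain P1 P2 where P: "P = P1 @ w # P2" by (meson split_list)
      show False
      proof (cases "P2 = []")
        case True
        then show False using w(2) P by (simp add: y_def)
      next
        case False
        then show False using theta_no_chord[OF T, of P1 w P2 x Q] xw(2) ps P by simp
      qed
    qed
    moreover have "w \<notin> set Q"
    proof
      assume "w \<in> set Q"
      then obtain Q1 Q2 where Q: "Q = Q1 @ w # Q2" by (meson split_list)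
      show False
      proof (cases "Q1 = []")
        case True
        then show False using w(2) Q by (simp add: z_def)
      next
        case False
        then show False using theta_no_chord[OF T, of P x Q1 w Q2] xw(1) ps Q by simp
      qed
    qed
    moreover have "w \<noteq> x" using cls_irrefl[OF D(1)] xw by blast
    ultimately have "w \<notin> set (t # R @ s # ps)" using ps by auto
    moreover have "y \<in> set (t # R @ s # ps)" "z \<in> set (t # R @ s # ps)"
      unfolding y_def z_def using ps by (cases Q; auto)+
    ultimately show ?thesis by (intro that[OF w(1)] N(1,2))
  qed
qed

text \<open>The other exchange would shorten the cycle or the ear. The last vertex of \<open>R\<close> and the first
  one of \<open>ps\<close> are not adjacent, but have the common neighbour \<open>s\<close>.\<close>
lemma theta_flip:
  assumes T: "theta \<beta> K s t R ps" and uv: "R @ ps = A @ u # v # C"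
    and b: "(u, b) \<in> K" "b \<notin> set (t # R @ s # ps)" and d: "(v, d) \<in> K" "d \<notin> set (t # R @ s # ps)"
  shows "cls (\<not> \<beta>) (swap_ends K u b v d)"
  using uv
proof (cases rule: append_eq_two_Cons_cases)
  case (left C')
  show ?thesis
    using short_cycle_flip[OF thetaD(1-3)[OF T], of "s # t # A" u v C' b d] left b d by simp
next
  case between
  note D = thetaD[OF T] and sm = cls_symD[OF thetaD(1)[OF T]]
  obtain a A' where A: "A = A' @ [a]" using between D(9) by (cases A rule: rev_cases) auto
  obtain c C' where C: "C = c # C'" using between D(10) by (cases C) auto
  have R: "R = A' @ [a, u]" and ps: "ps = v # c # C'" using between A C by auto
  have e: "(a, u) \<in> K" "(u, s) \<in> K" "(s, v) \<in> K" "(v, c) \<in> K"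
    using D(2,6,7) unfolding R ps by (auto simp: cyc_def successively_append_iff successively_Cons)
  have dist: "distinct (s # t # R @ ps)" using D(5) .
  have "b \<noteq> d"
  proof
    assume "b = d"
    then have "cyc K [s, u, b, v]"
      using sm[OF e(2)] b(1) sm[OF d(1)] sm[OF e(3)] b(2) dist R ps by (auto simp: cyc_def)
    then show False using girth_le[OF D(1)] girth_ge_5 by fastforce
  qed
  have Nu: "K `` {u} = {s, a, b}"
    by (rule neighbours_eq[OF D(1) e(2) sm[OF e(1)] b(1)]) (use b dist R in auto)
  have Nv: "K `` {v} = {s, c, d}"
    by (rule neighbours_eq[OF D(1) sm[OF e(3)] e(4) d(1)]) (use d dist ps in auto)
  have "cls (\<not> \<beta>) (swap_ends K u b v d) \<or> cls (\<not> \<beta>) (swap_ends K u b v c)"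
    by (rule toggle[OF D(1) _ Nu Nv]) (use \<open>b \<noteq> d\<close> b d dist R ps in auto)
  moreover have False if L: "cls (\<not> \<beta>) (swap_ends K u b v c)"
  proof -
    let ?L = "swap_ends K u b v c"
    have keep: "(x, y) \<in> ?L" if "(x, y) \<in> K" "x \<notin> {b, v}" "y \<notin> {b, v}" for x y
      using that by (auto simp: swap_ends_def)
    have "set (s # t # R) \<inter> {b, v} = {}" using b dist ps by auto
    then have "cyc ?L (s # t # R)"
      by (intro cyc_mono[OF D(2)] keep) blast+
    have "set (c # C' @ [t]) \<inter> {b, v} = {}" using b dist ps by auto
    moreover have piece: "successively (\<lambda>x y. (x, y) \<in> K) (c # C' @ [t])" using theta_path[OF T] ps by simp
    ultimately have "successively (\<lambda>x y. (x, y) \<in> ?L) (c # C' @ [t])"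
      by (intro successively_mono[OF piece] keep) blast+
    then have "successively (\<lambda>x y. (x, y) \<in> ?L) (u # (c # C') @ [t])" by (simp add: swap_ends_def)
    moreover have "u \<in> set (s # t # R)" "u \<noteq> t" "distinct (c # C')" "set (c # C') \<inter> set (s # t # R) = {}"
      using dist R ps by auto
    \<comment> \<open>The new edge \<open>uc\<close> bypasses \<open>v\<close>: the ear now starts
      at \<open>u\<close> and has one inner vertex less.\<close>
    ultimately have "ear ?L (s # t # R) u (c # C') t"
      using D(3) \<open>cyc ?L (s # t # R)\<close> unfolding ear_iff_path by simp
    then have "ear_length \<le> length (c # C')" by (rule ear_length_le[OF L])
    then show False using D(4) ps by simp
  qed
  ultimately show ?thesis by blast
next
  case (right A')
  note D = thetaD[OF T] and sm = cls_symD[OF thetaD(1)[OF T]]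
  have dist: "distinct (s # t # R @ ps)" using D(5) .
  \<comment> \<open>At the ends of the ear, \<open>a\<close> is \<open>s\<close> or \<open>c\<close>
    is \<open>t\<close>. In every case an edge \<open>uc\<close> would bypass
    \<open>v\<close>.\<close>
  define a where "a = last (s # A')"
  define c where "c = hd (C @ [t])"
  have path: "successively (\<lambda>x y. (x, y) \<in> K) ((s # A' @ [u]) @ v # C @ [t])"
    "successively (\<lambda>x y. (x, y) \<in> K) ((s # A') @ u # v # C @ [t])"
    using theta_path[OF T] unfolding right by simp_all
  have pieces: "successively (\<lambda>x y. (x, y) \<in> K) (s # A' @ [u])" "successively (\<lambda>x y. (x, y) \<in> K) (v # C @ [t])"
    using path(1) unfolding successively_append_iff by blast+
  have e: "(u, a) \<in> K" "(u, v) \<in> K" "(v, c) \<in> K"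
  proof -
    have 1: "(a, u) \<in> K" and 2: "successively (\<lambda>x y. (x, y) \<in> K) (u # v # C @ [t])"
      using path(2) unfolding successively_append_iff[of _ "s # A'"] a_def by simp_all
    show "(u, a) \<in> K" by (rule sm[OF 1])
    show "(u, v) \<in> K" using 2 by simp
    show "(v, c) \<in> K" using pieces(2) by (simp add: successively_Cons c_def)
  qed
  have "a \<in> set (s # A')" unfolding a_def by (rule last_in_set) simp
  moreover have "c \<in> set (t # C)" unfolding c_def by (cases C) simp_all
  ultimately have mem: "a \<in> set (s # A')" "c \<in> set (t # C)" .
  have "b \<noteq> d" using triangle_free[OF D(1) e(2) b(1)] d(1) by blast
  have Nu: "K `` {u} = {v, a, b}"
    by (rule neighbours_eq[OF D(1) e(2,1) b(1)]) (use mem b dist right in auto)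
  have Nv: "K `` {v} = {u, c, d}"
    by (rule neighbours_eq[OF D(1) sm[OF e(2)] e(3) d(1)]) (use mem d dist right in auto)
  have "cls (\<not> \<beta>) (swap_ends K u b v d) \<or> cls (\<not> \<beta>) (swap_ends K u b v c)"
    by (rule toggle[OF D(1) _ Nu Nv]) (use \<open>b \<noteq> d\<close> mem b d dist right in auto)
  moreover have False if L: "cls (\<not> \<beta>) (swap_ends K u b v c)"
  proof -
    let ?L = "swap_ends K u b v c"
    have keep: "(x, y) \<in> ?L" if "(x, y) \<in> K" "x \<notin> {b, v}" "y \<notin> {b, v}" for x y
      using that by (auto simp: swap_ends_def)
    have "set (s # t # R) \<inter> {b, v} = {}" using b dist right by auto
    then have "cyc ?L (s # t # R)"
      by (intro cyc_mono[OF D(2)] keep) blast+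
    have "set (s # A' @ [u]) \<inter> {b, v} = {}" "set (C @ [t]) \<inter> {b, v} = {}" using b dist right by auto
    then have "successively (\<lambda>x y. (x, y) \<in> ?L) (s # A' @ [u])"
      by (intro successively_mono[OF pieces(1)] keep) blast+
    moreover have piece: "successively (\<lambda>x y. (x, y) \<in> K) (C @ [t])"
      using pieces(2) by (simp add: successively_Cons)
    have "successively (\<lambda>x y. (x, y) \<in> ?L) (C @ [t])"
      using \<open>set (C @ [t]) \<inter> {b, v} = {}\<close> by (intro successively_mono[OF piece] keep) blast+
    moreover have "(last (s # A' @ [u]), hd (C @ [t])) \<in> ?L"
      by (simp add: swap_ends_def flip: c_def)
    ultimately have "successively (\<lambda>x y. (x, y) \<in> ?L) ((s # A' @ [u]) @ C @ [t])"
      unfolding successively_append_iff[of _ "s # A' @ [u]"] by blast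
    moreover have "s \<noteq> t" "distinct (A' @ u # C)" "set (A' @ u # C) \<inter> set (s # t # R) = {}"
      using dist right by auto
    ultimately have "ear ?L (s # t # R) s (A' @ u # C) t"
      using D(3) \<open>cyc ?L (s # t # R)\<close> unfolding ear_iff_path by simp
    then have "ear_length \<le> length (A' @ u # C)" by (rule ear_length_le[OF L])
    then show False using D(4) right by simp
  qed
  ultimately show ?thesis by blast
qed

section \<open>Rearranging the outside neighbours of a theta graph\<close>

lemma theta_arranged:
  assumes T: "theta \<beta> K s t R ps"
  defines "S \<equiv> set (t # R @ s # ps)"
  defines "B \<equiv> K \<inter> uncut S"
  obtains ys where "K = arrange B (R @ ps) ys" "arranged B S (R @ ps) \<beta> ys"
proof -
  note D = thetaD[OF T]
  have sub: "set (R @ ps) \<subseteq> S" by (auto simp: S_def)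
  have "\<exists>w. w \<notin> S \<and> (\<forall>v. v \<notin> S \<longrightarrow> ((x, v) \<in> K \<longleftrightarrow> v = w))" if x: "x \<in> set (R @ ps)" for x
  proof -
    obtain y z w where yzw: "K `` {x} = {y, z, w}" "w \<notin> S" "y \<in> S" "z \<in> S"
      using theta_pendant[OF T x] unfolding S_def by metis
    have "(x, v) \<in> K \<longleftrightarrow> v \<in> {y, z, w}" for v using yzw(1) by blast
    then show ?thesis using yzw(2-4) by (intro exI[of _ w]) auto
  qed
  then obtain w where w: "\<And>x. x \<in> set (R @ ps) \<Longrightarrow> w x \<notin> S"
    "\<And>x v. x \<in> set (R @ ps) \<Longrightarrow> v \<notin> S \<Longrightarrow> (x, v) \<in> K \<longleftrightarrow> v = w x" by metis
  let ?ys = "map w (R @ ps)"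
  have dis: "set ?ys \<inter> S = {}" using w(1) by auto
  have eq: "K = arrange B (R @ ps) ?ys"
    unfolding B_def
  proof (rule arrange_cut[OF cls_sym[OF D(1)] sub dis])
    fix x y assume xy: "x \<in> S" "y \<notin> S"
    show "(x, y) \<in> K \<longleftrightarrow> (x, y) \<in> set (zip (R @ ps) ?ys)"
    proof (cases "x \<in> set (R @ ps)")
      case True
      then show ?thesis using w(2)[OF True xy(2)]
        unfolding zip_map2 zip_same_conv_map by auto
    next
      case False
      then have "x = s \<or> x = t" using xy(1) by (auto simp: S_def)
      moreover have "R \<noteq> []" "ps \<noteq> []" using D(9,10) by auto
      then have "{t, last R, hd ps} \<subseteq> S" "{s, hd R, last ps} \<subseteq> S" by (auto simp: S_def)
      ultimately have "K `` {x} \<subseteq> S" by (elim disjE; simp only: theta_branch[OF T])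
      then have "(x, y) \<notin> K" using xy(2) by blast
      moreover have "(x, y) \<notin> set (zip (R @ ps) ?ys)" using False by (meson set_zip_leftD)
      ultimately show ?thesis by blast
    qed
  qed
  show ?thesis
    by (rule that[OF eq]) (unfold arranged_def eq[symmetric], use D(1) dis in simp)
qed

text \<open>A theta graph uses only edges between its own vertices, so it survives every change
  elsewhere; it stays extremal in the class \<open>\<gamma>\<close> because \<open>girth\<close> and
  \<open>ear_length\<close> refer to both classes.\<close>

lemma theta_transfer:
  assumes T: "theta \<beta> K s t R ps" and L: "cls \<gamma> L"
    and KL: "\<And>x y. x \<in> set (t # R @ s # ps) \<Longrightarrow> y \<in> set (t # R @ s # ps) \<Longrightarrow> (x, y) \<in> K \<Longrightarrow> (x, y) \<in> L"
  shows "theta \<gamma> L s t R ps"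
proof -
  note D = thetaD[OF T]
  have "ps \<noteq> []" using D(10) by auto
  have "cyc L (s # t # R)" by (rule cyc_mono[OF D(2)]) (use KL in auto)
  moreover have "successively (\<lambda>x y. (x, y) \<in> L) ps"
    by (rule successively_mono[OF D(6)]) (use KL in auto)
  moreover have "(s, hd ps) \<in> L" "(last ps, t) \<in> L" using KL D(7,8) \<open>ps \<noteq> []\<close> by auto
  ultimately show ?thesis
    using T L unfolding theta_def ear_def by simp
qed

lemma theta_arranged_flip:
  assumes T: "theta \<beta>' K s t R ps"
  defines "S \<equiv> set (t # R @ s # ps)"
  defines "B \<equiv> K \<inter> uncut S"
  assumes ys: "arranged B S (R @ ps) \<beta> (A @ b # d # C)"
  shows "arranged B S (R @ ps) (\<not> \<beta>) (A @ d # b # C)"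
proof -
  let ?xs = "R @ ps"
  let ?L = "arrange B ?xs (A @ b # d # C)"
  have L: "cls \<beta> ?L" and len: "length (A @ b # d # C) = length ?xs"
    and dis: "set (A @ b # d # C) \<inter> S = {}" using ys by (auto simp: arranged_def)
  have Bs: "B \<subseteq> uncut S" by (simp add: B_def)
  have sub: "set ?xs \<subseteq> S" by (auto simp: S_def)
  have TL: "theta \<beta> ?L s t R ps"
    by (rule theta_transfer[OF T L]) (auto simp: arrange_def B_def uncut_def S_def)
  define A' where "A' = take (length A) ?xs"
  have lA: "length A' = length A" using len by (simp add: A'_def)
  have "2 \<le> length (drop (length A) ?xs)" using len by simp
  then obtain u v C' where "drop (length A) ?xs = u # v # C'"
    by (metis One_nat_def Suc_1 Suc_le_length_iff)
  then have xs: "?xs = A' @ u # v # C'" by (metis A'_def append_take_drop_id)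
  have e: "(u, b) \<in> ?L" "(v, d) \<in> ?L"
    using lA unfolding xs arrange_def by auto
  have bd: "b \<notin> S" "d \<notin> S" using dis by auto
  have flip: "cls (\<not> \<beta>) (swap_ends ?L u b v d)"
    using theta_flip[OF TL xs e(1) _ e(2)] bd unfolding S_def by blast
  \<comment> \<open>Equal outer ends would make the exchange trivial and put one graph into both
    classes.\<close>
  have "b \<noteq> d"
  proof
    assume "b = d"
    have "swap_ends ?L u b v d = ?L"
      using \<open>b = d\<close> e cls_symD[OF L] by (auto simp: swap_ends_def)
    then show False using flip L cls_disjoint by metis
  qed
  then have "swap_ends ?L u b v d = arrange B ?xs (A @ d # b # C)"
    using swap_ends_arrange[of B S A' u v C' A b d C] Bs sub dis lA thetaD(5)[OF T]
    unfolding xs by (metis distinct.simps(2) distinct_append xs)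
  then show ?thesis using flip len dis by (auto simp: arranged_def)
qed

text \<open>On the theta graph, \<open>f\<close> preserves the edges of the long cycle because it
  maps that cycle to a cycle of \<open>K\<close>, and the chord \<open>st\<close> because it keeps
  the pair of its ends. So an arrangement of the opposite class is isomorphic to
  \<open>K\<close>.\<close>

lemma theta_automorphism:
  assumes T: "theta \<beta> K s t R ps" and K: "K = arrange B (R @ ps) ys"
  defines "S \<equiv> set (t # R @ s # ps)"
  assumes B: "B = K \<inter> uncut S" and ys: "arranged B S (R @ ps) \<beta> ys" "arranged B S (R @ ps) (\<not> \<beta>) ys'"
    and f: "f permutes S" "{f s, f t} = {s, t}" "cyc K (map f (t # R @ s # ps))"
    and eq: "arrange B (map f (R @ ps)) ys = arrange B (R @ ps) ys'"
  shows False
proof -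
  note D = thetaD[OF T]
  let ?O = "t # R @ s # ps"
  have SV: "S \<subseteq> V" using cyc_subset_V[OF D(1) theta_cyc[OF T]] by (simp add: S_def)
  have fS: "f x \<in> S \<longleftrightarrow> x \<in> S" for x using permutes_in_image[OF f(1)] .
  have edge_st: "(s, t) \<in> K" "(t, s) \<in> K"
    using D(2) cls_symD[OF D(1)] by (auto simp: cyc_def)
  have "isomorphic_on V (arrange B (R @ ps) ys) (arrange B (map f (R @ ps)) ys)"
  proof (rule arrange_map_isomorphic[OF _ _ _ SV _ f(1)])
    fix x y assume xy: "x \<in> S" "y \<in> S" "(x, y) \<in> B"
    then have xyK: "(x, y) \<in> K" using B by blast
    have "cadj ?O x y \<or> {x, y} = {s, t}"
    proof (cases "x \<in> set (R @ ps)")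
      case True
      obtain p q w where "K `` {x} = {p, q, w}" "cadj ?O x p" "cadj ?O x q" "w \<notin> S"
        using theta_pendant[OF T True] unfolding S_def by metis
      moreover have "y = p \<or> y = q \<or> y = w" using xyK calculation(1) by blast
      ultimately show ?thesis using xy(2) by blast
    next
      case False
      then consider "x = s" | "x = t" using xy(1) by (auto simp: S_def)
      then show ?thesis
      proof cases
        case 1
        then have "y \<in> {t, last R, hd ps}" using theta_branch(1)[OF T] xyK by blast
        moreover have "cadj ?O s (hd ps)"
          using cadj_middle[of "t # R" s "hd ps" "tl ps"] D(10) by (cases ps) auto
        moreover have "cadj ?O (last R) s"
          using cadj_middle[of "t # butlast R" "last R" s ps] D(9) by (cases R rule: rev_cases) auto
        then have "cadj ?O s (last R)" by (rule cadj_sym)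
        ultimately show ?thesis using 1 by blast
      next
        case 2
        then have "y \<in> {s, hd R, last ps}" using theta_branch(2)[OF T] xyK by blast
        moreover have "cadj ?O t (hd R)"
          using cadj_hd_next[of t "hd R" "tl R @ s # ps"] D(9) by (cases R) auto
        moreover have "cadj ?O t (last ps)"
          using cadj_hd_last[of t "R @ s # butlast ps" "last ps"] D(10) by (cases ps rule: rev_cases) auto
        ultimately show ?thesis using 2 by blast
      qed
    qed
    then have "(f x, f y) \<in> K"
    proof
      assume "cadj ?O x y"
      then have "cadj (map f ?O) (f x) (f y)" by (rule cadj_map)
      then show ?thesis using cyc_cadj[OF f(3) cls_sym[OF D(1)]] by blast
    next
      assume "{x, y} = {s, t}"
      then have "f ` {x, y} = f ` {s, t}" by (rule arg_cong)
      then have "{f x, f y} = {s, t}" by (simp only: image_insert image_empty f(2))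
      then show ?thesis using edge_st unfolding doubleton_eq_iff by blast
    qed
    then show "(f x, f y) \<in> B" using B fS xy by (simp add: uncut_def)
  qed (use B ys in \<open>auto simp: S_def arranged_def\<close>)
  then have "isomorphic_on V K (arrange B (R @ ps) ys')" unfolding eq K[symmetric] .
  moreover have "cls (\<not> \<beta>) (arrange B (R @ ps) ys')" using ys(2) by (simp add: arranged_def)
  ultimately show False using cls_iso cls_disjoint D(1) by blast
qed

lemma no_deck_pair: False
proof -
  obtain \<beta>' K' zs x ps y where ear': "cls \<beta>' K'" "ear K' zs x ps y" "length ps = ear_length"
    using ex_shortest_ear by blast
  obtain \<beta> K s t R where "cls \<beta> K" "ear K (s # t # R) s ps t"
    using ear_adjacent[OF ear'(1,2)] by metis
  then have T: "theta \<beta> K s t R ps" using ear'(3) by (simp add: theta_def)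
  note D = thetaD[OF T]
  let ?O = "t # R @ s # ps"
  define S where "S = set ?O"
  define B where "B = K \<inter> uncut S"
  obtain ys where ys: "K = arrange B (R @ ps) ys" "arranged B S (R @ ps) \<beta> ys"
    using theta_arranged[OF T] unfolding B_def S_def by blast
  note flip = theta_arranged_flip[OF T, folded S_def, folded B_def]
  have len: "length ys = length (R @ ps)" using ys(2) by (simp add: arranged_def)
  obtain k where k: "girth = 2 * k + 1" using girth_odd by (rule oddE)
  have lR: "length R = 2 * k - 1" using D(3) k by simp
  have O: "cyc K ?O" "distinct ?O" using theta_cyc[OF T] by (simp_all add: cyc_def)
  have revO: "cyc K (rev ?O)" using O(1) cyc_rev[OF cls_sym[OF D(1)]] by blast
  have "ear_length = girth - 2 \<or> ear_length = girth - 1" using ear_length_bounds by linarith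
  then show False
  proof
    \<comment> \<open>The reflection fixing \<open>s\<close> and \<open>t\<close> exchanges the two paths \<open>R\<close> and \<open>ps\<close> of equal length.\<close>
    assume "ear_length = girth - 2"
    then have lps: "length ps = length R" using D(3,4) by simp
    obtain f where f: "f permutes S" "map f ?O = t # rev ps @ s # rev R"
    proof -
      have "distinct (t # rev ps @ s # rev R)" "set ?O = set (t # rev ps @ s # rev R)" using O(2) by auto
      then show ?thesis using ex_permutes_map[OF O(2)] that unfolding S_def by metis
    qed
    have fm: "f t = t" "map f R = rev ps" "f s = s" "map f ps = rev R"
      using f(2) lps by simp_all
    \<comment> \<open>As \<open>map f (R @ ps)\<close> is \<open>rev (R @ ps)\<close>, the
      reflection amounts to reversing the whole list of outer ends.\<close>
    have "arranged B S (R @ ps) (\<beta> = even (length ys * (length ys - 1) div 2)) (rev ys)"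
      using flips_rev[of "arranged B S (R @ ps)" \<beta> "[]" ys "[]", OF flip] ys(2) by simp
    moreover have "(\<beta> = even (length ys * (length ys - 1) div 2)) = (\<not> \<beta>)"
    proof -
      obtain j where "k = Suc j" using lR D(9) by (cases k) auto
      moreover have "length ys = 2 * (2 * k - 1)" using len lps lR by simp
      then have "length ys * (length ys - 1) div 2 = (2 * k - 1) * (2 * (2 * k - 1) - 1)" by simp
      ultimately have "odd (length ys * (length ys - 1) div 2)" by simp
      then show ?thesis by blast
    qed
    ultimately have ys': "arranged B S (R @ ps) (\<not> \<beta>) (rev ys)" by (simp only:)
    show False
    proof (rule theta_automorphism[OF T ys(1), folded S_def, OF B_def ys(2) ys' f(1)])
      show "cyc K (map f ?O)" using revO unfolding f(2) by (simp add: cyc_Cons_snoc[of K t])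
      show "arrange B (map f (R @ ps)) ys = arrange B (R @ ps) (rev ys)"
        using arrange_rev[OF len[symmetric], of B] fm by simp
    qed (use fm in auto)
  next
    \<comment> \<open>The reflection exchanging \<open>s\<close> and \<open>t\<close> reverses both paths.\<close>
    assume "ear_length = girth - 1"
    then have lps: "length ps = 2 * k" using D(4) k by simp
    obtain f where f: "f permutes S" "map f ?O = s # rev R @ t # rev ps"
    proof -
      have "distinct (s # rev R @ t # rev ps)" "set ?O = set (s # rev R @ t # rev ps)" using O(2) by auto
      then show ?thesis using ex_permutes_map[OF O(2)] that unfolding S_def by metis
    qed
    have fm: "f t = s" "map f R = rev R" "f s = t" "map f ps = rev ps"
      using f(2) by simp_all
    define Y where "Y = take (length R) ys"
    define Y' where "Y' = drop (length R) ys"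
    have Y: "ys = Y @ Y'" "length Y = length R" "length Y' = length ps"
      using len by (simp_all add: Y_def Y'_def)
    let ?h = "\<lambda>n::nat. n * (n - 1) div 2"
    have "arranged B S (R @ ps) (\<beta> = even (?h (length Y))) ([] @ rev Y @ Y')"
      using flips_rev[of "arranged B S (R @ ps)" \<beta> "[]" Y Y', OF flip] ys(2) Y(1) by simp
    then have "arranged B S (R @ ps) ((\<beta> = even (?h (length Y))) = even (?h (length Y'))) (rev Y @ rev Y' @ [])"
      using flips_rev[of "arranged B S (R @ ps)" "\<beta> = even (?h (length Y))" "rev Y" Y' "[]", OF flip]
      by simp
    moreover have "((\<beta> = even (?h (length Y))) = even (?h (length Y'))) = (\<not> \<beta>)"
    proof -
      obtain j where j: "k = Suc j" using lR D(9) by (cases k) auto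
      \<comment> \<open>The two numbers of flips add up to the square of the odd number
        \<open>2 * j + 1\<close>.\<close>
      have "?h (length Y) = (2 * j + 1) * j" "?h (length Y') = (j + 1) * (2 * j + 1)"
        using Y lR lps j by (simp_all add: algebra_simps)
      then show ?thesis by auto
    qed
    ultimately have ys': "arranged B S (R @ ps) (\<not> \<beta>) (rev Y @ rev Y')" by simp
    show False
    proof (rule theta_automorphism[OF T ys(1), folded S_def, OF B_def ys(2) ys' f(1)])
      have "cyc K (rev ps @ (s # rev R @ [t]))" using revO by simp
      then show "cyc K (map f ?O)" unfolding f(2) using cyc_append_swap[of K "rev ps"] by simp
      show "arrange B (map f (R @ ps)) ys = arrange B (R @ ps) (rev Y @ rev Y')"
        using Y fm unfolding arrange_def by (simp add: set_zip_rev)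
    qed (use fm in auto)
  qed
qed

end

section \<open>Counting in the deck\<close>

text \<open>Equality of decks for two relations on a common vertex set. The isomorphism of a card
  may depend on \<open>T\<close> and need not fit together with those of other cards.\<close>

definition same_deck :: "nat \<Rightarrow> 'a set \<Rightarrow> ('a \<times> 'a) set \<Rightarrow> ('a \<times> 'a) set \<Rightarrow> bool" where
  "same_deck k V E F \<longleftrightarrow> (\<exists>\<phi>. bij_betw \<phi> {T. T \<subseteq> V \<and> card T = k} {T. T \<subseteq> V \<and> card T = k} \<and>
    (\<forall>T. T \<subseteq> V \<and> card T = k \<longrightarrow>
      (\<exists>f. bij_betw f T (\<phi> T) \<and> (\<forall>x\<in>T. \<forall>y\<in>T. (x, y) \<in> E \<longleftrightarrow> (f x, f y) \<in> F))))"

lemma same_deck_sym: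
  assumes "same_deck k V E F" shows "same_deck k V F E"
proof -
  let ?D = "{T. T \<subseteq> V \<and> card T = k}"
  obtain \<phi> where \<phi>: "bij_betw \<phi> ?D ?D" "\<And>T. T \<in> ?D \<Longrightarrow>
      \<exists>f. bij_betw f T (\<phi> T) \<and> (\<forall>x\<in>T. \<forall>y\<in>T. (x, y) \<in> E \<longleftrightarrow> (f x, f y) \<in> F)"
    using assms unfolding same_deck_def by blast
  show ?thesis
    unfolding same_deck_def
  proof (intro exI[of _ "inv_into ?D \<phi>"] conjI allI impI)
    show "bij_betw (inv_into ?D \<phi>) ?D ?D" using \<phi>(1) by (rule bij_betw_inv_into)
    fix T assume T: "T \<subseteq> V \<and> card T = k"
    let ?U = "inv_into ?D \<phi> T"
    have U: "?U \<in> ?D" "\<phi> ?U = T"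
      using bij_betwE[OF bij_betw_inv_into[OF \<phi>(1)]] bij_betw_inv_into_right[OF \<phi>(1)] T by blast+
    then obtain f where f: "bij_betw f ?U T" "\<forall>x\<in>?U. \<forall>y\<in>?U. (x, y) \<in> E \<longleftrightarrow> (f x, f y) \<in> F"
      using \<phi>(2)[OF U(1)] unfolding U(2) by blast
    have g: "bij_betw (inv_into ?U f) T ?U" using f(1) by (rule bij_betw_inv_into)
    have "(x, y) \<in> F \<longleftrightarrow> (inv_into ?U f x, inv_into ?U f y) \<in> E" if "x \<in> T" "y \<in> T" for x y
    proof -
      have "inv_into ?U f x \<in> ?U" "inv_into ?U f y \<in> ?U" using that bij_betwE[OF g] by blast+
      then have "(inv_into ?U f x, inv_into ?U f y) \<in> E \<longleftrightarrow>
          (f (inv_into ?U f x), f (inv_into ?U f y)) \<in> F" using f(2) by blast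
      then show ?thesis using that by (simp only: bij_betw_inv_into_right[OF f(1)])
    qed
    then show "\<exists>g. bij_betw g T ?U \<and> (\<forall>x\<in>T. \<forall>y\<in>T. (x, y) \<in> F \<longleftrightarrow> (g x, g y) \<in> E)"
      by (intro exI[of _ "inv_into ?U f"] conjI g ballI)
  qed
qed

text \<open>The isomorphism of the card without \<open>u\<close> and \<open>v\<close> is completed
  to a permutation by an arbitrary bijection onto the two vertices missing from its partner
  card.\<close>

lemma same_deck_permutation:
  assumes "finite V" "same_deck (card V - 2) V E F" "u \<in> V" "v \<in> V" "u \<noteq> v"
    and "E \<subseteq> V \<times> V" "F \<subseteq> V \<times> V"
  shows "\<exists>f. f permutes V \<and> (\<forall>x y. x \<notin> {u, v} \<longrightarrow> y \<notin> {u, v} \<longrightarrow>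
    ((x, y) \<in> E \<longleftrightarrow> (f x, f y) \<in> F))"
proof -
  let ?T = "V - {u, v}"
  have "card ?T = card V - 2" using assms by (simp add: card_Diff_subset)
  then obtain T' f where T': "T' \<subseteq> V" "card T' = card V - 2" and f: "bij_betw f ?T T'"
    "\<forall>x\<in>?T. \<forall>y\<in>?T. (x, y) \<in> E \<longleftrightarrow> (f x, f y) \<in> F"
    using assms(2) unfolding same_deck_def bij_betw_def
    by (smt (verit, del_insts) Diff_subset image_eqI mem_Collect_eq)
  have fin: "finite T'" using T'(1) assms(1) by (rule finite_subset)
  have "card {u, v} = card (V - T')"
    using T' fin assms card_mono[of V "{u, v}"] by (simp add: card_Diff_subset)
  then obtain g where g: "bij_betw g {u, v} (V - T')"
    using assms(1) by (metis finite.emptyI finite.insertI finite_Diff finite_same_card_bij)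
  define p where "p = (\<lambda>x. if x \<in> ?T then f x else if x \<in> {u, v} then g x else x)"
  have "bij_betw p (?T \<union> {u, v}) (T' \<union> (V - T'))"
  proof (rule bij_betw_combine)
    show "bij_betw p ?T T'" using f(1) by (rule bij_betw_cong[THEN iffD1, rotated]) (simp add: p_def)
    show "bij_betw p {u, v} (V - T')" using g by (rule bij_betw_cong[THEN iffD1, rotated]) (auto simp: p_def)
  qed blast
  moreover have "?T \<union> {u, v} = V" "T' \<union> (V - T') = V" using assms(3,4) T'(1) by blast+
  ultimately have bij: "bij_betw p V V" by simp
  have p: "p permutes V"
    by (rule bij_imp_permutes[OF bij]) (use assms(3,4) in \<open>auto simp: p_def\<close>)
  have "(x, y) \<in> E \<longleftrightarrow> (p x, p y) \<in> F" if "x \<notin> {u, v}" "y \<notin> {u, v}" for x y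
  proof (cases "x \<in> V \<and> y \<in> V")
    case True
    then show ?thesis using that f(2) by (simp add: p_def)
  next
    case False
    then have "(x, y) \<notin> E" using assms(6) by blast
    moreover have "\<not> (p x \<in> V \<and> p y \<in> V)" using False permutes_in_image[OF p] by blast
    then have "(p x, p y) \<notin> F" using assms(7) by blast
    ultimately show ?thesis by blast
  qed
  then show ?thesis using p by blast
qed

text \<open>Kelly's lemma: every \<open>s\<close>-set lies in the same number of \<open>k\<close>-sets.\<close>
lemma sum_over_cards:
  fixes w :: "'a set \<Rightarrow> nat"
  assumes "finite V" "s \<le> k" "k \<le> card V"
  shows "(\<Sum>T | T \<subseteq> V \<and> card T = k. \<Sum>S | S \<subseteq> T \<and> card S = s. w S) =
    (card V - s choose (k - s)) * (\<Sum>S | S \<subseteq> V \<and> card S = s. w S)"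
proof -
  let ?D = "\<lambda>k. {T. T \<subseteq> V \<and> card T = k}"
  have fin: "finite (?D k)" for k using assms(1) by simp
  have finT: "finite T" if "T \<subseteq> V" for T using that assms(1) by (rule finite_subset)
  have "(\<Sum>T\<in>?D k. \<Sum>S | S \<subseteq> T \<and> card S = s. w S) = (\<Sum>T\<in>?D k. \<Sum>S | S \<in> ?D s \<and> S \<subseteq> T. w S)"
    by (intro sum.cong) auto
  also have "\<dots> = (\<Sum>S\<in>?D s. \<Sum>T | T \<in> ?D k \<and> S \<subseteq> T. w S)"
    by (rule sum.swap_restrict[OF fin fin])
  also have "\<dots> = (\<Sum>S\<in>?D s. (card V - s choose (k - s)) * w S)"
  proof (rule sum.cong[OF refl])
    fix S assume S: "S \<in> ?D s"
    have "bij_betw (\<lambda>U. U \<union> S) {U. U \<subseteq> V - S \<and> card U = k - s} {T. T \<in> ?D k \<and> S \<subseteq> T}"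
    proof (rule bij_betw_byWitness[where f' = "\<lambda>T. T - S"])
      show "\<forall>U\<in>{U. U \<subseteq> V - S \<and> card U = k - s}. U \<union> S - S = U" by auto
      show "\<forall>T\<in>{T. T \<in> ?D k \<and> S \<subseteq> T}. T - S \<union> S = T" by auto
      show "(\<lambda>U. U \<union> S) ` {U. U \<subseteq> V - S \<and> card U = k - s} \<subseteq> {T. T \<in> ?D k \<and> S \<subseteq> T}"
      proof clarify
        fix U assume U: "U \<subseteq> V - S" "card U = k - s"
        then have "card (U \<union> S) = card U + card S"
          using S finT[of U] finT[of S] by (intro card_Un_disjoint) auto
        then show "U \<union> S \<in> ?D k \<and> S \<subseteq> U \<union> S" using U S assms(2) by auto
      qed
      show "(\<lambda>T. T - S) ` {T. T \<in> ?D k \<and> S \<subseteq> T} \<subseteq> {U. U \<subseteq> V - S \<and> card U = k - s}"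
        using S finT by (auto simp: card_Diff_subset)
    qed
    then have "card {T. T \<in> ?D k \<and> S \<subseteq> T} = card (V - S) choose (k - s)"
      using n_subsets[of "V - S" "k - s"] assms(1) by (simp add: bij_betw_same_card[symmetric])
    then show "(\<Sum>T | T \<in> ?D k \<and> S \<subseteq> T. w S) = (card V - s choose (k - s)) * w S"
      using S finT[of S] by (simp add: card_Diff_subset)
  qed
  finally show ?thesis by (simp add: sum_distrib_left)
qed

text \<open>\<open>w\<close> is any statistic of induced subgraphs. By Kelly's lemma its total over
  \<open>V\<close> is, up to a nonzero binomial factor, a sum over cards, and the bijection of cards
  matches these sums term by term.\<close>

lemma same_deck_sum_eq:
  fixes w :: "('a \<times> 'a) set \<Rightarrow> 'a set \<Rightarrow> nat"
  assumes "finite V" "s \<le> k" "k \<le> card V" "same_deck k V E F"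
    and inv: "\<And>f S. inj_on f S \<Longrightarrow> (\<And>x y. x \<in> S \<Longrightarrow> y \<in> S \<Longrightarrow> (x, y) \<in> E \<longleftrightarrow> (f x, f y) \<in> F) \<Longrightarrow>
      w E S = w F (f ` S)"
  shows "(\<Sum>S | S \<subseteq> V \<and> card S = s. w E S) = (\<Sum>S | S \<subseteq> V \<and> card S = s. w F S)"
proof -
  let ?D = "{T. T \<subseteq> V \<and> card T = k}"
  obtain \<phi> where \<phi>: "bij_betw \<phi> ?D ?D" "\<And>T. T \<in> ?D \<Longrightarrow>
      \<exists>f. bij_betw f T (\<phi> T) \<and> (\<forall>x\<in>T. \<forall>y\<in>T. (x, y) \<in> E \<longleftrightarrow> (f x, f y) \<in> F)"
    using assms(4) unfolding same_deck_def by blast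
  have "(\<Sum>T\<in>?D. \<Sum>S | S \<subseteq> T \<and> card S = s. w E S) = (\<Sum>T\<in>?D. \<Sum>S | S \<subseteq> \<phi> T \<and> card S = s. w F S)"
  proof (rule sum.cong[OF refl])
    fix T assume T: "T \<in> ?D"
    obtain f where f: "bij_betw f T (\<phi> T)" "\<forall>x\<in>T. \<forall>y\<in>T. (x, y) \<in> E \<longleftrightarrow> (f x, f y) \<in> F"
      using \<phi>(2)[OF T] by blast
    have inj: "inj_on f S" if "S \<subseteq> T" for S using f(1) that by (auto simp: bij_betw_def inj_on_subset)
    have bij: "bij_betw ((`) f) {S. S \<subseteq> T \<and> card S = s} {S. S \<subseteq> \<phi> T \<and> card S = s}"
    proof (rule bij_betwI')
      fix S S' assume "S \<in> {S. S \<subseteq> T \<and> card S = s}" "S' \<in> {S. S \<subseteq> T \<and> card S = s}"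
      then show "f ` S = f ` S' \<longleftrightarrow> S = S'" using inj[OF subset_refl] by (simp add: inj_on_image_eq_iff)
    next
      fix S assume "S \<in> {S. S \<subseteq> T \<and> card S = s}"
      then show "f ` S \<in> {S. S \<subseteq> \<phi> T \<and> card S = s}"
        using f(1) inj by (auto simp: bij_betw_def card_image)
    next
      fix S' assume S': "S' \<in> {S. S \<subseteq> \<phi> T \<and> card S = s}"
      then have "S' \<subseteq> f ` T" using f(1) by (simp add: bij_betw_def)
      then obtain S where "S \<subseteq> T" "S' = f ` S" by (rule subset_imageE)
      then show "\<exists>S\<in>{S. S \<subseteq> T \<and> card S = s}. S' = f ` S"
        using S' inj by (auto simp: card_image)
    qed
    show "(\<Sum>S | S \<subseteq> T \<and> card S = s. w E S) = (\<Sum>S | S \<subseteq> \<phi> T \<and> card S = s. w F S)"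
      unfolding sum.reindex_bij_betw[OF bij, symmetric]
    proof (rule sum.cong[OF refl])
      fix S assume "S \<in> {S. S \<subseteq> T \<and> card S = s}"
      then show "w E S = w F (f ` S)" using f(2) by (intro inv inj) auto
    qed
  qed
  also have "\<dots> = (\<Sum>T\<in>?D. \<Sum>S | S \<subseteq> T \<and> card S = s. w F S)"
    by (rule sum.reindex_bij_betw[OF \<phi>(1)])
  finally have "(card V - s choose (k - s)) * (\<Sum>S | S \<subseteq> V \<and> card S = s. w E S) =
      (card V - s choose (k - s)) * (\<Sum>S | S \<subseteq> V \<and> card S = s. w F S)"
    unfolding sum_over_cards[OF assms(1-3)] .
  moreover have "card V - s choose (k - s) \<noteq> 0"
    using assms(2,3) by (simp add: diff_le_mono)
  ultimately show ?thesis by simp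
qed

text \<open>Sorting objects by the vertex set they occupy brings a global count into the form of
  \<open>same_deck_sum_eq\<close>.\<close>

lemma card_by_support:
  assumes "finite V" "finite X" "\<And>x. x \<in> X \<Longrightarrow> p x \<subseteq> V \<and> card (p x) = s"
  shows "(\<Sum>S | S \<subseteq> V \<and> card S = s. card {x \<in> X. p x = S}) = card X"
proof -
  let ?D = "{S. S \<subseteq> V \<and> card S = s}"
  have "card X = card (\<Union>S\<in>?D. {x \<in> X. p x = S})"
    using assms(3) by (intro arg_cong[where f = card]) auto
  also have "\<dots> = (\<Sum>S\<in>?D. card {x \<in> X. p x = S})"
    using assms(1,2) by (intro card_UN_disjoint) auto
  finally show ?thesis by simp
qed

text \<open>Paths on three vertices, ordered and with the centre first. Their number supplies the
  second moment of the degree sequence, see \<open>card_cherries\<close>.\<close>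

definition cherries :: "('a \<times> 'a) set \<Rightarrow> ('a \<times> 'a \<times> 'a) set" where
  "cherries E = {(y, x, z). (y, x) \<in> E \<and> (y, z) \<in> E \<and> x \<noteq> z}"

lemma card_cherries:
  assumes "finite V" "E \<subseteq> V \<times> V"
  shows "card (cherries E) = (\<Sum>y\<in>V. card (E `` {y}) * (card (E `` {y}) - 1))"
proof -
  have fin: "finite (E `` {y})" for y using assms by (meson finite_Image finite_SigmaI finite_subset)
  have "cherries E = (SIGMA y:V. SIGMA x:E `` {y}. E `` {y} - {x})"
    using assms(2) by (auto simp: cherries_def)
  then show ?thesis using assms(1) fin by (simp add: card_SigmaI card_Diff_singleton_if)
qed

lemma card_edges:
  assumes "finite V" "E \<subseteq> V \<times> V"
  shows "card E = (\<Sum>y\<in>V. card (E `` {y}))"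
proof -
  have "finite (E `` {y})" for y using assms by (meson finite_Image finite_SigmaI finite_subset)
  moreover have "E = (SIGMA y:V. E `` {y})" using assms(2) by auto
  ultimately show ?thesis using assms(1) card_SigmaI[of V "\<lambda>y. E `` {y}"] by simp
qed

lemma same_deck_card_edges:
  assumes "finite V" "2 \<le> k" "k \<le> card V" "same_deck k V E F"
    and "E \<subseteq> V \<times> V" "F \<subseteq> V \<times> V" "irrefl E" "irrefl F"
  shows "card E = card F"
proof -
  let ?w = "\<lambda>E S. card {p \<in> E. {fst p, snd p} = S}"
  have sum: "(\<Sum>S | S \<subseteq> V \<and> card S = 2. ?w E S) = card E" if "E \<subseteq> V \<times> V" "irrefl E" for E
    by (rule card_by_support[OF assms(1)])
      (use that assms(1) finite_subset in \<open>fastforce simp: irrefl_def card_insert_if\<close>)+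
  have "(\<Sum>S | S \<subseteq> V \<and> card S = 2. ?w E S) = (\<Sum>S | S \<subseteq> V \<and> card S = 2. ?w F S)"
  proof (rule same_deck_sum_eq[OF assms(1-4)])
    fix f S assume f: "inj_on f S" "\<And>x y. x \<in> S \<Longrightarrow> y \<in> S \<Longrightarrow> (x, y) \<in> E \<longleftrightarrow> (f x, f y) \<in> F"
    have "bij_betw (map_prod f f) {p \<in> E. {fst p, snd p} = S} {p \<in> F. {fst p, snd p} = f ` S}"
      unfolding bij_betw_def
    proof
      show "inj_on (map_prod f f) {p \<in> E. {fst p, snd p} = S}"
        by (rule inj_on_subset[OF map_prod_inj_on[OF f(1) f(1)]]) auto
      show "map_prod f f ` {p \<in> E. {fst p, snd p} = S} = {p \<in> F. {fst p, snd p} = f ` S}"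
      proof (intro equalityI subsetI)
        fix q assume "q \<in> map_prod f f ` {p \<in> E. {fst p, snd p} = S}"
        then show "q \<in> {p \<in> F. {fst p, snd p} = f ` S}" using f(2) by auto
      next
        fix q assume q: "q \<in> {p \<in> F. {fst p, snd p} = f ` S}"
        then have "fst q \<in> f ` S" "snd q \<in> f ` S" by blast+
        then obtain x y where xy: "x \<in> S" "y \<in> S" "q = (f x, f y)" by (metis imageE prod.collapse)
        have "f ` {x, y} = f ` S" using q xy by simp
        then have "{x, y} = S" using inj_on_image_eq_iff[OF f(1), of "{x, y}" S] xy by simp
        then show "q \<in> map_prod f f ` {p \<in> E. {fst p, snd p} = S}"
          using q xy f(2) by (intro image_eqI[of _ _ "(x, y)"]) auto
      qed
    qed
    then show "?w E S = ?w F (f ` S)" by (rule bij_betw_same_card)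
  qed
  then show ?thesis unfolding sum[OF assms(5,7)] sum[OF assms(6,8)] .
qed

lemma same_deck_card_cherries:
  assumes "finite V" "3 \<le> k" "k \<le> card V" "same_deck k V E F"
    and "E \<subseteq> V \<times> V" "F \<subseteq> V \<times> V" "irrefl E" "irrefl F"
  shows "card (cherries E) = card (cherries F)"
proof -
  let ?s = "\<lambda>(x, y, z). {x, y, z}"
  let ?w = "\<lambda>E S. card {p \<in> cherries E. ?s p = S}"
  have sum: "(\<Sum>S | S \<subseteq> V \<and> card S = 3. ?w E S) = card (cherries E)" if "E \<subseteq> V \<times> V" "irrefl E" for E
  proof (rule card_by_support[OF assms(1)])
    have "cherries E \<subseteq> V \<times> V \<times> V" using that by (auto simp: cherries_def)
    then show "finite (cherries E)" using assms(1) by (meson finite_SigmaI finite_subset)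
    fix p assume "p \<in> cherries E"
    then obtain x y z where p: "p = (x, y, z)" "(x, y) \<in> E" "(x, z) \<in> E" "y \<noteq> z"
      by (auto simp: cherries_def)
    then have "x \<noteq> y" "x \<noteq> z" using that(2) by (auto simp: irrefl_def)
    then show "?s p \<subseteq> V \<and> card (?s p) = 3" using p that(1) by auto
  qed
  have "(\<Sum>S | S \<subseteq> V \<and> card S = 3. ?w E S) = (\<Sum>S | S \<subseteq> V \<and> card S = 3. ?w F S)"
  proof (rule same_deck_sum_eq[OF assms(1-4)])
    fix f S assume f: "inj_on f S" "\<And>x y. x \<in> S \<Longrightarrow> y \<in> S \<Longrightarrow> (x, y) \<in> E \<longleftrightarrow> (f x, f y) \<in> F"
    let ?f = "\<lambda>(x, y, z). (f x, f y, f z)"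
    have "bij_betw ?f {p \<in> cherries E. ?s p = S} {p \<in> cherries F. ?s p = f ` S}"
      unfolding bij_betw_def
    proof
      show "inj_on ?f {p \<in> cherries E. ?s p = S}"
        using f(1) by (auto simp: inj_on_def)
      show "?f ` {p \<in> cherries E. ?s p = S} = {p \<in> cherries F. ?s p = f ` S}"
      proof (intro equalityI subsetI)
        fix q assume "q \<in> ?f ` {p \<in> cherries E. ?s p = S}"
        then obtain x y z where "q = (f x, f y, f z)" "(x, y) \<in> E" "(x, z) \<in> E" "y \<noteq> z" "{x, y, z} = S"
          by (auto simp: cherries_def)
        moreover from this have "f y \<noteq> f z" using f(1) by (auto simp: inj_on_def)
        ultimately show "q \<in> {p \<in> cherries F. ?s p = f ` S}" using f(2) by (auto simp: cherries_def)
      next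
        fix q assume q: "q \<in> {p \<in> cherries F. ?s p = f ` S}"
        obtain a b c where abc: "q = (a, b, c)" by (cases q)
        then have "{a, b, c} = f ` S" using q by simp
        then have "a \<in> f ` S" "b \<in> f ` S" "c \<in> f ` S" by blast+
        then obtain x y z where xyz: "x \<in> S" "y \<in> S" "z \<in> S" "q = (f x, f y, f z)"
          unfolding abc by blast
        have "f ` {x, y, z} = f ` S" using q xyz by simp
        then have "{x, y, z} = S" using inj_on_image_eq_iff[OF f(1), of "{x, y, z}" S] xyz by simp
        then show "q \<in> ?f ` {p \<in> cherries E. ?s p = S}"
          using q xyz f(2) by (intro image_eqI[of _ _ "(x, y, z)"]) (auto simp: cherries_def)
      qed
    qed
    then show "?w E S = ?w F (f ` S)" by (rule bij_betw_same_card)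
  qed
  then show ?thesis unfolding sum[OF assms(5,7)] sum[OF assms(6,8)] .
qed

lemma same_deck_card_dense:
  assumes "finite V" "s \<le> k" "k \<le> card V" "same_deck k V E F"
  shows "card {S. S \<subseteq> V \<and> card S = s \<and> m \<le> card (E \<inter> S \<times> S)} =
    card {S. S \<subseteq> V \<and> card S = s \<and> m \<le> card (F \<inter> S \<times> S)}"
proof -
  let ?w = "\<lambda>E S. of_bool (m \<le> card (E \<inter> S \<times> S)) :: nat"
  have sum: "(\<Sum>S | S \<subseteq> V \<and> card S = s. ?w E S) = card {S. S \<subseteq> V \<and> card S = s \<and> m \<le> card (E \<inter> S \<times> S)}" for E
    using assms(1) by (simp add: sum_of_bool_eq Collect_conj_eq Int_assoc flip: Collect_conj_eq)
  have "(\<Sum>S | S \<subseteq> V \<and> card S = s. ?w E S) = (\<Sum>S | S \<subseteq> V \<and> card S = s. ?w F S)"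
  proof (rule same_deck_sum_eq[OF assms])
    fix f S assume f: "inj_on f S" "\<And>x y. x \<in> S \<Longrightarrow> y \<in> S \<Longrightarrow> (x, y) \<in> E \<longleftrightarrow> (f x, f y) \<in> F"
    have "map_prod f f ` (E \<inter> S \<times> S) = F \<inter> (f ` S) \<times> (f ` S)" using f(2) by force
    moreover have "inj_on (map_prod f f) (E \<inter> S \<times> S)"
      by (rule inj_on_subset[OF map_prod_inj_on[OF f(1) f(1)]]) auto
    ultimately have "card (E \<inter> S \<times> S) = card (F \<inter> (f ` S) \<times> (f ` S))" by (metis card_image)
    then show "?w E S = ?w F (f ` S)" by simp
  qed
  then show ?thesis unfolding sum .
qed

text \<open>The two sums determine the sum of the squared deviations of \<open>deg x\<close> from
  \<open>d\<close>, which vanishes.\<close>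

lemma regular_if_same_moments:
  fixes deg :: "'a \<Rightarrow> nat"
  assumes "finite V" "(\<Sum>x\<in>V. deg x) = d * card V" "(\<Sum>x\<in>V. deg x * (deg x - 1)) = d * (d - 1) * card V" "x \<in> V"
  shows "deg x = d"
proof -
  have i: "int (n * (n - 1)) = int n * int n - int n" for n by (cases n) (auto simp: algebra_simps)
  have "(\<Sum>x\<in>V. (int (deg x) - int d)\<^sup>2) =
      (\<Sum>x\<in>V. int (deg x * (deg x - 1)) + (1 - 2 * int d) * int (deg x) + int d * int d)"
    by (rule sum.cong[OF refl]) (simp add: i power2_eq_square algebra_simps)
  also have "\<dots> = int (\<Sum>x\<in>V. deg x * (deg x - 1)) + (1 - 2 * int d) * int (\<Sum>x\<in>V. deg x) + int d * int d * int (card V)"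
    by (simp add: sum.distrib sum_distrib_left)
  also have "\<dots> = 0"
    unfolding assms(2,3) by (simp add: i algebra_simps)
  finally have "(\<Sum>x\<in>V. (int (deg x) - int d)\<^sup>2) = 0" .
  then have "(int (deg x) - int d)\<^sup>2 = 0"
    using assms(1,4) by (subst (asm) sum_nonneg_eq_0_iff) auto
  then show ?thesis by simp
qed

lemma cubic_same_deck_isomorphic:
  assumes V: "finite V" "V \<noteq> {}"
    and E: "E \<subseteq> V \<times> V" "sym E" "irrefl E" "\<And>x. x \<in> V \<Longrightarrow> card (E `` {x}) = 3"
    and F: "F \<subseteq> V \<times> V" "sym F" "irrefl F"
    and deck: "same_deck (card V - 2) V E F"
  shows "isomorphic_on V E F"
proof (rule ccontr)
  assume not_iso: "\<not> isomorphic_on V E F"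
  obtain x where x: "x \<in> V" using V(2) by blast
  have "E `` {x} \<subseteq> V - {x}" using E(1,3) by (auto simp: irrefl_def)
  then have "card (E `` {x}) \<le> card (V - {x})" using V(1) by (intro card_mono) simp_all
  then have "3 \<le> card (V - {x})" using E(4)[OF x] by simp
  then have n: "4 \<le> card V" using x V(1) by simp
  have cE: "card E = 3 * card V" using card_edges[OF V(1) E(1)] E(4) by simp
  have cEF: "card E = card F"
    using same_deck_card_edges[OF V(1) _ _ deck] E F n by simp
  show False
  \<comment> \<open>On four vertices the cards have only two vertices, too few to contain a cherry.
    But then \<open>E\<close> is complete and the number of edges settles the matter.\<close>
  proof (cases "card V = 4")
    case True
    let ?K = "V \<times> V - Id_on V"
    have "card ?K = card (V \<times> V) - card (Id_on V)"
      using V(1) by (intro card_Diff_subset) (auto simp: Id_on_def)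
    moreover have "card (Id_on V) = card V" by (simp add: Id_on_def card_image inj_on_def UNION_singleton_eq_range)
    ultimately have cK: "card ?K = 12" using True by (simp add: card_cartesian_product)
    have "E \<subseteq> ?K" "F \<subseteq> ?K" using E(1,3) F(1,3) by (auto simp: irrefl_def)
    moreover have "card E = card ?K" "card F = card ?K" using cK cE cEF True by simp_all
    ultimately have "E = ?K" "F = ?K"
      using card_subset_eq[of ?K] V(1) by simp_all
    then have "isomorphic_on V E F"
      unfolding isomorphic_on_def by (intro exI[of _ id]) (simp add: permutes_id)
    then show False using not_iso by blast
  next
    case False
    then have "card (cherries F) = card (cherries E)"
      using same_deck_card_cherries[OF V(1) _ _ deck] E F n by simp
    then have "(\<Sum>y\<in>V. card (F `` {y}) * (card (F `` {y}) - 1)) = 3 * (3 - 1) * card V"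
      using E(4) by (simp add: card_cherries[OF V(1)] E(1) F(1))
    moreover have "(\<Sum>y\<in>V. card (F `` {y})) = 3 * card V"
      using cE cEF card_edges[OF V(1) F(1)] by simp
    ultimately have F3: "card (F `` {x}) = 3" if "x \<in> V" for x
      using regular_if_same_moments[OF V(1), of "\<lambda>y. card (F `` {y})" 3] that by blast
    have deck': "same_deck (card V - 2) V F E" using deck by (rule same_deck_sym)
    interpret deck_pair V "\<lambda>\<beta>. if \<beta> then E else F"
    proof
      show "\<not> isomorphic_on V (if \<beta> then E else F) (if \<not> \<beta> then E else F)" for \<beta>
        using not_iso isomorphic_on_sym[of V F E] by auto
      show "\<exists>f. f permutes V \<and> (\<forall>x y. x \<notin> {u, v} \<longrightarrow> y \<notin> {u, v} \<longrightarrow>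
          ((x, y) \<in> (if \<beta> then E else F)) = ((f x, f y) \<in> (if \<not> \<beta> then E else F)))"
        if "u \<in> V" "v \<in> V" "u \<noteq> v" for u v \<beta>
        using same_deck_permutation[OF V(1) deck that E(1) F(1)]
          same_deck_permutation[OF V(1) deck' that F(1) E(1)] by simp
      show "card {S. S \<subseteq> V \<and> card S = k \<and> 2 * k \<le> card ((if \<beta> then E else F) \<inter> S \<times> S)} =
          card {S. S \<subseteq> V \<and> card S = k \<and> 2 * k \<le> card ((if \<not> \<beta> then E else F) \<inter> S \<times> S)}"
        if "k \<le> card V - 2" for k \<beta>
        using same_deck_card_dense[OF V(1) that _ deck, of "2 * k"] by simp
    qed (use V E F F3 in auto)
    show False by (rule no_deck_pair)
  qed
qed

section \<open>From digraphs to relations\<close>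

lemma arcs_ends_graph:
  assumes "graph G"
  shows "arcs_ends G \<subseteq> verts G \<times> verts G" "sym (arcs_ends G)" "irrefl (arcs_ends G)"
proof -
  interpret graph G by fact
  show "arcs_ends G \<subseteq> verts G \<times> verts G" by (auto simp: arcs_ends_conv)
  show "sym (arcs_ends G)" using sym_arcs by (simp add: symmetric_def)
  show "irrefl (arcs_ends G)" using no_loops by (auto simp: irrefl_def arcs_ends_conv)
qed

lemma out_degree_arcs_ends:
  assumes "graph G"
  shows "out_degree G v = card (arcs_ends G `` {v})"
proof -
  interpret graph G by fact
  have "arcs_ends G `` {v} = head G ` out_arcs G v" by (force simp: arcs_ends_conv)
  moreover have "inj_on (head G) (out_arcs G v)"
    using no_multi_arcs by (auto simp: inj_on_def arc_to_ends_def)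
  ultimately show ?thesis by (simp add: out_degree_def card_image)
qed

lemma graph_induce_subgraph:
  assumes "graph G" "S \<subseteq> verts G"
  shows "graph (G \<restriction> S)"
proof -
  interpret graph G by fact
  show ?thesis
  proof unfold_locales
    show "symmetric (G \<restriction> S)"
      using sym_arcs by (fastforce simp: symmetric_conv)
  qed (use finite_subset[OF assms(2)] no_loops no_multi_arcs in \<open>auto simp: arc_to_ends_def\<close>)
qed

lemma arcs_ends_induce_subgraph: "arcs_ends (G \<restriction> S) = arcs_ends G \<inter> S \<times> S"
  by (auto simp: arcs_ends_conv)

lemma digraph_isoD:
  assumes "digraph_iso G H"
  obtains f where "bij_betw f (verts G) (verts H)"
    "\<And>x y. x \<in> verts G \<Longrightarrow> y \<in> verts G \<Longrightarrow> (x, y) \<in> arcs_ends G \<longleftrightarrow> (f x, f y) \<in> arcs_ends H"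
proof -
  obtain h where h: "pre_digraph.digraph_isomorphism G h" "H = app_iso h G"
    using assms unfolding digraph_iso_def by blast
  let ?f = "iso_verts h"
  have inj: "inj_on ?f (verts G)" and wf: "wf_digraph G"
    using h(1) by (auto simp: pre_digraph.digraph_isomorphism_def)
  have ends: "arcs_ends H = (\<lambda>(u, v). (?f u, ?f v)) ` arcs_ends G"
    unfolding h(2) by (rule wf_digraph.arcs_ends_app_iso_eq[OF wf h(1)])
  have sub: "arcs_ends G \<subseteq> verts G \<times> verts G"
    using wf by (auto simp: arcs_ends_conv wf_digraph_def)
  show ?thesis
  proof (rule that[of ?f])
    show "bij_betw ?f (verts G) (verts H)" using inj by (simp add: bij_betw_def h(2))
    show "(x, y) \<in> arcs_ends G \<longleftrightarrow> (?f x, ?f y) \<in> arcs_ends H" if "x \<in> verts G" "y \<in> verts G" for x y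
    proof
      assume "(?f x, ?f y) \<in> arcs_ends H"
      then obtain u v where "(u, v) \<in> arcs_ends G" "?f u = ?f x" "?f v = ?f y"
        unfolding ends by auto
      then show "(x, y) \<in> arcs_ends G" using sub that inj by (auto dest: inj_onD)
    qed (auto simp: ends)
  qed
qed

text \<open>Arcs of a simple graph are determined by their ends, so the vertex map alone dictates
  the arc map \<open>g\<close>.\<close>

lemma digraph_isoI:
  assumes G: "graph G" and H: "graph H" and f: "bij_betw f (verts G) (verts H)"
    and ends: "\<And>x y. x \<in> verts G \<Longrightarrow> y \<in> verts G \<Longrightarrow> (x, y) \<in> arcs_ends G \<longleftrightarrow> (f x, f y) \<in> arcs_ends H"
  shows "digraph_iso G H"
proof -
  interpret G: graph G by fact
  interpret H: graph H by fact
  have inj: "f x = f y \<longleftrightarrow> x = y" if "x \<in> verts G" "y \<in> verts G" for x y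
    using f that by (auto simp: bij_betw_def dest: inj_onD)
  have "\<exists>a. a \<in> arcs H \<and> tail H a = f (tail G e) \<and> head H a = f (head G e)" if "e \<in> arcs G" for e
  proof -
    have "(tail G e, head G e) \<in> arcs_ends G" using that by (auto simp: arcs_ends_conv)
    then have "(f (tail G e), f (head G e)) \<in> arcs_ends H" using ends that by simp
    then show ?thesis by (auto simp: arcs_ends_conv)
  qed
  then obtain g where g: "\<And>e. e \<in> arcs G \<Longrightarrow> g e \<in> arcs H"
    "\<And>e. e \<in> arcs G \<Longrightarrow> tail H (g e) = f (tail G e)"
    "\<And>e. e \<in> arcs G \<Longrightarrow> head H (g e) = f (head G e)" by metis
  \<comment> \<open>\<open>app_iso\<close> takes the end maps of the new graph from
    \<open>h\<close>. Choosing those of \<open>H\<close> gives equality of records, also off the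
    arcs.\<close>
  define h where "h = \<lparr>iso_verts = f, iso_arcs = g, iso_head = head H, iso_tail = tail H\<rparr>"
  have "inj_on g (arcs G)"
  proof (rule inj_onI)
    fix e e' assume e: "e \<in> arcs G" "e' \<in> arcs G" "g e = g e'"
    then have "f (tail G e) = f (tail G e')" "f (head G e) = f (head G e')" using g by metis+
    then show "e = e'" using e inj by (intro G.no_multi_arcs) (simp_all add: arc_to_ends_def)
  qed
  then have "G.digraph_isomorphism h"
    using f g G.wf_digraph by (simp add: G.digraph_isomorphism_def h_def bij_betw_def)
  moreover have "g ` arcs G = arcs H"
  proof (intro equalityI subsetI)
    fix a assume a: "a \<in> arcs H"
    then have "tail H a \<in> f ` verts G" "head H a \<in> f ` verts G"
      using f by (simp_all add: bij_betw_def)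
    then obtain x y where xy: "x \<in> verts G" "y \<in> verts G" "tail H a = f x" "head H a = f y" by auto
    then have "(f x, f y) \<in> arcs_ends H" using a by (force simp: arcs_ends_conv)
    then have "(x, y) \<in> arcs_ends G" using ends xy by blast
    then obtain e where e: "e \<in> arcs G" "x = tail G e" "y = head G e" by (auto simp: arcs_ends_conv)
    then have "g e = a" using g a xy by (intro H.no_multi_arcs) (simp_all add: arc_to_ends_def)
    then show "a \<in> g ` arcs G" using e by blast
  qed (use g in auto)
  then have "H = app_iso h G"
    using f by (intro pre_digraph.equality) (simp_all add: h_def bij_betw_def)
  ultimately show ?thesis unfolding digraph_iso_def by blast
qed

section \<open>Matching the two decks on one vertex set\<close>

lemma image_mset_eq_bij:
  assumes fin: "finite A" "finite B"
    and eq: "image_mset f (mset_set A) = image_mset g (mset_set B)"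
  obtains \<phi> where "bij_betw \<phi> A B" "\<And>x. x \<in> A \<Longrightarrow> f x = g (\<phi> x)"
proof -
  have "card A = card B" using arg_cong[OF eq, of size] by simp
  then obtain h where h: "bij_betw h A B" using fin finite_same_card_bij by blast
  have "mset_set B = image_mset h (mset_set A)"
    using h by (metis bij_betw_def image_mset_mset_set)
  then have "image_mset f (mset_set A) = image_mset (g \<circ> h) (mset_set A)"
    using eq by (simp add: multiset.map_comp)
  then obtain p where p: "p permutes A" "\<forall>x\<in>A. f x = (g \<circ> h) (p x)"
    using image_mset_eq_implies_permutes[OF fin(1)] by blast
  show ?thesis
  proof (rule that[of "h \<circ> p"])
    show "bij_betw (h \<circ> p) A B" using permutes_imp_bij[OF p(1)] h by (rule bij_betw_trans)
  qed (use p(2) in simp)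
qed

text \<open>For \<open>k > 0\<close> the binomial coefficient is strictly increasing in its upper
  argument from \<open>k - 1\<close> on.\<close>

lemma binomial_inj_left:
  fixes k m n :: nat
  assumes "(m choose k) = (n choose k)" "0 < k" "k \<le> n"
  shows "m = n"
proof -
  have less: "(a choose k) < (b choose k)" if "a < b" "k \<le> b" for a b
  proof -
    obtain c where c: "b = Suc c" using \<open>a < b\<close> by (cases b) auto
    obtain j where j: "k = Suc j" using assms(2) by (cases k) auto
    have "(a choose k) \<le> (c choose k)" using that(1) c by (intro binomial_right_mono) simp
    moreover have "0 < (c choose j)" using that(2) c j by simp
    ultimately have "(a choose k) < (c choose j) + (c choose k)" by linarith
    then show ?thesis using c j by simp
  qed
  show ?thesis
  proof (rule linorder_cases[of m n])
    assume "n < m"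
    then have "k \<le> m" using assms(3) by simp
    then show ?thesis using less[OF \<open>n < m\<close>] assms(1) by simp
  qed (use less[of m n] assms in auto)
qed

text \<open>The vertices of \<open>H\<close> may have another type. A bijection
  \<open>\<psi>\<close> unrelated to the cards is enough to transport \<open>H\<close> to the
  vertices of \<open>G\<close>, as each card has its own isomorphism.\<close>

lemma same_deck_pullback:
  assumes G: "graph G" and H: "graph H" and \<psi>: "bij_betw \<psi> (verts G) (verts H)"
    and deck: "deck k G = deck k H"
  shows "same_deck k (verts G) (arcs_ends G)
    {(x, y) \<in> verts G \<times> verts G. (\<psi> x, \<psi> y) \<in> arcs_ends H}"
proof -
  let ?V = "verts G" and ?W = "verts H"
  let ?F = "{(x, y) \<in> ?V \<times> ?V. (\<psi> x, \<psi> y) \<in> arcs_ends H}"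
  have fin: "finite ?V" "finite ?W" using G H by (simp_all add: graph_def digraph_def fin_digraph.finite_verts)
  obtain \<phi> where \<phi>: "bij_betw \<phi> {S. S \<subseteq> ?V \<and> card S = k} {S. S \<subseteq> ?W \<and> card S = k}"
    "\<And>S. S \<in> {S. S \<subseteq> ?V \<and> card S = k} \<Longrightarrow> iso_class (G \<restriction> S) = iso_class (H \<restriction> \<phi> S)"
    using image_mset_eq_bij[OF _ _ deck[unfolded deck_def]] fin by auto
  let ?g = "inv_into ?V \<psi>"
  have g: "bij_betw ?g ?W ?V" using \<psi> by (rule bij_betw_inv_into)
  have inj_g: "inj_on ?g S" if "S \<subseteq> ?W" for S using g that by (auto simp: bij_betw_def inj_on_subset)
  have bij_g: "bij_betw ((`) ?g) {S. S \<subseteq> ?W \<and> card S = k} {S. S \<subseteq> ?V \<and> card S = k}"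
  proof (rule bij_betwI')
    fix S S' assume "S \<in> {S. S \<subseteq> ?W \<and> card S = k}" "S' \<in> {S. S \<subseteq> ?W \<and> card S = k}"
    then show "?g ` S = ?g ` S' \<longleftrightarrow> S = S'" using inj_g[OF subset_refl] by (simp add: inj_on_image_eq_iff)
  next
    fix S assume "S \<in> {S. S \<subseteq> ?W \<and> card S = k}"
    then show "?g ` S \<in> {S. S \<subseteq> ?V \<and> card S = k}"
      using g inj_g[of S] by (auto simp: bij_betw_def card_image)
  next
    fix S' assume S': "S' \<in> {S. S \<subseteq> ?V \<and> card S = k}"
    then have "S' \<subseteq> ?g ` ?W" using g by (simp add: bij_betw_def)
    then obtain S where "S \<subseteq> ?W" "S' = ?g ` S" by (rule subset_imageE)
    then show "\<exists>S\<in>{S. S \<subseteq> ?W \<and> card S = k}. S' = ?g ` S"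
      using S' inj_g by (auto simp: card_image)
  qed
  show ?thesis
    unfolding same_deck_def
  proof (intro exI[of _ "(`) ?g \<circ> \<phi>"] conjI allI impI)
    show "bij_betw ((`) ?g \<circ> \<phi>) {T. T \<subseteq> ?V \<and> card T = k} {T. T \<subseteq> ?V \<and> card T = k}"
      using \<phi>(1) bij_g by (rule bij_betw_trans)
    fix T assume T: "T \<subseteq> ?V \<and> card T = k"
    then have \<phi>T: "\<phi> T \<subseteq> ?W" using bij_betwE[OF \<phi>(1)] by blast
    have "iso_class (G \<restriction> T) = iso_class (H \<restriction> \<phi> T)" using \<phi>(2) T by blast
    then have "digraph_iso (G \<restriction> T) (H \<restriction> \<phi> T)"
      using iso_class_eq_iff graph_induce_subgraph[OF G] graph_induce_subgraph[OF H] T \<phi>T by blast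
    then obtain f where f: "bij_betw f T (\<phi> T)"
      "\<And>x y. x \<in> T \<Longrightarrow> y \<in> T \<Longrightarrow> (x, y) \<in> arcs_ends (G \<restriction> T) \<longleftrightarrow> (f x, f y) \<in> arcs_ends (H \<restriction> \<phi> T)"
      by (rule digraph_isoD) simp
    have "(x, y) \<in> arcs_ends G \<longleftrightarrow> ((?g \<circ> f) x, (?g \<circ> f) y) \<in> ?F" if "x \<in> T" "y \<in> T" for x y
    proof -
      have fT: "f x \<in> \<phi> T" "f y \<in> \<phi> T" using that bij_betwE[OF f(1)] by blast+
      then have W: "f x \<in> ?W" "f y \<in> ?W" using \<phi>T by blast+
      then have "?g (f x) \<in> ?V" "?g (f y) \<in> ?V" using bij_betwE[OF g] by blast+
      moreover have "\<psi> (?g (f x)) = f x" "\<psi> (?g (f y)) = f y"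
        using W by (simp_all add: bij_betw_inv_into_right[OF \<psi>])
      ultimately show ?thesis
        using f(2)[OF that] that fT by (simp add: arcs_ends_induce_subgraph)
    qed
    moreover have "bij_betw (?g \<circ> f) T (?g ` \<phi> T)"
      using f(1) by (rule bij_betw_trans) (simp add: bij_betw_def inj_g[OF \<phi>T])
    ultimately show "\<exists>h. bij_betw h T (((`) ?g \<circ> \<phi>) T) \<and>
        (\<forall>x\<in>T. \<forall>y\<in>T. (x, y) \<in> arcs_ends G \<longleftrightarrow> (h x, h y) \<in> ?F)"
      unfolding comp_apply[of "(`) ?g" \<phi>] by blast
  qed
qed

theorem theorem1p1:
  fixes G :: "('a, 'b) pre_digraph" and H :: "('c, 'd) pre_digraph" and n :: nat
  assumes "regular_graph 3 G" and "verts G \<noteq> {}" and "card (verts G) = n"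
    and "graph H"
    and "deck (n - 2) H = deck (n - 2) G"
  shows "digraph_iso H G"
proof -
  let ?V = "verts G" and ?E = "arcs_ends G"
  have G: "graph G" and deg: "\<And>v. v \<in> ?V \<Longrightarrow> card (?E `` {v}) = 3"
    using assms(1) out_degree_arcs_ends[of G] by (auto simp: regular_graph_def)
  note E = arcs_ends_graph[OF G] and F = arcs_ends_graph[OF assms(4)]
  have fin: "finite ?V" "finite (verts H)"
    using G assms(4) by (simp_all add: graph_def digraph_def fin_digraph.finite_verts)
  obtain x where x: "x \<in> ?V" using assms(2) by blast
  have "?E `` {x} \<subseteq> ?V - {x}" using E by (auto simp: irrefl_def)
  then have "3 \<le> card (?V - {x})" using deg[OF x] card_mono[of "?V - {x}" "?E `` {x}"] fin by simp
  then have n: "4 \<le> n" using x fin assms(3) by simp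
  \<comment> \<open>The order of \<open>H\<close> is not given; it is read off from the number of
    cards.\<close>
  have "(card (verts H) choose (n - 2)) = (n choose (n - 2))"
    using arg_cong[OF assms(5), of size] fin assms(3) by (simp add: deck_def n_subsets)
  then have "card (verts H) = n" by (rule binomial_inj_left) (use n in simp_all)
  then obtain \<psi> where \<psi>: "bij_betw \<psi> ?V (verts H)"
    using finite_same_card_bij[OF fin] assms(3) by metis
  let ?F = "{(x, y) \<in> ?V \<times> ?V. (\<psi> x, \<psi> y) \<in> arcs_ends H}"
  have "isomorphic_on ?V ?E ?F"
  proof (rule cubic_same_deck_isomorphic[OF fin(1) assms(2) E deg])
    show "sym ?F" using F(2) by (auto simp: sym_def)
    show "irrefl ?F" using F(3) by (auto simp: irrefl_def)
    show "same_deck (card ?V - 2) ?V ?E ?F"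
      using same_deck_pullback[OF G assms(4) \<psi>] assms(3,5) by simp
  qed auto
  then obtain f where f: "f permutes ?V" "\<And>x y. (x, y) \<in> ?E \<longleftrightarrow> (f x, f y) \<in> ?F"
    unfolding isomorphic_on_def by blast
  have "digraph_iso G H"
  proof (rule digraph_isoI[OF G assms(4)])
    show "bij_betw (\<psi> \<circ> f) ?V (verts H)" using permutes_imp_bij[OF f(1)] \<psi> by (rule bij_betw_trans)
    show "(x, y) \<in> ?E \<longleftrightarrow> ((\<psi> \<circ> f) x, (\<psi> \<circ> f) y) \<in> arcs_ends H" if "x \<in> ?V" "y \<in> ?V" for x y
      using f(2)[of x y] that by (simp add: permutes_in_image[OF f(1)])
  qed
  moreover have "wf_digraph G" using G by (simp add: graph_def digraph_def fin_digraph_def)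
  ultimately show ?thesis using digraph_iso_swap by blast
qed

end
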